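(* Let $G$ be a countable amenable group. There exists a multiorder $(\tilde{\mathcal O},\nu,G)$ on $G$ whose Kolmogorov–Sinai entropy $h(\nu,G)$ is zero.
   Context: A countable amenable group means an infinite countable discrete group $G$ in which there is a Følner sequence, i.e. a sequence of finite subsets $F_n\subset G$ with $\lim_n |F_n\cap gF_n|/|F_n|=1$ for every $g\in G$. A linear order $\prec$ on $G$ is of type $\mathbb Z$ if every order interval $[a,b]^{\prec}=\{a,b\}\cup\{g\in G: a\prec g\prec b\}$ ($a\prec b$) is finite and $G$ has no minimal or maximal element. The set $\tilde{\mathcal O}$ of all orders of type $\mathbb Z$ on $G$ is a Borel subset of $\{0,1\}^{G\times G}$ (relations identified with their indicator functions, product topology), with the inherited Borel sigma-algebra. $G$ acts on $\tilde{\mathcal O}$ by: $\prec'=g(\prec)$ where $a\prec' b\iff ag\prec bg$. A multiorder on $G$ is the measure-preserving action $(\tilde{\mathcal O},\nu,G)$, where $\nu$ is a $G$-invariant Borel probability measure on $\tilde{\mathcal O}$. Entropy: for a finite measurable partition $\mathcal P$, $H(\nu,\mathcal P)=-\sum_{P\in\mathcal P}\nu(P)\log\nu(P)$; for finite $D\subset G$, $\mathcal P^D=\bigvee_{g\in D}g^{-1}(\mathcal P)$; $h(\nu,G,\mathcal P)=\lim_n\frac1{|F_n|}H(\nu,\mathcal P^{F_n})$ for any Følner sequence $(F_n)$; and $h(\nu,G)=\sup_{\mathcal P}h(\nu,G,\mathcal P)$ over finite measurable partitions $\mathcal P$. *)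

theory Defs
  imports "HOL-Algebra.Coset" "HOL-Probability.Probability"
begin

section \<open>Countable amenable groups\<close>

definition folner_sequence :: "('g, 'b) monoid_scheme \<Rightarrow> (nat \<Rightarrow> 'g set) \<Rightarrow> bool" where
  "folner_sequence G F \<longleftrightarrow>
     (\<forall>n. finite (F n) \<and> F n \<noteq> {} \<and> F n \<subseteq> carrier G) \<and>
     (\<forall>g\<in>carrier G.
        (\<lambda>n. real (card (F n \<inter> (g <#\<^bsub>G\<^esub> F n))) / real (card (F n))) \<longlonglongrightarrow> 1)"

definition countable_amenable_group :: "('g, 'b) monoid_scheme \<Rightarrow> bool" where
  "countable_amenable_group G \<longleftrightarrow>
     group G \<and> countable (carrier G) \<and> infinite (carrier G) \<and> (\<exists>F. folner_sequence G F)"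

section \<open>Orders of type Z\<close>

text \<open>Orders are strict. A relation on \<open>G\<close> is identified with its indicator function, an element
  of \<open>G \<times> G \<rightarrow>\<^sub>E {False, True}\<close>; extensionality fixes the values outside \<open>G \<times> G\<close>, so that distinct
  points are distinct relations on \<open>G\<close>.\<close>

definition rel_of :: "('g, 'b) monoid_scheme \<Rightarrow> ('g \<times> 'g \<Rightarrow> bool) \<Rightarrow> 'g rel" where
  "rel_of G f = {p \<in> carrier G \<times> carrier G. f p}"

definition order_interval :: "('g, 'b) monoid_scheme \<Rightarrow> 'g rel \<Rightarrow> 'g \<Rightarrow> 'g \<Rightarrow> 'g set" where
  "order_interval G r a b = {a, b} \<union> {g \<in> carrier G. (a, g) \<in> r \<and> (g, b) \<in> r}"

definition type_Z_order :: "('g, 'b) monoid_scheme \<Rightarrow> 'g rel \<Rightarrow> bool" where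
  "type_Z_order G r \<longleftrightarrow>
     r \<subseteq> carrier G \<times> carrier G \<and>
     strict_linear_order_on (carrier G) r \<and>
     (\<forall>(a, b)\<in>r. finite (order_interval G r a b)) \<and>
     (\<forall>a\<in>carrier G. \<exists>b\<in>carrier G. (b, a) \<in> r) \<and>
     (\<forall>a\<in>carrier G. \<exists>b\<in>carrier G. (a, b) \<in> r)"

definition relation_topology :: "('g, 'b) monoid_scheme \<Rightarrow> ('g \<times> 'g \<Rightarrow> bool) topology" where
  "relation_topology G =
     product_topology (\<lambda>_. discrete_topology (UNIV :: bool set)) (carrier G \<times> carrier G)"

definition Z_orders :: "('g, 'b) monoid_scheme \<Rightarrow> ('g \<times> 'g \<Rightarrow> bool) set" where
  "Z_orders G = {f \<in> topspace (relation_topology G). type_Z_order G (rel_of G f)}"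

definition Z_orders_borel :: "('g, 'b) monoid_scheme \<Rightarrow> ('g \<times> 'g \<Rightarrow> bool) measure" where
  "Z_orders_borel G =
     restrict_space (sigma (topspace (relation_topology G)) {U. openin (relation_topology G) U})
       (Z_orders G)"

definition order_action ::
    "('g, 'b) monoid_scheme \<Rightarrow> 'g \<Rightarrow> ('g \<times> 'g \<Rightarrow> bool) \<Rightarrow> ('g \<times> 'g \<Rightarrow> bool)" where
  "order_action G g f =
     restrict (\<lambda>(a, b). f (a \<otimes>\<^bsub>G\<^esub> g, b \<otimes>\<^bsub>G\<^esub> g)) (carrier G \<times> carrier G)"

section \<open>Multiorders\<close>

text \<open>\<^const>\<open>distr\<close> is only meaningful for a measurable map, hence the measurability clause; it
  holds for every \<open>g\<close>.\<close>

definition multiorder :: "('g, 'b) monoid_scheme \<Rightarrow> ('g \<times> 'g \<Rightarrow> bool) measure \<Rightarrow> bool" where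
  "multiorder G \<nu> \<longleftrightarrow>
     prob_space \<nu> \<and>
     space \<nu> = space (Z_orders_borel G) \<and> sets \<nu> = sets (Z_orders_borel G) \<and>
     (\<forall>g\<in>carrier G. order_action G g \<in> measurable \<nu> \<nu> \<and> distr \<nu> \<nu> (order_action G g) = \<nu>)"

section \<open>Kolmogorov--Sinai entropy of an action\<close>

definition measurable_partition :: "'x measure \<Rightarrow> 'x set set \<Rightarrow> bool" where
  "measurable_partition M P \<longleftrightarrow> finite P \<and> P \<subseteq> sets M \<and> partition_on (space M) P"

definition partition_entropy :: "'x measure \<Rightarrow> 'x set set \<Rightarrow> real" where
  "partition_entropy M P = - (\<Sum>A\<in>P. measure M A * ln (measure M A))"

definition preimage_partition :: "'x measure \<Rightarrow> ('x \<Rightarrow> 'x) \<Rightarrow> 'x set set \<Rightarrow> 'x set set" where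
  "preimage_partition M T P = (\<lambda>A. T -` A \<inter> space M) ` P"

definition iterated_partition ::
    "'x measure \<Rightarrow> ('g \<Rightarrow> 'x \<Rightarrow> 'x) \<Rightarrow> 'x set set \<Rightarrow> 'g set \<Rightarrow> 'x set set" where
  "iterated_partition M T P D = common_refinement ((\<lambda>g. preimage_partition M (T g) P) ` D)"

text \<open>The common value of the limit along all Folner sequences. It exists for every
  measure-preserving action of an amenable group, but this is a theorem, not part of the
  definition.\<close>

definition entropy_of_partition ::
    "('g, 'b) monoid_scheme \<Rightarrow> 'x measure \<Rightarrow> ('g \<Rightarrow> 'x \<Rightarrow> 'x) \<Rightarrow> 'x set set \<Rightarrow> real" where
  "entropy_of_partition G M T P =
     (THE h. \<forall>F. folner_sequence G F \<longrightarrow>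
        (\<lambda>n. partition_entropy M (iterated_partition M T P (F n)) / real (card (F n)))
          \<longlonglongrightarrow> h)"

definition KS_entropy ::
    "('g, 'b) monoid_scheme \<Rightarrow> 'x measure \<Rightarrow> ('g \<Rightarrow> 'x \<Rightarrow> 'x) \<Rightarrow> ereal" where
  "KS_entropy G M T =
     (SUP P\<in>{P. measurable_partition M P}. ereal (entropy_of_partition G M T P))"

end

theory Submission
  imports Defs "HOL-Complex_Analysis.Great_Picard"
begin

text \<open>Tile a very invariant finite set by disjoint pieces of translates of a smaller one, tile the
  smaller one likewise, and so on. A point of the resulting inverse limit records the positions of
  the unit element in its tiles of all levels; translating the unit element gives an action of the
  group on almost all points, and it preserves every limit of the uniform distributions on the tiles.
  Ordering the pieces inside each tile lexicographically orders the group so that tiles are intervals.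
  As any two elements eventually lie in a common tile, intervals are finite, and by invariance there is
  almost surely no minimal or maximal element.

  The coverings are greedy: translates of the tile are chosen in boundedly many batches, each nearly
  disjoint, so that few pairs \<open>g\<close>, \<open>k \<otimes> g\<close> are separated. No Ornstein--Weiss quasi-tiling by several
  shapes is needed: pieces may be arbitrary subsets of the tile, because a window of a covering
  is determined by the few centers near it. Hence it shows subexponentially many patterns. Since the
  tiling of any level is a function of the tilings of higher levels, every finite partition is
  approximated by the position in a tile of high level, and its names are few, so the entropy is zero.\<close>

section \<open>Greedy coverings by batches of tiles\<close>

text \<open>The obstacle is that pieces are arbitrary subsets of the tile. The position map from
  level \<open>n + 1\<close> to level \<open>n\<close> may overload a few positions, and a set of
  small density inside a tile may become frequent several levels up. Only the sets
  \<open>Bad n\<close> have to be kept rare: the points whose \<open>K n\<close>-neighbours may lie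
  in another piece or whose window is atypical. Each \<open>Bad n\<close> is charged with weight
  \<open>2 ^ n\<close>. Its density is at most \<open>(1 / 4) ^ n / 8\<close> when it arises, so the
  charges add a summable amount, and a new tiling raises the mean weight by a factor
  \<open>1 + \<epsilon>\<close> at most, with summable \<epsilon>. The mean weight stays below 3,
  and by Markov's inequality \<open>Bad n\<close> has frequency at most
  \<open>3 * (1 / 2) ^ n\<close> seen from every higher level. Summability of this bound yields both
  the almost sure definition of the action and its invariance. The quantifiers are ordered
  accordingly: the window \<open>B\<close> in which patterns are counted comes after the tile, since
  it must be large compared with it, and before the next tile, which must be almost invariant under
  it.\<close>

text \<open>A point lying in two tiles of the first batch that meets it stays unassigned. Hence the
  assignment is a local function of the batches, which are unordered sets: this is what keeps the
  number of its local patterns small.\<close>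

primrec asg :: "('c \<Rightarrow> 'a \<Rightarrow> bool) \<Rightarrow> 'c set list \<Rightarrow> 'a \<Rightarrow> 'c option" where
  "asg D [] g = None"
| "asg D (C # Cs) g =
     (let S = {c \<in> C. D c g} in
      if S = {} then asg D Cs g else if is_singleton S then Some (the_elem S) else None)"

lemma asg_SomeD:
  assumes "asg D Cs g = Some c"
  shows "c \<in> \<Union>(set Cs)" "D c g"
proof -
  have "c \<in> \<Union>(set Cs) \<and> D c g"
    using assms
  proof (induction Cs)
    case (Cons C Cs)
    then show ?case
      by (auto simp: Let_def is_singleton_def split: if_splits)
  qed simp
  then show "c \<in> \<Union>(set Cs)" "D c g" by auto
qed

lemma sum_card_swap:
  assumes "finite A" "finite X"
  shows "(\<Sum>c\<in>A. real (card {g\<in>X. P c g})) = (\<Sum>g\<in>X. real (card {c\<in>A. P c g}))"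
proof -
  have "(\<Sum>c\<in>A. real (card {g\<in>X. P c g})) = (\<Sum>c\<in>A. \<Sum>g\<in>X. if P c g then 1 else 0)"
    using assms by (simp add: sum.If_cases Int_def)
  also have "\<dots> = (\<Sum>g\<in>X. \<Sum>c\<in>A. if P c g then 1 else 0)" by (rule sum.swap)
  also have "\<dots> = (\<Sum>g\<in>X. real (card {c\<in>A. P c g}))"
    using assms by (simp add: sum.If_cases Int_def)
  finally show ?thesis .
qed

lemma sum_filter_swap:
  fixes f :: "'c \<Rightarrow> 'a \<Rightarrow> real"
  assumes "finite A" "finite X"
  shows "(\<Sum>c\<in>A. \<Sum>g\<in>{g\<in>X. P c g}. f c g) = (\<Sum>g\<in>X. \<Sum>c\<in>{c\<in>A. P c g}. f c g)"
proof -
  have "(\<Sum>c\<in>A. \<Sum>g\<in>{g\<in>X. P c g}. f c g) = (\<Sum>c\<in>A. \<Sum>g\<in>X. if P c g then f c g else 0)"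
    using assms by (simp add: sum.inter_filter)
  also have "\<dots> = (\<Sum>g\<in>X. \<Sum>c\<in>A. if P c g then f c g else 0)" by (rule sum.swap)
  also have "\<dots> = (\<Sum>g\<in>X. \<Sum>c\<in>{c\<in>A. P c g}. f c g)"
    using assms by (simp add: sum.inter_filter)
  finally show ?thesis .
qed

text \<open>Abstract form of covering \<open>F\<close> by translates of one tile: \<open>A\<close>
  holds the possible centers, \<open>D c g\<close> says that the tile at \<open>c\<close> contains
  \<open>g\<close>, and \<open>t\<close> is the size of the tile. \<open>\<rho>_sum\<close>
  normalizes the weight to mean at most 1 over the tiles through a point. \<open>cut_sum\<close>
  expresses almost invariance of the tile: on average a center separates few of the pairs in
  \<open>E\<close>. \<alpha> measures how much of \<open>F\<close> may stay uncovered, \<epsilon>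
  the permitted relative excess of weight.\<close>

locale greedy =
  fixes F :: "'a set" and A :: "'c set" and D :: "'c \<Rightarrow> 'a \<Rightarrow> bool"
    and \<rho> :: "'c \<Rightarrow> 'a \<Rightarrow> real" and E :: "('a \<times> 'a) set" and t \<alpha> \<epsilon> :: real
  assumes finF: "finite F" and F_ne: "F \<noteq> {}"
    and finA: "finite A" and card_A: "card A \<le> 2 * card F"
    and E_sub: "E \<subseteq> F \<times> F"
    and t_pos: "0 < t" and \<alpha>: "0 < \<alpha>" "\<alpha> \<le> 1" and \<epsilon>: "0 < \<epsilon>" "\<epsilon> \<le> 1"
    and \<rho>_nonneg: "\<And>c g. 0 \<le> \<rho> c g"
    and deg: "\<And>g. g \<in> F \<Longrightarrow> real (card {c\<in>A. D c g}) = t"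
    and \<rho>_sum: "\<And>g. g \<in> F \<Longrightarrow> (\<Sum>c\<in>{c\<in>A. D c g}. \<rho> c g) \<le> t"
    and cut_sum: "\<And>U. U \<subseteq> F \<Longrightarrow>
      (\<Sum>c\<in>A. real (card {(g, h)\<in>E. g \<in> U \<and> h \<in> U \<and> D c g \<noteq> D c h})) \<le> \<epsilon> * \<alpha> / 16 * t * card U"
begin

definition cut where "cut c U = real (card {(g, h)\<in>E. g \<in> U \<and> h \<in> U \<and> D c g \<noteq> D c h})"
definition cov where "cov C U = {g\<in>U. \<exists>c\<in>C. D c g}"
definition uni where "uni C U = {g\<in>U. is_singleton {c\<in>C. D c g}}"

text \<open>A center \<open>c\<close> is added to the batch only if what it newly covers outweighs its weight \<open>\<rho>\<close>, the
  pairs of \<open>E\<close> that it cuts, its overlap with the batch, and a flat fee that bounds the number of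
  centers. Such a \<open>c\<close> exists because the inequality holds on average over all centers, as long as
  the batch covers only a small fraction of \<open>U\<close>.\<close>

definition cost where
  "cost C U = (\<Sum>g\<in>uni C U. \<Sum>c\<in>{c\<in>C. D c g}. \<rho> c g) + 2 / \<alpha> * (\<Sum>c\<in>C. cut c U)
     + 2 / \<alpha> * card (cov C U - uni C U) + \<epsilon> * \<alpha> * t / 16 * card C"

lemma finE: "finite E"
  using E_sub finF by (meson finite_SigmaI finite_subset)

text \<open>Sum the reverse inequality over all centers. By double counting the new points give
  \<open>(1 + \<epsilon>) * t * card (U - V)\<close>, the weights at most
  \<open>t * card (U - V)\<close>, and each of the other three terms at most
  \<open>\<epsilon> / 8 * t * card U\<close>. Hence \<open>U - V\<close> would be at most 3/8 of
  \<open>U\<close>, whereas \<open>V\<close> is less than 1/16 of it.\<close>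

lemma step_exists:
  assumes U: "U \<subseteq> F" "\<alpha> * card F \<le> card U" and V: "V \<subseteq> U" "card V < \<epsilon> * \<alpha> / 16 * card U"
  shows "\<exists>c\<in>A. (\<Sum>g\<in>{g\<in>U - V. D c g}. \<rho> c g) + 2 / \<alpha> * cut c U + 2 / \<alpha> * card {g\<in>V. D c g}
      + \<epsilon> * \<alpha> * t / 16 < (1 + \<epsilon>) * card {g\<in>U - V. D c g}"
proof (rule ccontr)
  assume "\<not> ?thesis"
  then have "(\<Sum>c\<in>A. (1 + \<epsilon>) * card {g\<in>U - V. D c g})
    \<le> (\<Sum>c\<in>A. (\<Sum>g\<in>{g\<in>U - V. D c g}. \<rho> c g) + 2 / \<alpha> * cut c U + 2 / \<alpha> * card {g\<in>V. D c g}
      + \<epsilon> * \<alpha> * t / 16)"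
    by (intro sum_mono) (simp add: not_less)
  then have 1: "(1 + \<epsilon>) * (\<Sum>c\<in>A. real (card {g\<in>U - V. D c g}))
    \<le> (\<Sum>c\<in>A. \<Sum>g\<in>{g\<in>U - V. D c g}. \<rho> c g) + 2 / \<alpha> * (\<Sum>c\<in>A. cut c U)
       + 2 / \<alpha> * (\<Sum>c\<in>A. real (card {g\<in>V. D c g})) + \<epsilon> * \<alpha> * t / 16 * card A"
    by (simp add: sum.distrib sum_distrib_left mult.commute)
  have fin: "finite U" "finite V" "finite (U - V)"
    using U V finF by (auto intro: finite_subset)
  have sumD: "(\<Sum>c\<in>A. real (card {g\<in>X. D c g})) = t * card X" if "X \<subseteq> F" for X
  proof -
    have "finite X" using that finF finite_subset by blast
    then have "(\<Sum>c\<in>A. real (card {g\<in>X. D c g})) = (\<Sum>g\<in>X. t)"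
      unfolding sum_card_swap[OF finA \<open>finite X\<close>] using that deg by (intro sum.cong) auto
    then show ?thesis by simp
  qed
  have c1: "(\<Sum>c\<in>A. \<Sum>g\<in>{g\<in>U - V. D c g}. \<rho> c g) \<le> t * card (U - V)"
  proof -
    have "(\<Sum>c\<in>A. \<Sum>g\<in>{g\<in>U - V. D c g}. \<rho> c g) \<le> (\<Sum>g\<in>U - V. t)"
      unfolding sum_filter_swap[OF finA fin(3)] using U \<rho>_sum by (intro sum_mono) auto
    then show ?thesis by (simp add: mult.commute)
  qed
  have c2: "2 / \<alpha> * (\<Sum>c\<in>A. cut c U) \<le> \<epsilon> / 8 * t * card U"
  proof -
    have "2 / \<alpha> * (\<Sum>c\<in>A. cut c U) \<le> 2 / \<alpha> * (\<epsilon> * \<alpha> / 16 * t * card U)"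
      unfolding cut_def using \<alpha> cut_sum[OF U(1)] by (intro mult_left_mono) auto
    then show ?thesis using \<alpha> by (simp add: field_simps)
  qed
  have c3: "2 / \<alpha> * (t * card V) \<le> \<epsilon> / 8 * t * card U"
  proof -
    have "2 / \<alpha> * (t * card V) \<le> 2 / \<alpha> * (t * (\<epsilon> * \<alpha> / 16 * card U))"
      using \<alpha> t_pos V by (intro mult_left_mono) auto
    then show ?thesis using \<alpha> by (simp add: field_simps)
  qed
  \<comment> \<open>The fees of all centers are proportional to \<open>card F\<close>; the lower
    bound on \<open>card U\<close> makes them comparable with \<open>card U\<close>.\<close>
  have c4: "\<epsilon> * \<alpha> * t / 16 * card A \<le> \<epsilon> / 8 * t * card U"
  proof -
    have "real (card A) \<le> 2 * card F" using card_A by linarith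
    then have "\<epsilon> * \<alpha> * t / 16 * card A \<le> \<epsilon> * \<alpha> * t / 16 * (2 * card F)"
      using \<alpha> t_pos \<epsilon> by (intro mult_left_mono) auto
    also have "\<dots> = \<epsilon> / 8 * t * (\<alpha> * card F)" by simp
    also have "\<dots> \<le> \<epsilon> / 8 * t * card U"
      using t_pos \<epsilon> U by (intro mult_left_mono) auto
    finally show ?thesis .
  qed
  have "U - V \<subseteq> F" "V \<subseteq> F" using U V by auto
  note sums = sumD[OF this(1)] sumD[OF this(2)]
  have 2: "(1 + \<epsilon>) * (t * card (U - V)) \<le> t * card (U - V) + 3 * (\<epsilon> / 8 * t * card U)"
    using 1[unfolded sums] c1 c2 c3 c4 by linarith
  then have "\<epsilon> * t * card (U - V) \<le> \<epsilon> * t * (3 / 8 * card U)"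
    by (simp add: algebra_simps)
  then have "card (U - V) \<le> 3 / 8 * real (card U)"
    using \<epsilon> t_pos by (simp add: mult_le_cancel_left)
  moreover have "real (card (U - V)) = card U - card V"
    using card_Diff_subset[OF fin(2) V(1)] card_mono[OF fin(1) V(1)] by simp
  moreover have "card V < 1 / 16 * real (card U)"
  proof -
    have "\<epsilon> * \<alpha> \<le> 1" using \<alpha> \<epsilon> by (simp add: mult_le_one)
    then have "\<epsilon> * \<alpha> / 16 * card U \<le> 1 / 16 * real (card U)" by (intro mult_right_mono) auto
    then show ?thesis using V by linarith
  qed
  moreover have "0 < card U"
    using U \<alpha> F_ne finF by (metis card_gt_0_iff mult_pos_pos of_nat_0_less_iff order_less_le_trans)
  ultimately show False by linarith
qed

text \<open>Points covered once and met again by \<open>c\<close> leave \<open>uni\<close> and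
  become multiply covered; newly covered points enter \<open>uni\<close> with the weight of
  \<open>c\<close> alone. Only an inequality results, since the bound keeps the weights of points
  that leave \<open>uni\<close> and counts again those already multiply covered.\<close>

lemma cost_insert:
  assumes C: "C \<subseteq> A" "U \<subseteq> F" and c: "c \<in> A" "c \<notin> C"
  shows "cost (insert c C) U \<le> cost C U + (\<Sum>g\<in>{g\<in>U - cov C U. D c g}. \<rho> c g) + 2 / \<alpha> * cut c U
      + 2 / \<alpha> * card {g\<in>cov C U. D c g} + \<epsilon> * \<alpha> * t / 16"
proof -
  have fin: "finite C" "finite U" using C finA finF finite_subset by auto
  have set: "{c'\<in>insert c C. D c' g} = (if D c g then insert c {c'\<in>C. D c' g} else {c'\<in>C. D c' g})" for g
    by auto
  have sing: "is_singleton (insert c {c'\<in>C. D c' g}) \<longleftrightarrow> {c'\<in>C. D c' g} = {}" for g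
    using c by (auto simp: is_singleton_def)
  have uni: "uni (insert c C) U = {g\<in>uni C U. \<not> D c g} \<union> {g\<in>U - cov C U. D c g}"
  proof (rule Set.set_eqI)
    fix g
    have "g \<in> uni (insert c C) U \<longleftrightarrow>
      g \<in> U \<and> is_singleton (if D c g then insert c {c'\<in>C. D c' g} else {c'\<in>C. D c' g})"
      by (simp only: uni_def mem_Collect_eq set)
    also have "\<dots> \<longleftrightarrow> g \<in> {g\<in>uni C U. \<not> D c g} \<union> {g\<in>U - cov C U. D c g}"
      using sing[of g] by (cases "D c g") (auto simp: uni_def cov_def)
    finally show "g \<in> uni (insert c C) U \<longleftrightarrow> g \<in> {g\<in>uni C U. \<not> D c g} \<union> {g\<in>U - cov C U. D c g}" .
  qed
  have "(\<Sum>g\<in>uni (insert c C) U. \<Sum>c\<in>{c'\<in>insert c C. D c' g}. \<rho> c g)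
    = (\<Sum>g\<in>{g\<in>uni C U. \<not> D c g}. \<Sum>c\<in>{c'\<in>insert c C. D c' g}. \<rho> c g)
     + (\<Sum>g\<in>{g\<in>U - cov C U. D c g}. \<Sum>c\<in>{c'\<in>insert c C. D c' g}. \<rho> c g)"
    unfolding uni using fin by (intro sum.union_disjoint) (auto simp: uni_def)
  also have "(\<Sum>g\<in>{g\<in>uni C U. \<not> D c g}. \<Sum>c\<in>{c'\<in>insert c C. D c' g}. \<rho> c g)
     = (\<Sum>g\<in>{g\<in>uni C U. \<not> D c g}. \<Sum>c\<in>{c'\<in>C. D c' g}. \<rho> c g)"
    by (intro sum.cong) (auto simp: set)
  also have "\<dots> \<le> (\<Sum>g\<in>uni C U. \<Sum>c\<in>{c'\<in>C. D c' g}. \<rho> c g)"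
    using fin \<rho>_nonneg by (intro sum_mono2) (auto simp: uni_def intro!: sum_nonneg)
  also have "(\<Sum>g\<in>{g\<in>U - cov C U. D c g}. \<Sum>c\<in>{c'\<in>insert c C. D c' g}. \<rho> c g)
     = (\<Sum>g\<in>{g\<in>U - cov C U. D c g}. \<rho> c g)"
  proof (rule sum.cong)
    fix g assume "g \<in> {g\<in>U - cov C U. D c g}"
    then have "{c'\<in>insert c C. D c' g} = {c}" by (auto simp: cov_def)
    then show "(\<Sum>c\<in>{c'\<in>insert c C. D c' g}. \<rho> c g) = \<rho> c g" by simp
  qed simp
  finally have 1: "(\<Sum>g\<in>uni (insert c C) U. \<Sum>c\<in>{c'\<in>insert c C. D c' g}. \<rho> c g)
     \<le> (\<Sum>g\<in>uni C U. \<Sum>c\<in>{c'\<in>C. D c' g}. \<rho> c g) + (\<Sum>g\<in>{g\<in>U - cov C U. D c g}. \<rho> c g)"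
    by simp
  have "cov (insert c C) U - uni (insert c C) U \<subseteq> (cov C U - uni C U) \<union> {g\<in>cov C U. D c g}"
    unfolding uni by (auto simp: cov_def)
  then have "card (cov (insert c C) U - uni (insert c C) U)
      \<le> card ((cov C U - uni C U) \<union> {g\<in>cov C U. D c g})"
    using fin by (intro card_mono) (auto simp: cov_def uni_def)
  also have "\<dots> \<le> card (cov C U - uni C U) + card {g\<in>cov C U. D c g}"
    by (rule card_Un_le)
  finally have "real (card (cov (insert c C) U - uni (insert c C) U))
     \<le> card (cov C U - uni C U) + card {g\<in>cov C U. D c g}" by linarith
  then have "2 / \<alpha> * real (card (cov (insert c C) U - uni (insert c C) U))
     \<le> 2 / \<alpha> * (card (cov C U - uni C U) + card {g\<in>cov C U. D c g})"
    using \<alpha> by (intro mult_left_mono) auto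
  then show ?thesis
    using 1 fin c unfolding cost_def by (simp add: algebra_simps add_divide_distrib)
qed

text \<open>Take a batch of maximal coverage among those whose cost is paid for by the points they
  cover. If it covered too little, \<open>step_exists\<close> would supply one more center.\<close>

lemma batch_exists:
  assumes U: "U \<subseteq> F" "\<alpha> * card F \<le> card U"
  shows "\<exists>C\<subseteq>A. \<epsilon> * \<alpha> / 16 * card U \<le> card (cov C U) \<and> cost C U \<le> (1 + \<epsilon>) * card (cov C U)"
proof -
  have finU: "finite U" using U finF finite_subset by auto
  define P where "P C \<longleftrightarrow> C \<subseteq> A \<and> cost C U \<le> (1 + \<epsilon>) * card (cov C U)" for C
  have "P {}" by (simp add: P_def cost_def cov_def uni_def is_singleton_def)
  moreover have "\<forall>C. P C \<longrightarrow> card (cov C U) \<le> card U"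
    using finU by (auto simp: cov_def intro!: card_mono)
  ultimately have "\<exists>C. P C \<and> (\<forall>C'. P C' \<longrightarrow> card (cov C' U) \<le> card (cov C U))"
    using ex_has_greatest_nat[of P "{}" "\<lambda>C. card (cov C U)" "Suc (card U)"] by (simp add: less_Suc_eq_le)
  then obtain C where C: "P C" "\<And>C'. P C' \<Longrightarrow> card (cov C' U) \<le> card (cov C U)"
    by auto
  have "\<epsilon> * \<alpha> / 16 * card U \<le> card (cov C U)"
  proof (rule ccontr)
    assume "\<not> ?thesis"
    then obtain c where c: "c \<in> A" and less:
      "(\<Sum>g\<in>{g\<in>U - cov C U. D c g}. \<rho> c g) + 2 / \<alpha> * cut c U + 2 / \<alpha> * card {g\<in>cov C U. D c g}
      + \<epsilon> * \<alpha> * t / 16 < (1 + \<epsilon>) * card {g\<in>U - cov C U. D c g}"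
      using step_exists[OF U, of "cov C U"] by (auto simp: cov_def)
    \<comment> \<open>The fee is positive, so the right side of the strict inequality is positive
      too: the additional center covers at least one new point, which contradicts
      maximality.\<close>
    have "0 \<le> (\<Sum>g\<in>{g\<in>U - cov C U. D c g}. \<rho> c g)" using \<rho>_nonneg by (intro sum_nonneg) auto
    moreover have "0 \<le> 2 / \<alpha> * cut c U" using \<alpha> by (simp add: cut_def)
    moreover have "0 \<le> 2 / \<alpha> * card {g\<in>cov C U. D c g}" using \<alpha> by simp
    moreover have "0 < \<epsilon> * \<alpha> * t / 16" using \<alpha> \<epsilon> t_pos by simp
    ultimately have "0 < (1 + \<epsilon>) * card {g\<in>U - cov C U. D c g}" using less by linarith
    then have pos: "0 < card {g\<in>U - cov C U. D c g}"
      by (metis mult_zero_right neq0_conv of_nat_0 less_irrefl)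
    then have "c \<notin> C" by (auto simp: cov_def card_gt_0_iff)
    have cov: "cov (insert c C) U = cov C U \<union> {g\<in>U - cov C U. D c g}" by (auto simp: cov_def)
    have card: "card (cov (insert c C) U) = card (cov C U) + card {g\<in>U - cov C U. D c g}"
      unfolding cov using finU by (intro card_Un_disjoint) (auto simp: cov_def)
    have "cost (insert c C) U \<le> (1 + \<epsilon>) * card (cov (insert c C) U)"
      using cost_insert[of C U c] C(1) U c \<open>c \<notin> C\<close> less unfolding card P_def
      by (simp add: algebra_simps)
    then have "P (insert c C)" using C(1) c by (auto simp: P_def)
    from C(2)[OF this] card pos show False by linarith
  qed
  then show ?thesis using C(1) by (auto simp: P_def)
qed

text \<open>Batches are chosen one after another on the points not yet covered, until fewer than
  \<open>\<alpha> * card F\<close> remain. Each removes at least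
  \<open>\<epsilon> * \<alpha>\<^sup>2 / 16 * card F\<close> points, which bounds their number; the
  costs add up because successive batches are charged to disjoint sets. The number \<open>m\<close>
  accounts for the points left unassigned because they are covered several times.\<close>

lemma batches_exist:
  assumes "U \<subseteq> F"
  shows "\<exists>Cs m. (\<forall>C\<in>set Cs. C \<subseteq> A) \<and> \<epsilon> * \<alpha>\<^sup>2 / 16 * card F * length Cs \<le> card U \<and> 0 \<le> m
    \<and> card {g\<in>U. asg D Cs g = None} \<le> m + \<alpha> * card F
    \<and> (\<Sum>g\<in>U. case asg D Cs g of None \<Rightarrow> 0 | Some c \<Rightarrow> \<rho> c g)
      + 2 / \<alpha> * card {(g, h)\<in>E. g \<in> U \<and> h \<in> U \<and> asg D Cs g \<noteq> asg D Cs h}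
      + 2 / \<alpha> * m + \<epsilon> * \<alpha> * t / 16 * (\<Sum>C\<leftarrow>Cs. card C) \<le> (1 + \<epsilon>) * card U"
  using assms
proof (induction "card U" arbitrary: U rule: less_induct)
  case less
  have finU: "finite U" using less.prems finF finite_subset by auto
  show ?case
  proof (cases "\<alpha> * card F \<le> card U")
    case False
    show ?thesis
      using False \<epsilon> by (intro exI[of _ "[]"] exI[of _ 0]) auto
  next
    case True
    obtain C where C: "C \<subseteq> A" "\<epsilon> * \<alpha> / 16 * card U \<le> card (cov C U)"
      "cost C U \<le> (1 + \<epsilon>) * card (cov C U)"
      using batch_exists[OF less.prems True] by auto
    define U' where "U' = U - cov C U"
    have covU: "cov C U \<subseteq> U" by (auto simp: cov_def)
    have card_U: "card U = card U' + card (cov C U)"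
      using covU finU unfolding U'_def
      by (metis card_Diff_subset card_mono finite_subset le_add_diff_inverse2)
    have Fpos: "0 < card F" using F_ne finF by (simp add: card_gt_0_iff)
    have ge: "\<epsilon> * \<alpha>\<^sup>2 / 16 * card F \<le> card (cov C U)"
    proof -
      have "\<epsilon> * \<alpha>\<^sup>2 / 16 * card F = \<epsilon> * \<alpha> / 16 * (\<alpha> * card F)" by (simp add: power2_eq_square)
      also have "\<dots> \<le> \<epsilon> * \<alpha> / 16 * card U" using True \<alpha> \<epsilon> by (intro mult_left_mono) auto
      finally show ?thesis using C by linarith
    qed
    moreover have "0 < \<epsilon> * \<alpha>\<^sup>2 / 16 * card F" using Fpos \<alpha> \<epsilon> by simp
    ultimately have "0 < card (cov C U)" by linarith
    then have "card U' < card U" using card_U by linarith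
    moreover have "U' \<subseteq> F" using less.prems by (auto simp: U'_def)
    ultimately obtain Cs m where IH: "\<forall>C\<in>set Cs. C \<subseteq> A"
      "\<epsilon> * \<alpha>\<^sup>2 / 16 * card F * length Cs \<le> card U'" "0 \<le> m"
      "card {g\<in>U'. asg D Cs g = None} \<le> m + \<alpha> * card F"
      "(\<Sum>g\<in>U'. case asg D Cs g of None \<Rightarrow> 0 | Some c \<Rightarrow> \<rho> c g)
      + 2 / \<alpha> * card {(g, h)\<in>E. g \<in> U' \<and> h \<in> U' \<and> asg D Cs g \<noteq> asg D Cs h}
      + 2 / \<alpha> * m + \<epsilon> * \<alpha> * t / 16 * (\<Sum>C\<leftarrow>Cs. card C) \<le> (1 + \<epsilon>) * card U'"
      using less.hyps by blast
    have asg_U': "asg D (C # Cs) g = asg D Cs g" if "g \<in> U'" for g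
      using that by (auto simp: U'_def cov_def)
    have asg_mul: "asg D (C # Cs) g = None" if "g \<in> cov C U - uni C U" for g
      using that by (auto simp: uni_def cov_def Let_def)
    have asg_uni: "asg D (C # Cs) g = Some (the_elem {c\<in>C. D c g})" if "g \<in> uni C U" for g
      using that by (auto simp: uni_def is_singleton_def Let_def)
    have sub: "uni C U \<subseteq> cov C U"
    proof
      fix g assume "g \<in> uni C U"
      then obtain c where "{c\<in>C. D c g} = {c}" "g \<in> U" by (auto simp: uni_def is_singleton_def)
      then show "g \<in> cov C U" by (auto simp: cov_def)
    qed
    define M where "M = cov C U - uni C U"
    have split: "U = U' \<union> (uni C U \<union> M)" using covU sub by (auto simp: U'_def M_def)
    have fins: "finite U'" "finite (uni C U)" "finite M"
      using split finU by (metis finite_Un)+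
    let ?f = "\<lambda>Cs g. case asg D Cs g of None \<Rightarrow> 0 | Some c \<Rightarrow> \<rho> c g"
    have "(\<Sum>g\<in>U. ?f (C # Cs) g) = (\<Sum>g\<in>U' \<union> (uni C U \<union> M). ?f (C # Cs) g)"
      using split by simp
    also have "\<dots> = (\<Sum>g\<in>U'. ?f (C # Cs) g) + ((\<Sum>g\<in>uni C U. ?f (C # Cs) g) + (\<Sum>g\<in>M. ?f (C # Cs) g))"
      using fins sub by (subst sum.union_disjoint; (subst sum.union_disjoint)?) (auto simp: U'_def M_def)
    also have "(\<Sum>g\<in>U'. ?f (C # Cs) g) = (\<Sum>g\<in>U'. ?f Cs g)"
      using asg_U' by (intro sum.cong) auto
    also have "(\<Sum>g\<in>M. ?f (C # Cs) g) = 0"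
      using asg_mul by (intro sum.neutral) (auto simp: M_def simp del: asg.simps)
    also have "(\<Sum>g\<in>uni C U. ?f (C # Cs) g) = (\<Sum>g\<in>uni C U. \<Sum>c\<in>{c\<in>C. D c g}. \<rho> c g)"
    proof (rule sum.cong)
      fix g assume g: "g \<in> uni C U"
      then obtain c where c: "{c\<in>C. D c g} = {c}" by (auto simp: uni_def is_singleton_def)
      then show "?f (C # Cs) g = (\<Sum>c\<in>{c\<in>C. D c g}. \<rho> c g)"
        unfolding asg_uni[OF g] c by simp
    qed simp
    finally have s1: "(\<Sum>g\<in>U. ?f (C # Cs) g)
      = (\<Sum>g\<in>U'. ?f Cs g) + (\<Sum>g\<in>uni C U. \<Sum>c\<in>{c\<in>C. D c g}. \<rho> c g)" by simp
    have finC: "finite C" using C finA finite_subset by auto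
    let ?cut = "\<lambda>c. {(g, h)\<in>E. g \<in> U \<and> h \<in> U \<and> D c g \<noteq> D c h}"
    let ?sep' = "{(g, h)\<in>E. g \<in> U' \<and> h \<in> U' \<and> asg D Cs g \<noteq> asg D Cs h}"
    have fincut: "finite (?cut c)" for c by (rule finite_subset[OF _ finE]) auto
    have finsep: "finite ?sep'" by (rule finite_subset[OF _ finE]) auto
    \<comment> \<open>If no center of the batch cuts the pair, both points see the same subset of
      the batch. Either it is nonempty and decides both assignments alike, or both points pass on to
      the later batches.\<close>
    have "{(g, h)\<in>E. g \<in> U \<and> h \<in> U \<and> asg D (C # Cs) g \<noteq> asg D (C # Cs) h} \<subseteq> (\<Union>c\<in>C. ?cut c) \<union> ?sep'"
    proof (rule subsetI, rule ccontr)
      fix p assume p: "p \<in> {(g, h)\<in>E. g \<in> U \<and> h \<in> U \<and> asg D (C # Cs) g \<noteq> asg D (C # Cs) h}"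
        and no': "p \<notin> (\<Union>c\<in>C. ?cut c) \<union> ?sep'"
      then obtain g h where "p = (g, h)" and
        gh: "(g, h) \<in> E" "g \<in> U" "h \<in> U" "asg D (C # Cs) g \<noteq> asg D (C # Cs) h" by blast
      then have no: "(g, h) \<notin> ?sep'" and "(g, h) \<notin> (\<Union>c\<in>C. ?cut c)" using no' by blast+
      then have eq: "{c\<in>C. D c g} = {c\<in>C. D c h}" using gh by auto
      show False
      proof (cases "{c\<in>C. D c h} = {}")
        case True
        then have "g \<in> U'" "h \<in> U'" using gh eq by (auto simp: U'_def cov_def)
        then show False using gh no asg_U' by auto
      next
        case False
        show False using gh(4) unfolding asg.simps Let_def eq by (simp only: False if_False simp_thms)
      qed
    qed
    then have "card {(g, h)\<in>E. g \<in> U \<and> h \<in> U \<and> asg D (C # Cs) g \<noteq> asg D (C # Cs) h}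
        \<le> card ((\<Union>c\<in>C. ?cut c) \<union> ?sep')"
      using finC fincut finsep by (intro card_mono) auto
    also have "\<dots> \<le> card (\<Union>c\<in>C. ?cut c) + card ?sep'" by (rule card_Un_le)
    also have "\<dots> \<le> (\<Sum>c\<in>C. card (?cut c)) + card ?sep'"
      using card_UN_le[OF finC, of ?cut] by simp
    finally have s2: "real (card {(g, h)\<in>E. g \<in> U \<and> h \<in> U \<and> asg D (C # Cs) g \<noteq> asg D (C # Cs) h})
       \<le> (\<Sum>c\<in>C. cut c U) + card ?sep'" unfolding cut_def by (simp flip: of_nat_sum of_nat_add)
    have "{g\<in>U. asg D (C # Cs) g = None} \<subseteq> {g\<in>U'. asg D Cs g = None} \<union> M"
    proof (rule subsetI)
      fix g assume g: "g \<in> {g\<in>U. asg D (C # Cs) g = None}"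
      then consider "g \<in> U'" | "g \<in> uni C U" | "g \<in> M" using split by blast
      then show "g \<in> {g\<in>U'. asg D Cs g = None} \<union> M"
      proof cases
        case 1
        then show ?thesis using g asg_U'[OF 1] by (simp del: asg.simps)
      next
        case 2
        then show ?thesis using g asg_uni[OF 2] by (simp del: asg.simps)
      qed simp
    qed
    then have "card {g\<in>U. asg D (C # Cs) g = None} \<le> card ({g\<in>U'. asg D Cs g = None} \<union> M)"
      using fins by (intro card_mono) auto
    also have "\<dots> \<le> card {g\<in>U'. asg D Cs g = None} + card M" by (rule card_Un_le)
    finally have s3: "real (card {g\<in>U. asg D (C # Cs) g = None}) \<le> (m + card M) + \<alpha> * card F"
      using IH(4) by linarith
    have s2': "2 / \<alpha> * real (card {(g, h)\<in>E. g \<in> U \<and> h \<in> U \<and> asg D (C # Cs) g \<noteq> asg D (C # Cs) h})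
       \<le> 2 / \<alpha> * (\<Sum>c\<in>C. cut c U) + 2 / \<alpha> * card ?sep'"
      using mult_left_mono[OF s2, of "2 / \<alpha>"] \<alpha> by (simp add: algebra_simps)
    have c3: "(\<Sum>g\<in>uni C U. \<Sum>c\<in>{c\<in>C. D c g}. \<rho> c g) + 2 / \<alpha> * (\<Sum>c\<in>C. cut c U)
     + 2 / \<alpha> * card M + \<epsilon> * \<alpha> * t / 16 * card C \<le> (1 + \<epsilon>) * card (cov C U)"
      using C(3) by (simp add: cost_def M_def)
    have e1: "2 / \<alpha> * (m + real (card M)) = 2 / \<alpha> * m + 2 / \<alpha> * card M" by (rule distrib_left)
    have e2: "\<epsilon> * \<alpha> * t / 16 * (\<Sum>C\<leftarrow>C # Cs. card C) =
      \<epsilon> * \<alpha> * t / 16 * card C + \<epsilon> * \<alpha> * t / 16 * (\<Sum>C\<leftarrow>Cs. card C)" by (simp add: algebra_simps)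
    have e3: "(1 + \<epsilon>) * card U = (1 + \<epsilon>) * card U' + (1 + \<epsilon>) * card (cov C U)"
      unfolding card_U by (simp add: algebra_simps)
    have "(\<Sum>g\<in>U. ?f (C # Cs) g)
      + 2 / \<alpha> * card {(g, h)\<in>E. g \<in> U \<and> h \<in> U \<and> asg D (C # Cs) g \<noteq> asg D (C # Cs) h}
      + 2 / \<alpha> * (m + card M) + \<epsilon> * \<alpha> * t / 16 * (\<Sum>C\<leftarrow>C # Cs. card C) \<le> (1 + \<epsilon>) * card U"
      unfolding e1 e2 e3 s1 using s2' c3 IH(5) by linarith
    moreover have "\<epsilon> * \<alpha>\<^sup>2 / 16 * card F * length (C # Cs) \<le> card U"
    proof -
      have "\<epsilon> * \<alpha>\<^sup>2 / 16 * card F * length (C # Cs)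
        = \<epsilon> * \<alpha>\<^sup>2 / 16 * card F * length Cs + \<epsilon> * \<alpha>\<^sup>2 / 16 * card F"
        by (simp add: distrib_left)
      then show ?thesis using IH(2) ge unfolding card_U by linarith
    qed
    moreover have "\<forall>C\<in>set (C # Cs). C \<subseteq> A" using IH(1) C(1) by auto
    moreover have "0 \<le> m + card M" using IH(3) by simp
    ultimately show ?thesis using s3
      by (intro exI[of _ "C # Cs"] exI[of _ "m + card M"] conjI)
  qed
qed

text \<open>All terms of the total cost are nonnegative, so each is at most
  \<open>(1 + \<epsilon>) * card F\<close>, hence at most \<open>2 * card F\<close>. The
  coefficients of \<open>cost\<close> are made for this: \<open>2 / \<alpha>\<close> leaves at most
  \<open>\<alpha> * card F\<close> separated pairs and as many multiply covered points, the fee at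
  most \<open>32 / (\<epsilon> * \<alpha> * t) * card F\<close> centers.\<close>

theorem greedy_cover:
  obtains Cs where "\<And>C. C \<in> set Cs \<Longrightarrow> C \<subseteq> A"
    "length Cs \<le> 16 / (\<epsilon> * \<alpha>\<^sup>2)"
    "(\<Sum>C\<leftarrow>Cs. card C) \<le> 32 / (\<epsilon> * \<alpha> * t) * card F"
    "card {g\<in>F. asg D Cs g = None} \<le> 2 * \<alpha> * card F"
    "card {(g, h)\<in>E. asg D Cs g \<noteq> asg D Cs h} \<le> \<alpha> * card F"
    "(\<Sum>g\<in>F. case asg D Cs g of None \<Rightarrow> 0 | Some c \<Rightarrow> \<rho> c g) \<le> (1 + \<epsilon>) * card F"
proof -
  obtain Cs m where Cs: "\<forall>C\<in>set Cs. C \<subseteq> A" "\<epsilon> * \<alpha>\<^sup>2 / 16 * card F * length Cs \<le> card F" "0 \<le> m"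
    and none: "card {g\<in>F. asg D Cs g = None} \<le> m + \<alpha> * card F"
    and le: "(\<Sum>g\<in>F. case asg D Cs g of None \<Rightarrow> 0 | Some c \<Rightarrow> \<rho> c g)
      + 2 / \<alpha> * card {(g, h)\<in>E. g \<in> F \<and> h \<in> F \<and> asg D Cs g \<noteq> asg D Cs h}
      + 2 / \<alpha> * m + \<epsilon> * \<alpha> * t / 16 * (\<Sum>C\<leftarrow>Cs. card C) \<le> (1 + \<epsilon>) * card F"
    using batches_exist[of F] by auto
  have "{(g, h)\<in>E. g \<in> F \<and> h \<in> F \<and> asg D Cs g \<noteq> asg D Cs h} = {(g, h)\<in>E. asg D Cs g \<noteq> asg D Cs h}"
    using E_sub by auto
  note le = le[unfolded this]
  have n1: "0 \<le> (\<Sum>g\<in>F. case asg D Cs g of None \<Rightarrow> 0 | Some c \<Rightarrow> \<rho> c g)"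
    using \<rho>_nonneg by (intro sum_nonneg) (auto split: option.split)
  have n2: "0 \<le> 2 / \<alpha> * card {(g, h)\<in>E. asg D Cs g \<noteq> asg D Cs h}" using \<alpha> by simp
  have n3: "0 \<le> 2 / \<alpha> * m" using \<alpha> Cs by simp
  have n4: "0 \<le> \<epsilon> * \<alpha> * t / 16 * (\<Sum>C\<leftarrow>Cs. card C)" using \<alpha> \<epsilon> t_pos by simp
  have b: "(1 + \<epsilon>) * card F \<le> 2 * real (card F)" using \<epsilon> by (intro mult_right_mono) auto
  have Fpos: "0 < card F" using F_ne finF by (simp add: card_gt_0_iff)
  show thesis
  proof (rule that[of Cs])
    show "C \<in> set Cs \<Longrightarrow> C \<subseteq> A" for C using Cs by auto
    have "\<epsilon> * \<alpha>\<^sup>2 / 16 * length Cs * card F \<le> 1 * card F" using Cs(2) by (simp add: mult_ac)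
    then have "\<epsilon> * \<alpha>\<^sup>2 / 16 * length Cs \<le> 1" using Fpos by (simp add: mult_le_cancel_right)
    then show "length Cs \<le> 16 / (\<epsilon> * \<alpha>\<^sup>2)" using \<alpha> \<epsilon> by (simp add: field_simps)
    have "\<epsilon> * \<alpha> * t / 16 * (\<Sum>C\<leftarrow>Cs. card C) \<le> 2 * card F" using le n1 n2 n3 b by linarith
    then show "(\<Sum>C\<leftarrow>Cs. card C) \<le> 32 / (\<epsilon> * \<alpha> * t) * card F"
      using \<alpha> \<epsilon> t_pos by (simp add: field_simps)
    have "2 / \<alpha> * m \<le> 2 * card F" using le n1 n2 n4 b by linarith
    then have "m \<le> \<alpha> * card F" using \<alpha> by (simp add: field_simps)
    then show "card {g\<in>F. asg D Cs g = None} \<le> 2 * \<alpha> * card F" using none by linarith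
    have "2 / \<alpha> * card {(g, h)\<in>E. asg D Cs g \<noteq> asg D Cs h} \<le> 2 * card F" using le n1 n3 n4 b by linarith
    then show "card {(g, h)\<in>E. asg D Cs g \<noteq> asg D Cs h} \<le> \<alpha> * card F"
      using \<alpha> by (simp add: field_simps)
    show "(\<Sum>g\<in>F. case asg D Cs g of None \<Rightarrow> 0 | Some c \<Rightarrow> \<rho> c g) \<le> (1 + \<epsilon>) * card F"
      using le n2 n3 n4 by linarith
  qed
qed

end

section \<open>Tilings of Folner sets\<close>

lemma sum_Pow_power:
  fixes y :: real
  assumes "finite Z"
  shows "(\<Sum>S\<in>Pow Z. y ^ card S) = (1 + y) ^ card Z"
  using assms
proof (induction Z)
  case (insert z Z)
  have inj: "inj_on (insert z) (Pow Z)" using insert(2) by (auto simp: inj_on_def)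
  have "(\<Sum>S\<in>Pow (insert z Z). y ^ card S)
     = (\<Sum>S\<in>Pow Z. y ^ card S) + (\<Sum>S\<in>insert z ` Pow Z. y ^ card S)"
    unfolding Pow_insert using insert by (intro sum.union_disjoint) auto
  also have "(\<Sum>S\<in>insert z ` Pow Z. y ^ card S) = (\<Sum>S\<in>Pow Z. y * y ^ card S)"
    unfolding sum.reindex[OF inj] comp_def
  proof (rule sum.cong)
    fix S assume "S \<in> Pow Z"
    then have "finite S" "z \<notin> S" using insert finite_subset by auto
    then show "y ^ card (insert z S) = y * y ^ card S" by simp
  qed simp
  finally show ?case using insert by (simp add: algebra_simps flip: sum_distrib_left)
qed simp

text \<open>Exponential moment bound: since \<open>card S \<le> s\<close> and
  \<open>x \<le> 1\<close>, the factor \<open>x powr (card S - s)\<close> is at least 1. Once it is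
  inserted, the sum may run over all subsets, where it is binomial.\<close>

lemma sum_small_subsets_le:
  fixes x a s :: real
  assumes "finite Z" and x: "0 < x" "x \<le> 1" and a: "0 \<le> a"
  shows "(\<Sum>S | S \<subseteq> Z \<and> card S \<le> s. a ^ card S) \<le> exp (s * ln (1 / x) + x * a * card Z)"
proof -
  have "(\<Sum>S | S \<subseteq> Z \<and> card S \<le> s. a ^ card S)
      \<le> (\<Sum>S | S \<subseteq> Z \<and> card S \<le> s. exp (s * ln (1 / x)) * (x * a) ^ card S)"
  proof (rule sum_mono)
    fix S assume "S \<in> {S. S \<subseteq> Z \<and> card S \<le> s}"
    then have "card S * ln (1 / x) \<le> s * ln (1 / x)" using x by (intro mult_right_mono) auto
    then have "exp (card S * ln (1 / x)) * x ^ card S \<le> exp (s * ln (1 / x)) * x ^ card S"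
      using x by (intro mult_right_mono) auto
    moreover have "exp (card S * ln (1 / x)) * x ^ card S = 1"
      using x by (simp add: exp_of_nat_mult power_one_over flip: power_mult_distrib)
    ultimately have "1 \<le> exp (s * ln (1 / x)) * x ^ card S" by simp
    then have "1 * a ^ card S \<le> exp (s * ln (1 / x)) * x ^ card S * a ^ card S"
      using a by (intro mult_right_mono) auto
    then show "a ^ card S \<le> exp (s * ln (1 / x)) * (x * a) ^ card S"
      by (simp add: power_mult_distrib mult.assoc)
  qed
  also have "\<dots> \<le> (\<Sum>S\<in>Pow Z. exp (s * ln (1 / x)) * (x * a) ^ card S)"
    using assms by (intro sum_mono2) auto
  also have "\<dots> = exp (s * ln (1 / x)) * (1 + x * a) ^ card Z"
    using sum_Pow_power[OF assms(1), of "x * a"] by (simp flip: sum_distrib_left)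
  also have "\<dots> \<le> exp (s * ln (1 / x)) * exp (x * a) ^ card Z"
    using x a by (intro mult_left_mono power_mono) (auto simp: add.commute)
  also have "\<dots> = exp (s * ln (1 / x) + x * a * card Z)"
    by (simp add: exp_add exp_of_nat2_mult mult.commute)
  finally show ?thesis .
qed

lemma card_small_subsets_le:
  fixes x s :: real
  assumes "finite Z" "0 < x" "x \<le> 1"
  shows "card {S. S \<subseteq> Z \<and> card S \<le> s} \<le> exp (s * ln (1 / x) + x * card Z)"
  using sum_small_subsets_le[OF assms, of 1 s] by simp

text \<open>A list of \<open>L\<close> subsets of \<open>Y\<close> is a single subset of
  \<open>{..<L} \<times> Y\<close>, of size the sum of their sizes. Counting the list as a whole
  requires a bound on the total number of centers only, not on each batch.\<close>

lemma card_small_set_lists_le: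
  fixes x s :: real and L :: nat and Y :: "'b set"
  assumes "finite Y" "0 < x" "x \<le> 1"
  defines "\<L> \<equiv> {Cs. length Cs = L \<and> (\<forall>C\<in>set Cs. C \<subseteq> Y) \<and> (\<Sum>C\<leftarrow>Cs. card C) \<le> s}"
  shows "finite \<L>" "card \<L> \<le> exp (s * ln (1 / x) + x * (L * card Y))"
proof -
  define J :: "'b set list \<Rightarrow> _" where "J Cs = {(j, y). j < L \<and> y \<in> Cs ! j}" for Cs
  have inj: "inj_on J \<L>"
  proof (rule inj_onI)
    fix Cs Cs' assume "Cs \<in> \<L>" "Cs' \<in> \<L>" and eq: "J Cs = J Cs'"
    then have len: "length Cs = L" "length Cs' = L" by (auto simp: \<L>_def)
    show "Cs = Cs'"
    proof (rule nth_equalityI)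
      fix j assume "j < length Cs"
      then have "Cs ! j = {y. (j, y) \<in> J Cs}" "Cs' ! j = {y. (j, y) \<in> J Cs'}"
        using len by (auto simp: J_def)
      then show "Cs ! j = Cs' ! j" using eq by simp
    qed (use len in auto)
  qed
  have sub: "J ` \<L> \<subseteq> {S. S \<subseteq> {..<L} \<times> Y \<and> card S \<le> s}"
  proof clarify
    fix Cs assume Cs: "Cs \<in> \<L>"
    then have len: "length Cs = L" and Y: "\<And>j. j < L \<Longrightarrow> Cs ! j \<subseteq> Y" by (auto simp: \<L>_def)
    have fin: "finite (Cs ! j)" if "j < L" for j using Y[OF that] assms(1) finite_subset by auto
    have "J Cs = Sigma {..<L} (\<lambda>j. Cs ! j)" by (auto simp: J_def)
    then have "card (J Cs) = (\<Sum>j<L. card (Cs ! j))" using fin by simp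
    also have "\<dots> = (\<Sum>C\<leftarrow>Cs. card C)"
      using len by (simp add: sum_list_sum_nth atLeast0LessThan)
    finally have "card (J Cs) \<le> s" using Cs by (simp add: \<L>_def)
    then show "J Cs \<subseteq> {..<L} \<times> Y \<and> card (J Cs) \<le> s" using Y by (auto simp: J_def)
  qed
  have fin: "finite {S. S \<subseteq> {..<L} \<times> Y \<and> card S \<le> s}"
    using assms(1) by (intro finite_subset[OF _ finite_Pow_iff[THEN iffD2, of "{..<L} \<times> Y"]]) auto
  show "finite \<L>" using finite_subset[OF sub fin] inj finite_imageD by auto
  have "card \<L> = card (J ` \<L>)" using inj by (simp add: card_image)
  also have "\<dots> \<le> card {S. S \<subseteq> {..<L} \<times> Y \<and> card S \<le> s}" using sub fin by (intro card_mono)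
  finally have "real (card \<L>) \<le> card {S. S \<subseteq> {..<L} \<times> Y \<and> card S \<le> s}" by simp
  also have "\<dots> \<le> exp (s * ln (1 / x) + x * card ({..<L} \<times> Y))"
    using assms by (intro card_small_subsets_le) auto
  finally show "card \<L> \<le> exp (s * ln (1 / x) + x * (L * card Y))"
    by (simp add: card_cartesian_product)
qed

context group
begin

lemma mult_inv_cancel_left [simp]:
  assumes "x \<in> carrier G" "y \<in> carrier G"
  shows "x \<otimes> (inv x \<otimes> y) = y" "inv x \<otimes> (x \<otimes> y) = y"
  using assms by (simp_all flip: m_assoc)

section \<open>Almost invariant finite sets\<close>

definition almost_inv :: "'a set \<Rightarrow> real \<Rightarrow> 'a set \<Rightarrow> bool" where
  "almost_inv Q \<delta> F \<longleftrightarrow> finite F \<and> F \<noteq> {} \<and> F \<subseteq> carrier G \<and> (\<forall>q\<in>Q. real (card {u\<in>F. q \<otimes> u \<notin> F}) \<le> \<delta> * real (card F))"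

lemma almost_inv_mono:
  fixes \<delta> :: real
  assumes "almost_inv Q \<delta> F" "Q' \<subseteq> Q" "\<delta> \<le> \<delta>'"
  shows "almost_inv Q' \<delta>' F"
  using assms unfolding almost_inv_def
  by (meson mult_right_mono of_nat_0_le_iff order_trans subset_iff)

lemma almost_inv_card_bad:
  fixes \<delta> :: real
  assumes "almost_inv Q \<delta> F" "finite Q'" "Q' \<subseteq> Q"
  shows "card {u\<in>F. \<exists>q\<in>Q'. q \<otimes> u \<notin> F} \<le> card Q' * \<delta> * card F"
proof -
  have "{u\<in>F. \<exists>q\<in>Q'. q \<otimes> u \<notin> F} = (\<Union>q\<in>Q'. {u\<in>F. q \<otimes> u \<notin> F})" by auto
  then have "card {u\<in>F. \<exists>q\<in>Q'. q \<otimes> u \<notin> F} \<le> (\<Sum>q\<in>Q'. card {u\<in>F. q \<otimes> u \<notin> F})"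
    using card_UN_le[OF assms(2)] by simp
  then have "real (card {u\<in>F. \<exists>q\<in>Q'. q \<otimes> u \<notin> F}) \<le> (\<Sum>q\<in>Q'. real (card {u\<in>F. q \<otimes> u \<notin> F}))"
    by (simp flip: of_nat_sum)
  also have "\<dots> \<le> (\<Sum>q\<in>Q'. \<delta> * card F)"
    using assms by (intro sum_mono) (auto simp: almost_inv_def)
  finally show ?thesis by (simp add: mult.assoc)
qed

text \<open>Fewer than \<open>card F\<close> points are moved out of \<open>F\<close> by some
  element of \<open>Q\<close>, so some \<open>u\<close> in \<open>F\<close> has all its translates
  by \<open>Q\<close> in \<open>F\<close>, and these are distinct.\<close>

lemma almost_inv_card_le:
  fixes \<delta> :: real
  assumes "almost_inv Q \<delta> F" "finite Q" "Q \<subseteq> carrier G" "card Q * \<delta> < 1"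
  shows "card Q \<le> card F"
proof -
  have F: "finite F" "F \<noteq> {}" "F \<subseteq> carrier G" using assms by (auto simp: almost_inv_def)
  have "\<exists>u\<in>F. \<forall>q\<in>Q. q \<otimes> u \<in> F"
  proof (rule ccontr)
    assume "\<not> ?thesis"
    then have "{u\<in>F. \<exists>q\<in>Q. q \<otimes> u \<notin> F} = F" by auto
    then have "card F \<le> card Q * \<delta> * card F" using almost_inv_card_bad[OF assms(1,2)] by auto
    moreover have "card Q * \<delta> * card F < 1 * real (card F)"
      using assms F by (intro mult_strict_right_mono) (auto simp: card_gt_0_iff)
    ultimately show False by simp
  qed
  then obtain u where u: "u \<in> F" "\<forall>q\<in>Q. q \<otimes> u \<in> F" by auto
  have "inj_on (\<lambda>q. q \<otimes> u) Q" using assms u F by (auto simp: inj_on_def subset_eq)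
  then show ?thesis using u F by (intro card_inj_on_le[of "\<lambda>q. q \<otimes> u"]) auto
qed

lemma almost_inv_card_prod_le:
  fixes \<delta> :: real
  assumes "almost_inv Q \<delta> F" "finite Q" "Q \<subseteq> carrier G" "card Q * \<delta> \<le> 1"
  shows "card ((\<lambda>(q, u). q \<otimes> u) ` (Q \<times> F)) \<le> 2 * card F"
proof -
  have F: "finite F" "F \<noteq> {}" "F \<subseteq> carrier G" using assms by (auto simp: almost_inv_def)
  have "(\<lambda>(q, u). q \<otimes> u) ` (Q \<times> F) \<subseteq> F \<union> (\<Union>q\<in>Q. (\<lambda>u. q \<otimes> u) ` {u\<in>F. q \<otimes> u \<notin> F})"
    by auto
  then have "card ((\<lambda>(q, u). q \<otimes> u) ` (Q \<times> F)) \<le> card (F \<union> (\<Union>q\<in>Q. (\<lambda>u. q \<otimes> u) ` {u\<in>F. q \<otimes> u \<notin> F}))"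
    using F assms by (intro card_mono) auto
  also have "\<dots> \<le> card F + card (\<Union>q\<in>Q. (\<lambda>u. q \<otimes> u) ` {u\<in>F. q \<otimes> u \<notin> F})" by (rule card_Un_le)
  also have "card (\<Union>q\<in>Q. (\<lambda>u. q \<otimes> u) ` {u\<in>F. q \<otimes> u \<notin> F}) \<le> (\<Sum>q\<in>Q. card ((\<lambda>u. q \<otimes> u) ` {u\<in>F. q \<otimes> u \<notin> F}))"
    by (rule card_UN_le[OF assms(2)])
  also have "\<dots> \<le> (\<Sum>q\<in>Q. card {u\<in>F. q \<otimes> u \<notin> F})"
    using F by (intro sum_mono card_image_le) auto
  finally have "real (card ((\<lambda>(q, u). q \<otimes> u) ` (Q \<times> F))) \<le> card F + (\<Sum>q\<in>Q. real (card {u\<in>F. q \<otimes> u \<notin> F}))"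
    by (simp flip: of_nat_sum of_nat_add)
  also have "(\<Sum>q\<in>Q. real (card {u\<in>F. q \<otimes> u \<notin> F})) \<le> (\<Sum>q\<in>Q. \<delta> * card F)"
    using assms by (intro sum_mono) (auto simp: almost_inv_def)
  also have "\<dots> \<le> 1 * real (card F)"
    using assms mult_right_mono[OF assms(4), of "real (card F)"] by (simp add: mult.assoc)
  finally show ?thesis by linarith
qed

lemma folner_sequence_almost_inv:
  fixes \<delta> :: real
  assumes F: "folner_sequence G F" and Q: "finite Q" "Q \<subseteq> carrier G" and \<delta>: "0 < \<delta>"
  shows "\<forall>\<^sub>F n in sequentially. almost_inv Q \<delta> (F n)"
proof -
  have Fn: "finite (F n)" "F n \<noteq> {}" "F n \<subseteq> carrier G" for n
    using F by (auto simp: folner_sequence_def)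
  have "\<forall>\<^sub>F n in sequentially. card {u\<in>F n. q \<otimes> u \<notin> F n} \<le> \<delta> * card (F n)" if q: "q \<in> Q" for q
  proof -
    have qG: "q \<in> carrier G" using q Q by auto
    have eq: "real (card (F n \<inter> (q <# F n))) / card (F n) = 1 - card {u\<in>F n. q \<otimes> u \<notin> F n} / card (F n)" for n
    proof -
      have "F n \<inter> (q <# F n) = (\<lambda>u. q \<otimes> u) ` {u\<in>F n. q \<otimes> u \<in> F n}"
        by (auto simp: l_coset_def)
      moreover have "inj_on (\<lambda>u. q \<otimes> u) {u\<in>F n. q \<otimes> u \<in> F n}"
        using qG Fn(3)[of n] by (auto simp: inj_on_def subset_eq)
      ultimately have "card (F n \<inter> (q <# F n)) = card {u\<in>F n. q \<otimes> u \<in> F n}"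
        by (simp add: card_image)
      moreover have "card (F n) = card {u\<in>F n. q \<otimes> u \<in> F n} + card {u\<in>F n. q \<otimes> u \<notin> F n}"
        using Fn(1)[of n] by (subst card_Un_disjoint[symmetric]) (auto intro: arg_cong[of _ _ card])
      moreover have "0 < real (card (F n))" using Fn by (simp add: card_gt_0_iff)
      ultimately show ?thesis by (simp add: divide_simps)
    qed
    have "(\<lambda>n. real (card (F n \<inter> (q <# F n))) / card (F n)) \<longlonglongrightarrow> 1"
      using F qG by (auto simp: folner_sequence_def)
    then have "\<forall>\<^sub>F n in sequentially. 1 - \<delta> < real (card (F n \<inter> (q <# F n))) / card (F n)"
      using \<delta> by (intro order_tendstoD) auto
    then show ?thesis
    proof eventually_elim
      case (elim n)
      have "0 < card (F n)" using Fn by (simp add: card_gt_0_iff)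
      then show ?case using elim unfolding eq by (simp add: field_simps)
    qed
  qed
  then have "\<forall>\<^sub>F n in sequentially. \<forall>q\<in>Q. card {u\<in>F n. q \<otimes> u \<notin> F n} \<le> \<delta> * card (F n)"
    using Q by (intro eventually_ball_finite) auto
  then show ?thesis by eventually_elim (use Fn in \<open>auto simp: almost_inv_def\<close>)
qed

text \<open>An infinite group has subsets \<open>Q\<close> of any finite size, and a set that is
  almost invariant under \<open>Q\<close> is at least as large as \<open>Q\<close>.\<close>

lemma folner_sequence_card:
  assumes F: "folner_sequence G F" and inf: "infinite (carrier G)"
  shows "\<forall>\<^sub>F n in sequentially. N \<le> card (F n)"
proof -
  obtain Q where Q: "Q \<subseteq> carrier G" "finite Q" "card Q = N"
    using infinite_arbitrarily_large[OF inf] by blast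
  have "\<forall>\<^sub>F n in sequentially. almost_inv Q (1 / (N + 1)) (F n)"
    using F Q by (intro folner_sequence_almost_inv) auto
  then show ?thesis
  proof eventually_elim
    case (elim n)
    then show ?case using almost_inv_card_le[OF elim Q(2,1)] Q by (simp add: field_simps)
  qed
qed

text \<open>Tiles are right translates of \<open>T\<close>: Folner sets are almost invariant under
  left multiplication, and right translation preserves this.\<close>

definition in_tile :: "'a set \<Rightarrow> 'a \<Rightarrow> 'a \<Rightarrow> bool" where
  "in_tile T c g \<longleftrightarrow> g \<otimes> inv c \<in> T"

text \<open>Right translation moves centers and points alike, and only centers of the form
  \<open>inv \<tau> \<otimes> b \<otimes> u\<close> with \<tau> in \<open>T\<close> reach the point
  \<open>b \<otimes> u\<close>. So the assignment around \<open>u\<close> depends only on the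
  centers seen through the finite window \<open>Y\<close> placed at \<open>u\<close>; counting
  patterns rests on this locality.\<close>

lemma asg_shift:
  assumes u: "u \<in> carrier G" and b: "b \<in> carrier G" and T: "T \<subseteq> carrier G"
    and Cs: "\<And>C. C \<in> set Cs \<Longrightarrow> C \<subseteq> carrier G"
    and Y: "Y \<subseteq> carrier G" "\<And>\<tau>. \<tau> \<in> T \<Longrightarrow> inv \<tau> \<otimes> b \<in> Y"
  shows "asg (in_tile T) Cs (b \<otimes> u) =
    map_option (\<lambda>x. x \<otimes> u) (asg (in_tile T) (map (\<lambda>C. {x\<in>Y. x \<otimes> u \<in> C}) Cs) b)"
  using Cs
proof (induction Cs)
  case (Cons C Cs)
  let ?S = "{x\<in>{x\<in>Y. x \<otimes> u \<in> C}. in_tile T x b}"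
  have eq: "{c\<in>C. in_tile T c (b \<otimes> u)} = (\<lambda>x. x \<otimes> u) ` ?S"
  proof (intro equalityI subsetI)
    fix c assume "c \<in> {c\<in>C. in_tile T c (b \<otimes> u)}"
    then have c: "c \<in> C" "b \<otimes> u \<otimes> inv c \<in> T" by (auto simp: in_tile_def)
    have cG: "c \<in> carrier G" using c Cons.prems[of C] by auto
    define \<tau> where "\<tau> = b \<otimes> u \<otimes> inv c"
    have "inv \<tau> \<otimes> b = c \<otimes> inv u"
      unfolding \<tau>_def using cG u b by (simp add: inv_mult_group m_assoc)
    then have x: "c \<otimes> inv u \<in> Y" using Y(2)[of \<tau>] c by (simp add: \<tau>_def)
    have "c \<otimes> inv u \<otimes> u = c" using cG u by (simp add: m_assoc)
    moreover have "b \<otimes> inv (c \<otimes> inv u) = b \<otimes> u \<otimes> inv c"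
      using cG u b by (simp add: inv_mult_group m_assoc)
    ultimately show "c \<in> (\<lambda>x. x \<otimes> u) ` ?S"
      using x c by (intro image_eqI[of _ _ "c \<otimes> inv u"]) (auto simp: in_tile_def)
  next
    fix c assume "c \<in> (\<lambda>x. x \<otimes> u) ` ?S"
    then obtain x where x: "x \<in> Y" "x \<otimes> u \<in> C" "b \<otimes> inv x \<in> T" "c = x \<otimes> u"
      by (auto simp: in_tile_def)
    have xG: "x \<in> carrier G" using x Y by auto
    have "b \<otimes> u \<otimes> inv (x \<otimes> u) = b \<otimes> inv x"
      using xG u b by (simp add: inv_mult_group m_assoc)
    then show "c \<in> {c\<in>C. in_tile T c (b \<otimes> u)}" using x by (auto simp: in_tile_def)
  qed
  have inj: "inj_on (\<lambda>x. x \<otimes> u) ?S" using Y u by (auto simp: inj_on_def subset_eq)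
  have IH: "asg (in_tile T) Cs (b \<otimes> u) =
    map_option (\<lambda>x. x \<otimes> u) (asg (in_tile T) (map (\<lambda>C. {x\<in>Y. x \<otimes> u \<in> C}) Cs) b)"
    using Cons by simp
  show ?case
  proof (cases "?S = {}")
    case True
    then have "{c\<in>C. in_tile T c (b \<otimes> u)} = {}" using eq by blast
    with True IH show ?thesis unfolding asg.simps list.map Let_def by presburger
  next
    case False
    show ?thesis
    proof (cases "is_singleton ?S")
      case True
      then obtain x where x: "?S = {x}" by (auto simp: is_singleton_def)
      then have "{c\<in>C. in_tile T c (b \<otimes> u)} = {x \<otimes> u}" unfolding eq x by simp
      with x show ?thesis unfolding asg.simps list.map Let_def by simp
    next
      case ns: False
      have "\<not> is_singleton ((\<lambda>x. x \<otimes> u) ` ?S)"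
        using ns unfolding is_singleton_altdef card_image[OF inj] .
      then show ?thesis unfolding asg.simps list.map Let_def eq using ns False by auto
    qed
  qed
qed simp

text \<open>The candidates are all centers whose tile meets \<open>F\<close>. Each point of
  \<open>F\<close> lies in exactly \<open>card T\<close> candidate tiles, one for each position, and
  almost invariance of \<open>F\<close> under the inverses of \<open>T\<close> limits the candidates
  to \<open>2 * card F\<close>. The weight is divided by its mean \<open>r\<close> to meet the
  normalization of \<open>greedy\<close>.\<close>

lemma tile_assignment:
  fixes \<delta> \<epsilon> \<alpha> r :: real
  assumes T: "finite T" "T \<noteq> {}" "T \<subseteq> carrier G"
    and K: "finite K" "K \<subseteq> carrier G" "almost_inv (K \<union> m_inv G ` K) \<delta> T" "card K * (2 * \<delta>) \<le> \<epsilon> * \<alpha> / 16"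
    and \<epsilon>: "0 < \<epsilon>" "\<epsilon> \<le> 1" and \<alpha>: "0 < \<alpha>" "\<alpha> \<le> 1"
    and \<rho>: "\<And>\<tau>. 0 \<le> \<rho> \<tau>" "(\<Sum>\<tau>\<in>T. \<rho> \<tau>) = r * card T" "0 < r"
    and F: "almost_inv (m_inv G ` T) (1 / card T) F"
  obtains Cs where "\<And>C. C \<in> set Cs \<Longrightarrow> finite C \<and> C \<subseteq> carrier G"
    "length Cs \<le> 16 / (\<epsilon> * \<alpha>\<^sup>2)"
    "(\<Sum>C\<leftarrow>Cs. card C) \<le> 32 / (\<epsilon> * \<alpha> * card T) * card F"
    "card {g\<in>F. asg (in_tile T) Cs g = None} \<le> 2 * \<alpha> * card F"
    "card {g\<in>F. \<exists>k\<in>K. k \<otimes> g \<in> F \<and> asg (in_tile T) Cs g \<noteq> asg (in_tile T) Cs (k \<otimes> g)} \<le> \<alpha> * card F"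
    "(\<Sum>g\<in>F. case asg (in_tile T) Cs g of None \<Rightarrow> 0 | Some c \<Rightarrow> \<rho> (g \<otimes> inv c)) \<le> (1 + \<epsilon>) * r * card F"
proof -
  have Fp: "finite F" "F \<noteq> {}" "F \<subseteq> carrier G" using F by (auto simp: almost_inv_def)
  define A where "A = (\<lambda>(q, u). q \<otimes> u) ` (m_inv G ` T \<times> F)"
  define E where "E = {(g, h)\<in>F \<times> F. \<exists>k\<in>K. h = k \<otimes> g}"
  have finA: "finite A" using T Fp by (auto simp: A_def)
  have AG: "A \<subseteq> carrier G" using T Fp by (auto simp: A_def)
  have cT: "0 < card T" using T by (simp add: card_gt_0_iff)
  have cardinv: "card (m_inv G ` T) \<le> card T" using T by (simp add: card_image_le)
  have pos: "g \<otimes> inv (inv \<tau> \<otimes> g) = \<tau>" if "\<tau> \<in> T" "g \<in> F" for \<tau> g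
  proof -
    have G: "\<tau> \<in> carrier G" "g \<in> carrier G" using that T Fp by auto
    show ?thesis using G by (simp add: inv_mult_group)
  qed
  have bij: "bij_betw (\<lambda>\<tau>. inv \<tau> \<otimes> g) T {c\<in>A. in_tile T c g}" if g: "g \<in> F" for g
  proof (rule bij_betwI[of _ _ _ "\<lambda>c. g \<otimes> inv c"])
    have gG: "g \<in> carrier G" using g Fp by auto
    show "g \<otimes> inv (inv \<tau> \<otimes> g) = \<tau>" if "\<tau> \<in> T" for \<tau> using pos[OF that g] .
    show "(\<lambda>\<tau>. inv \<tau> \<otimes> g) \<in> T \<rightarrow> {c\<in>A. in_tile T c g}"
      using g pos[OF _ g] by (auto simp: A_def in_tile_def)
    show "(\<lambda>c. g \<otimes> inv c) \<in> {c\<in>A. in_tile T c g} \<rightarrow> T" by (auto simp: in_tile_def)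
    show "inv (g \<otimes> inv c) \<otimes> g = c" if "c \<in> {c\<in>A. in_tile T c g}" for c
    proof -
      have cG: "c \<in> carrier G" using that AG by auto
      show ?thesis using cG gG by (simp add: inv_mult_group m_assoc)
    qed
  qed
  interpret greedy F A "in_tile T" "\<lambda>c g. \<rho> (g \<otimes> inv c) / r" E "card T" \<alpha> \<epsilon>
  proof
    show "card A \<le> 2 * card F"
      unfolding A_def using T F cT cardinv by (intro almost_inv_card_prod_le) (auto simp: field_simps)
    show "E \<subseteq> F \<times> F" by (auto simp: E_def)
    show "real (card {c\<in>A. in_tile T c g}) = card T" if "g \<in> F" for g
      using bij_betw_same_card[OF bij[OF that]] by simp
    show "(\<Sum>c\<in>{c\<in>A. in_tile T c g}. \<rho> (g \<otimes> inv c) / r) \<le> card T" if "g \<in> F" for g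
    proof -
      have "(\<Sum>c\<in>{c\<in>A. in_tile T c g}. \<rho> (g \<otimes> inv c) / r)
        = (\<Sum>\<tau>\<in>T. \<rho> (g \<otimes> inv (inv \<tau> \<otimes> g)) / r)"
        using sum.reindex_bij_betw[OF bij[OF that], of "\<lambda>c. \<rho> (g \<otimes> inv c) / r"] by simp
      also have "\<dots> = (\<Sum>\<tau>\<in>T. \<rho> \<tau>) / r"
        using pos that by (simp add: sum_divide_distrib)
      finally show ?thesis using \<rho> by simp
    qed
    fix U assume U: "U \<subseteq> F"
    have finU: "finite U" using U Fp finite_subset by auto
    let ?P = "{p\<in>E. fst p \<in> U \<and> snd p \<in> U}"
    have Psub: "?P \<subseteq> (\<lambda>(k, g). (g, k \<otimes> g)) ` (K \<times> U)" by (auto simp: E_def)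
    then have finP: "finite ?P" using K finU by (auto intro: finite_subset)
    have "card ?P \<le> card ((\<lambda>(k, g). (g, k \<otimes> g)) ` (K \<times> U))"
      using K finU by (intro card_mono[OF _ Psub]) auto
    also have "\<dots> \<le> card (K \<times> U)" using K finU by (intro card_image_le) auto
    finally have cP: "real (card ?P) \<le> card K * card U"
      unfolding card_cartesian_product by (simp flip: of_nat_mult)
    have "(\<Sum>c\<in>A. real (card {(g, h)\<in>E. g \<in> U \<and> h \<in> U \<and> in_tile T c g \<noteq> in_tile T c h}))
      = (\<Sum>c\<in>A. real (card {p\<in>?P. in_tile T c (fst p) \<noteq> in_tile T c (snd p)}))"
      by (intro sum.cong refl arg_cong[of _ _ "\<lambda>X. real (card X)"]) auto
    also have "\<dots> = (\<Sum>p\<in>?P. real (card {c\<in>A. in_tile T c (fst p) \<noteq> in_tile T c (snd p)}))"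
      by (rule sum_card_swap[OF finA finP])
    also have "\<dots> \<le> (\<Sum>p\<in>?P. 2 * \<delta> * card T)"
    proof (rule sum_mono)
      fix p assume "p \<in> ?P"
      then obtain g k where p: "p = (g, k \<otimes> g)" "g \<in> F" "k \<in> K" by (auto simp: E_def)
      have G: "g \<in> carrier G" "k \<in> carrier G" using p Fp K by auto
      \<comment> \<open>A tile cuts the pair only if it contains one of the two points at a position
        that \<open>k\<close>, or its inverse, moves out of \<open>T\<close>. The position
        determines the center, so almost invariance of \<open>T\<close> bounds both kinds.\<close>
      have "{c\<in>A. in_tile T c (fst p) \<noteq> in_tile T c (snd p)} \<subseteq>
        (\<lambda>\<tau>. inv \<tau> \<otimes> g) ` {\<tau>\<in>T. k \<otimes> \<tau> \<notin> T} \<union> (\<lambda>\<tau>. inv \<tau> \<otimes> (k \<otimes> g)) ` {\<tau>\<in>T. inv k \<otimes> \<tau> \<notin> T}"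
      proof
        fix c assume "c \<in> {c\<in>A. in_tile T c (fst p) \<noteq> in_tile T c (snd p)}"
        then have c: "c \<in> A" "(g \<otimes> inv c \<in> T) \<noteq> (k \<otimes> g \<otimes> inv c \<in> T)" by (auto simp: p in_tile_def)
        have cG: "c \<in> carrier G" using c AG by auto
        have e: "inv (g \<otimes> inv c) \<otimes> g = c" "inv (k \<otimes> g \<otimes> inv c) \<otimes> (k \<otimes> g) = c"
          using cG G by (simp_all add: inv_mult_group m_assoc)
        have e2: "k \<otimes> (g \<otimes> inv c) = k \<otimes> g \<otimes> inv c" "inv k \<otimes> (k \<otimes> g \<otimes> inv c) = g \<otimes> inv c"
          using cG G by (simp_all add: m_assoc)
        show "c \<in> (\<lambda>\<tau>. inv \<tau> \<otimes> g) ` {\<tau>\<in>T. k \<otimes> \<tau> \<notin> T} \<union> (\<lambda>\<tau>. inv \<tau> \<otimes> (k \<otimes> g)) ` {\<tau>\<in>T. inv k \<otimes> \<tau> \<notin> T}"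
        proof (cases "g \<otimes> inv c \<in> T")
          case True
          then have "c \<in> (\<lambda>\<tau>. inv \<tau> \<otimes> g) ` {\<tau>\<in>T. k \<otimes> \<tau> \<notin> T}"
            using c e e2 by (intro image_eqI[of _ _ "g \<otimes> inv c"]) auto
          then show ?thesis by blast
        next
          case False
          then have "c \<in> (\<lambda>\<tau>. inv \<tau> \<otimes> (k \<otimes> g)) ` {\<tau>\<in>T. inv k \<otimes> \<tau> \<notin> T}"
            using c e e2 by (intro image_eqI[of _ _ "k \<otimes> g \<otimes> inv c"]) auto
          then show ?thesis by blast
        qed
      qed
      then have "card {c\<in>A. in_tile T c (fst p) \<noteq> in_tile T c (snd p)} \<le>
        card ((\<lambda>\<tau>. inv \<tau> \<otimes> g) ` {\<tau>\<in>T. k \<otimes> \<tau> \<notin> T} \<union> (\<lambda>\<tau>. inv \<tau> \<otimes> (k \<otimes> g)) ` {\<tau>\<in>T. inv k \<otimes> \<tau> \<notin> T})"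
        using T by (intro card_mono) auto
      also have "\<dots> \<le> card ((\<lambda>\<tau>. inv \<tau> \<otimes> g) ` {\<tau>\<in>T. k \<otimes> \<tau> \<notin> T})
           + card ((\<lambda>\<tau>. inv \<tau> \<otimes> (k \<otimes> g)) ` {\<tau>\<in>T. inv k \<otimes> \<tau> \<notin> T})" by (rule card_Un_le)
      also have "\<dots> \<le> card {\<tau>\<in>T. k \<otimes> \<tau> \<notin> T} + card {\<tau>\<in>T. inv k \<otimes> \<tau> \<notin> T}"
        using T by (intro add_mono card_image_le) auto
      finally have "real (card {c\<in>A. in_tile T c (fst p) \<noteq> in_tile T c (snd p)})
         \<le> card {\<tau>\<in>T. k \<otimes> \<tau> \<notin> T} + card {\<tau>\<in>T. inv k \<otimes> \<tau> \<notin> T}" by linarith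
      moreover have "card {\<tau>\<in>T. k \<otimes> \<tau> \<notin> T} \<le> \<delta> * card T" "card {\<tau>\<in>T. inv k \<otimes> \<tau> \<notin> T} \<le> \<delta> * card T"
        using K(3) p by (auto simp: almost_inv_def)
      ultimately show "real (card {c\<in>A. in_tile T c (fst p) \<noteq> in_tile T c (snd p)}) \<le> 2 * \<delta> * card T"
        by linarith
    qed
    also have "\<dots> = card ?P * (2 * \<delta> * card T)" by simp
    also have "\<dots> \<le> \<epsilon> * \<alpha> / 16 * card T * card U"
    \<comment> \<open>No sign of \<delta> is assumed, and \<open>almost_inv\<close> forces it to be
      nonnegative only if \<open>K\<close> has an element.\<close>
    proof (cases "K = {}")
      case True
      then have "?P = {}" by (auto simp: E_def)
      then have "card ?P = 0" by (simp only: card.empty)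
      then show ?thesis using \<epsilon> \<alpha> by simp
    next
      case False
      then obtain k where "k \<in> K" by auto
      then have "0 \<le> \<delta> * card T"
        using K(3) unfolding almost_inv_def by (meson UnI1 of_nat_0_le_iff order_trans)
      then have "0 \<le> 2 * \<delta> * card T" by simp
      then have "card ?P * (2 * \<delta> * card T) \<le> card K * card U * (2 * \<delta> * card T)"
        using cP by (intro mult_right_mono) auto
      also have "\<dots> = (card K * (2 * \<delta>)) * (card T * card U)" by simp
      also have "\<dots> \<le> (\<epsilon> * \<alpha> / 16) * (card T * card U)" using K by (intro mult_right_mono) auto
      finally show ?thesis by simp
    qed
    finally show "(\<Sum>c\<in>A. real (card {(g, h)\<in>E. g \<in> U \<and> h \<in> U \<and> in_tile T c g \<noteq> in_tile T c h}))
      \<le> \<epsilon> * \<alpha> / 16 * card T * card U" by simp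
  qed (use finA Fp cT \<epsilon> \<alpha> \<rho> in auto)
  obtain Cs where Cs: "\<And>C. C \<in> set Cs \<Longrightarrow> C \<subseteq> A"
    "length Cs \<le> 16 / (\<epsilon> * \<alpha>\<^sup>2)"
    "(\<Sum>C\<leftarrow>Cs. card C) \<le> 32 / (\<epsilon> * \<alpha> * card T) * card F"
    "card {g\<in>F. asg (in_tile T) Cs g = None} \<le> 2 * \<alpha> * card F"
    "card {(g, h)\<in>E. asg (in_tile T) Cs g \<noteq> asg (in_tile T) Cs h} \<le> \<alpha> * card F"
    "(\<Sum>g\<in>F. case asg (in_tile T) Cs g of None \<Rightarrow> 0 | Some c \<Rightarrow> \<rho> (g \<otimes> inv c) / r) \<le> (1 + \<epsilon>) * card F"
    by (rule greedy_cover) (rule that; assumption)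
  show thesis
  proof (rule that[OF _ Cs(2,3,4)])
    show "finite C \<and> C \<subseteq> carrier G" if "C \<in> set Cs" for C
      using Cs(1)[OF that] finA AG finite_subset by auto
    have "{g\<in>F. \<exists>k\<in>K. k \<otimes> g \<in> F \<and> asg (in_tile T) Cs g \<noteq> asg (in_tile T) Cs (k \<otimes> g)}
       \<subseteq> fst ` {(g, h)\<in>E. asg (in_tile T) Cs g \<noteq> asg (in_tile T) Cs h}"
      by (force simp: E_def)
    then have "card {g\<in>F. \<exists>k\<in>K. k \<otimes> g \<in> F \<and> asg (in_tile T) Cs g \<noteq> asg (in_tile T) Cs (k \<otimes> g)}
       \<le> card {(g, h)\<in>E. asg (in_tile T) Cs g \<noteq> asg (in_tile T) Cs h}"
      by (rule surj_card_le[rotated]) (auto intro: finite_subset[OF _ finE])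
    then show "card {g\<in>F. \<exists>k\<in>K. k \<otimes> g \<in> F \<and> asg (in_tile T) Cs g \<noteq> asg (in_tile T) Cs (k \<otimes> g)}
      \<le> \<alpha> * card F" using Cs(5) by linarith
    have "(\<Sum>g\<in>F. case asg (in_tile T) Cs g of None \<Rightarrow> 0 | Some c \<Rightarrow> \<rho> (g \<otimes> inv c) / r)
      = (\<Sum>g\<in>F. case asg (in_tile T) Cs g of None \<Rightarrow> 0 | Some c \<Rightarrow> \<rho> (g \<otimes> inv c)) / r"
      unfolding sum_divide_distrib by (intro sum.cong) (auto split: option.split)
    then show "(\<Sum>g\<in>F. case asg (in_tile T) Cs g of None \<Rightarrow> 0 | Some c \<Rightarrow> \<rho> (g \<otimes> inv c)) \<le> (1 + \<epsilon>) * r * card F"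
      using Cs(6) \<rho>(3) by (simp add: pos_divide_le_eq mult_ac)
  qed
qed

end

lemma sum_sum_list_swap:
  fixes f :: "'c \<Rightarrow> 'd \<Rightarrow> 'e::comm_monoid_add"
  shows "(\<Sum>u\<in>F. \<Sum>C\<leftarrow>Cs. f C u) = (\<Sum>C\<leftarrow>Cs. \<Sum>u\<in>F. f C u)"
  by (induction Cs) (simp_all add: sum.distrib)

context group
begin

text \<open>The map \<open>\<phi>\<close> need not carry the uniform distribution on \<open>F\<close> to one close to the uniform
  distribution on \<open>T\<close>. The weight \<open>\<rho>\<close>, which is allowed to grow only by the factor \<open>1 + \<epsilon>\<close>, is what
  controls the frequency of finitely many prescribed subsets of \<open>T\<close>.\<close>

definition good_tile :: "'a set \<Rightarrow> real \<Rightarrow> 'a set \<Rightarrow> bool" where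
  "good_tile K \<epsilon> T \<longleftrightarrow> (\<forall>\<rho> B. (\<forall>\<tau>. 0 \<le> \<rho> \<tau>) \<and> 0 < (\<Sum>\<tau>\<in>T. \<rho> \<tau>) \<and> almost_inv (m_inv G ` T) (1 / card T) B \<longrightarrow>
     (\<exists>Q \<delta>. finite Q \<and> Q \<subseteq> carrier G \<and> 0 < \<delta> \<and> (\<forall>F. almost_inv Q \<delta> F \<longrightarrow>
       (\<exists>\<phi> X. \<phi> \<in> F \<rightarrow> T \<and> X \<subseteq> F
          \<and> (\<Sum>u\<in>F. \<rho> (\<phi> u)) \<le> (1 + \<epsilon>) * ((\<Sum>\<tau>\<in>T. \<rho> \<tau>) / card T) * card F
          \<and> real (card (F - X)) \<le> \<epsilon> * real (card F)
          \<and> (\<forall>u\<in>X. \<forall>k\<in>K. k \<otimes> u \<in> F \<and> \<phi> (k \<otimes> u) = k \<otimes> \<phi> u)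
          \<and> card ((\<lambda>u. \<lambda>b\<in>B. \<phi> (b \<otimes> u)) ` X) \<le> exp (\<epsilon> * real (card B))))))"

text \<open>For given \<open>x\<close> and given center \<open>c\<close>, at most one
  \<open>u\<close> satisfies \<open>x \<otimes> u = c\<close>. So a window sees on average at most
  \<open>card Y\<close> times the density of the centers.\<close>

lemma sum_window_centers_le:
  assumes F: "finite F" "F \<subseteq> carrier G" and Y: "finite Y" "Y \<subseteq> carrier G"
    and Cs: "\<And>C. C \<in> set Cs \<Longrightarrow> finite C"
  shows "(\<Sum>u\<in>F. \<Sum>C\<leftarrow>Cs. card {x\<in>Y. x \<otimes> u \<in> C}) \<le> card Y * (\<Sum>C\<leftarrow>Cs. card C)"
proof -
  have "(\<Sum>u\<in>F. card {x\<in>Y. x \<otimes> u \<in> C}) \<le> card Y * card C" if "C \<in> set Cs" for C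
  proof -
    have "real (\<Sum>u\<in>F. card {x\<in>Y. x \<otimes> u \<in> C}) = (\<Sum>x\<in>Y. real (card {u\<in>F. x \<otimes> u \<in> C}))"
      using sum_card_swap[OF F(1) Y(1), of "\<lambda>u x. x \<otimes> u \<in> C"] by simp
    also have "\<dots> \<le> (\<Sum>x\<in>Y. real (card C))"
    proof (rule sum_mono)
      fix x assume "x \<in> Y"
      then have "inj_on (\<lambda>u. x \<otimes> u) {u\<in>F. x \<otimes> u \<in> C}"
        using F Y by (auto simp: inj_on_def subset_eq)
      then have "card {u\<in>F. x \<otimes> u \<in> C} \<le> card C"
        using Cs[OF that] by (intro card_inj_on_le[of "\<lambda>u. x \<otimes> u"]) auto
      then show "real (card {u\<in>F. x \<otimes> u \<in> C}) \<le> card C" by simp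
    qed
    also have "\<dots> = real (card Y * card C)" by simp
    finally show ?thesis by (simp only: of_nat_le_iff)
  qed
  then have "(\<Sum>C\<leftarrow>Cs. \<Sum>u\<in>F. card {x\<in>Y. x \<otimes> u \<in> C}) \<le> (\<Sum>C\<leftarrow>Cs. card Y * card C)"
    by (intro sum_list_mono) auto
  then show ?thesis by (simp add: sum_sum_list_swap sum_list_const_mult)
qed

text \<open>Origin of the constants: the covering is used with \<open>\<epsilon> / 2\<close> and
  \<open>\<epsilon> / 8\<close> in place of its \<epsilon> and \<alpha>, so it has at most
  \<open>2048 / \<epsilon> ^ 3\<close> batches. Windows with at most \<open>\<zeta> * card B\<close>
  centers show at most \<open>exp (\<zeta> * card B * ln (1 / x) + x * (2048 / \<epsilon> ^ 3 * (2 *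
  card B)))\<close> patterns; \<zeta> and \<open>x\<close> make each summand equal to
  \<open>\<epsilon> / 2 * card B\<close>. A large tile makes centers so sparse that all but a
  proportion \<open>\<epsilon> / 4\<close> of the windows are of this kind.\<close>

lemma good_tile_step:
  fixes \<epsilon> \<delta> x \<zeta> :: real
  assumes K: "finite K" "K \<subseteq> carrier G" and \<epsilon>: "0 < \<epsilon>" "\<epsilon> \<le> 1"
    and \<delta>: "card K * (2 * \<delta>) \<le> \<epsilon>\<^sup>2 / 256"
    and x: "x = \<epsilon> ^ 4 / 8192" and \<zeta>: "\<zeta> = \<epsilon> / (2 * ln (1 / x))"
    and T: "almost_inv (K \<union> m_inv G ` K) \<delta> T" "4096 / (\<epsilon> ^ 3 * \<zeta>) \<le> card T"
  shows "good_tile K \<epsilon> T"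
  unfolding good_tile_def
proof (intro allI impI, elim conjE)
  fix \<rho> :: "'a \<Rightarrow> real" and B
  assume \<rho>: "\<forall>\<tau>. 0 \<le> \<rho> \<tau>" "0 < (\<Sum>\<tau>\<in>T. \<rho> \<tau>)" and B: "almost_inv (m_inv G ` T) (1 / card T) B"
  have Tp: "finite T" "T \<noteq> {}" "T \<subseteq> carrier G" using T by (auto simp: almost_inv_def)
  have Bp: "finite B" "B \<noteq> {}" "B \<subseteq> carrier G" using B by (auto simp: almost_inv_def)
  have cT: "0 < real (card T)" and cB: "0 < real (card B)" using Tp Bp by (auto simp: card_gt_0_iff)
  define r where "r = (\<Sum>\<tau>\<in>T. \<rho> \<tau>) / card T"
  have r: "0 < r" "(\<Sum>\<tau>\<in>T. \<rho> \<tau>) = r * card T" using \<rho> cT by (auto simp: r_def)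
  \<comment> \<open>The position given to unassigned points. As its weight is at most the mean,
    these points, at most a proportion \<open>\<epsilon> / 4\<close> of \<open>F\<close>, stay
    within the permitted growth of the weight.\<close>
  obtain \<tau>0 where \<tau>0: "\<tau>0 \<in> T" "\<rho> \<tau>0 \<le> r"
  proof (rule ccontr)
    assume "\<not> thesis"
    then have "\<forall>\<tau>\<in>T. r < \<rho> \<tau>" using that by force
    then have "(\<Sum>\<tau>\<in>T. r) < (\<Sum>\<tau>\<in>T. \<rho> \<tau>)" using Tp by (intro sum_strict_mono) auto
    then show False using r by (simp add: mult.commute)
  qed
  have x01: "0 < x" "x < 1"
  proof -
    have "\<epsilon> ^ 4 \<le> 1" using \<epsilon> by (intro power_le_one) auto
    then show "x < 1" by (simp add: x)
    show "0 < x" using \<epsilon> by (simp add: x)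
  qed
  have ln_pos: "0 < ln (1 / x)" using x01 by simp
  have \<zeta>_pos: "0 < \<zeta>" using \<epsilon> ln_pos by (simp add: \<zeta>)
  \<comment> \<open>\<open>Y\<close> holds the centers, relative to \<open>u\<close>, whose tiles
    can meet the window of shape \<open>B\<close> at \<open>u\<close>. Almost invariance of
    \<open>B\<close> under the inverses of \<open>T\<close> keeps it below twice the size of
    \<open>B\<close>.\<close>
  define Y where "Y = (\<lambda>(q, b). q \<otimes> b) ` (m_inv G ` T \<times> B)"
  have Yp: "finite Y" "Y \<subseteq> carrier G" using Tp Bp by (auto simp: Y_def)
  have "card (m_inv G ` T) * (1 / card T) \<le> 1"
    using card_image_le[OF Tp(1), of "m_inv G"] cT by (simp add: field_simps)
  then have cY: "real (card Y) \<le> 2 * real (card B)"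
    using almost_inv_card_prod_le[OF B] Tp unfolding Y_def by force
  \<comment> \<open>The first entry of the minimum serves the covering of \<open>F\<close>; the
    second keeps the translates by \<open>K\<close> and \<open>B\<close> inside \<open>F\<close> for
    all but a proportion \<open>\<epsilon> / 8\<close> of the points.\<close>
  define \<delta>' where "\<delta>' = min (1 / card T) (\<epsilon> / (8 * (card (K \<union> B) + 1)))"
  define Q where "Q = m_inv G ` T \<union> (K \<union> B)"
  have "\<exists>\<phi> X. \<phi> \<in> F \<rightarrow> T \<and> X \<subseteq> F
          \<and> (\<Sum>u\<in>F. \<rho> (\<phi> u)) \<le> (1 + \<epsilon>) * ((\<Sum>\<tau>\<in>T. \<rho> \<tau>) / card T) * card F
          \<and> real (card (F - X)) \<le> \<epsilon> * real (card F)
          \<and> (\<forall>u\<in>X. \<forall>k\<in>K. k \<otimes> u \<in> F \<and> \<phi> (k \<otimes> u) = k \<otimes> \<phi> u)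
          \<and> card ((\<lambda>u. \<lambda>b\<in>B. \<phi> (b \<otimes> u)) ` X) \<le> exp (\<epsilon> * real (card B))"
    if F: "almost_inv Q \<delta>' F" for F
  proof -
    have Fp: "finite F" "F \<noteq> {}" "F \<subseteq> carrier G" using F by (auto simp: almost_inv_def)
    have F1: "almost_inv (m_inv G ` T) (1 / card T) F"
      by (rule almost_inv_mono[OF F]) (auto simp: Q_def \<delta>'_def)
    obtain Cs where Cs: "\<And>C. C \<in> set Cs \<Longrightarrow> finite C \<and> C \<subseteq> carrier G"
      and len: "length Cs \<le> 16 / (\<epsilon> / 2 * (\<epsilon> / 8)\<^sup>2)"
      and sum: "(\<Sum>C\<leftarrow>Cs. card C) \<le> 32 / (\<epsilon> / 2 * (\<epsilon> / 8) * card T) * card F"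
      and none: "card {g\<in>F. asg (in_tile T) Cs g = None} \<le> 2 * (\<epsilon> / 8) * card F"
      and sep: "card {g\<in>F. \<exists>k\<in>K. k \<otimes> g \<in> F \<and> asg (in_tile T) Cs g \<noteq> asg (in_tile T) Cs (k \<otimes> g)} \<le> \<epsilon> / 8 * card F"
      and \<rho>sum: "(\<Sum>g\<in>F. case asg (in_tile T) Cs g of None \<Rightarrow> 0 | Some c \<Rightarrow> \<rho> (g \<otimes> inv c)) \<le> (1 + \<epsilon> / 2) * r * card F"
    proof (rule tile_assignment[OF Tp K T(1) _ _ _ _ _ _ r(2,1) F1])
      show "card K * (2 * \<delta>) \<le> \<epsilon> / 2 * (\<epsilon> / 8) / 16" using \<delta> by (simp add: power2_eq_square)
    qed (use \<epsilon> \<rho> in auto)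
    let ?a = "asg (in_tile T) Cs"
    define w where "w u = (\<Sum>C\<leftarrow>Cs. card {x\<in>Y. x \<otimes> u \<in> C})" for u
    define \<phi> where "\<phi> g = (case ?a g of None \<Rightarrow> \<tau>0 | Some c \<Rightarrow> g \<otimes> inv c)" for g
    \<comment> \<open>The four ways to fail have density at most \<open>\<epsilon> / 8\<close>,
      \<open>\<epsilon> / 4\<close>, \<open>\<epsilon> / 8\<close> and
      \<open>\<epsilon> / 4\<close>: a translate of \<open>u\<close> leaves \<open>F\<close>,
      \<open>u\<close> is unassigned, \<open>u\<close> is separated from some
      \<open>k \<otimes> u\<close>, or its window is crowded with centers.\<close>
    define X where "X = {u\<in>F. (\<forall>q\<in>K \<union> B. q \<otimes> u \<in> F) \<and> ?a u \<noteq> None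
        \<and> (\<forall>k\<in>K. ?a u = ?a (k \<otimes> u)) \<and> w u \<le> \<zeta> * card B}"
    have center: "c \<in> carrier G \<and> g \<otimes> inv c \<in> T" if "?a g = Some c" for g c
      using asg_SomeD[OF that] Cs by (auto simp: in_tile_def)
    have "\<phi> \<in> F \<rightarrow> T" using center \<tau>0 by (auto simp: \<phi>_def split: option.split)
    moreover have "X \<subseteq> F" by (auto simp: X_def)
    moreover have "(\<Sum>u\<in>F. \<rho> (\<phi> u)) \<le> (1 + \<epsilon>) * ((\<Sum>\<tau>\<in>T. \<rho> \<tau>) / card T) * card F"
    proof -
      have "(\<Sum>u\<in>F. \<rho> (\<phi> u)) \<le> (\<Sum>u\<in>F. (case ?a u of None \<Rightarrow> 0 | Some c \<Rightarrow> \<rho> (u \<otimes> inv c))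
          + (if ?a u = None then r else 0))"
        using \<tau>0 by (intro sum_mono) (auto simp: \<phi>_def split: option.split)
      also have "\<dots> = (\<Sum>g\<in>F. case ?a g of None \<Rightarrow> 0 | Some c \<Rightarrow> \<rho> (g \<otimes> inv c))
          + r * card {g\<in>F. ?a g = None}"
        using Fp by (simp add: sum.distrib sum.If_cases Int_def mult.commute)
      also have "\<dots> \<le> (1 + \<epsilon> / 2) * r * card F + r * (2 * (\<epsilon> / 8) * card F)"
        using \<rho>sum none r by (intro add_mono mult_left_mono) auto
      also have "\<dots> \<le> (1 + \<epsilon>) * r * card F" using r \<epsilon> by (simp add: algebra_simps)
      finally show ?thesis by (simp add: r_def)
    qed
    moreover have "real (card (F - X)) \<le> \<epsilon> * real (card F)"
    proof -
      let ?W1 = "{u\<in>F. \<exists>q\<in>K \<union> B. q \<otimes> u \<notin> F}" and ?W2 = "{g\<in>F. ?a g = None}"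
      let ?W3 = "{g\<in>F. \<exists>k\<in>K. k \<otimes> g \<in> F \<and> ?a g \<noteq> ?a (k \<otimes> g)}"
      let ?W4 = "{u\<in>F. \<zeta> * card B < w u}"
      have "F - X \<subseteq> ?W1 \<union> (?W2 \<union> (?W3 \<union> ?W4))" by (auto simp: X_def not_le)
      then have "card (F - X) \<le> card (?W1 \<union> (?W2 \<union> (?W3 \<union> ?W4)))"
        using Fp by (intro card_mono) auto
      also have "\<dots> \<le> card ?W1 + (card ?W2 + (card ?W3 + card ?W4))"
        by (intro order_trans[OF card_Un_le] add_mono order_refl)
      finally have c: "real (card (F - X)) \<le> card ?W1 + (card ?W2 + (card ?W3 + card ?W4))"
        by linarith
      have "real (card ?W1) \<le> card (K \<union> B) * \<delta>' * card F"
        using K Bp by (intro almost_inv_card_bad[OF F]) (auto simp: Q_def)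
      also have "\<dots> \<le> \<epsilon> / 8 * card F"
      proof (rule mult_right_mono)
        have "card (K \<union> B) * \<delta>' \<le> card (K \<union> B) * (\<epsilon> / (8 * (card (K \<union> B) + 1)))"
          by (intro mult_left_mono) (auto simp: \<delta>'_def)
        also have "\<dots> \<le> \<epsilon> / 8" using \<epsilon> by (simp add: field_simps)
        finally show "card (K \<union> B) * \<delta>' \<le> \<epsilon> / 8" .
      qed simp
      finally have W1: "real (card ?W1) \<le> \<epsilon> / 8 * card F" .
      \<comment> \<open>Markov's inequality for the number \<open>w u\<close> of centers seen from
        \<open>u\<close>.\<close>
      have "card ?W4 * (\<zeta> * card B) = (\<Sum>u\<in>?W4. \<zeta> * card B)" by simp
      also have "\<dots> \<le> (\<Sum>u\<in>?W4. real (w u))" by (intro sum_mono) auto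
      also have "\<dots> \<le> (\<Sum>u\<in>F. real (w u))" using Fp by (intro sum_mono2) auto
      also have "\<dots> \<le> card Y * (\<Sum>C\<leftarrow>Cs. card C)"
      proof -
        have "(\<Sum>u\<in>F. w u) \<le> card Y * (\<Sum>C\<leftarrow>Cs. card C)"
          unfolding w_def using Fp Yp Cs by (intro sum_window_centers_le) auto
        then show ?thesis by (metis of_nat_le_iff of_nat_sum of_nat_mult)
      qed
      also have "\<dots> \<le> (2 * card B) * (32 / (\<epsilon> / 2 * (\<epsilon> / 8) * card T) * card F)"
        unfolding of_nat_mult of_nat_numeral using cY sum by (intro mult_mono) auto
      also have "\<dots> = card B * (1024 / (\<epsilon>\<^sup>2 * card T) * card F)"
        by (simp add: power2_eq_square)
      finally have "card ?W4 * \<zeta> * card B \<le> 1024 / (\<epsilon>\<^sup>2 * card T) * card F * card B"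
        by (simp add: mult_ac)
      then have 4: "card ?W4 * \<zeta> \<le> 1024 / (\<epsilon>\<^sup>2 * card T) * card F"
        using cB by (simp only: mult_le_cancel_right_pos)
      have "4096 / (\<epsilon> ^ 3 * \<zeta>) * (\<epsilon> ^ 3 * \<zeta>) \<le> card T * (\<epsilon> ^ 3 * \<zeta>)"
        using T(2) \<epsilon> \<zeta>_pos by (intro mult_right_mono) auto
      then have "4096 \<le> card T * (\<epsilon> ^ 3 * \<zeta>)" using \<epsilon> \<zeta>_pos by simp
      then have "1024 / (\<epsilon>\<^sup>2 * card T) \<le> \<epsilon> / 4 * \<zeta>"
        using \<epsilon> cT by (simp add: field_simps power2_eq_square power3_eq_cube)
      note 4
      also have "1024 / (\<epsilon>\<^sup>2 * card T) * card F \<le> \<epsilon> / 4 * \<zeta> * card F"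
        using \<open>1024 / (\<epsilon>\<^sup>2 * card T) \<le> \<epsilon> / 4 * \<zeta>\<close> by (intro mult_right_mono) auto
      also have "\<dots> = (\<epsilon> / 4 * card F) * \<zeta>" by simp
      finally have "card ?W4 * \<zeta> \<le> (\<epsilon> / 4 * card F) * \<zeta>" .
      then have "card ?W4 \<le> \<epsilon> / 4 * card F" using \<zeta>_pos by (simp only: mult_le_cancel_right_pos)
      moreover have "0 \<le> \<epsilon> * card F" using \<epsilon> by simp
      ultimately show ?thesis using c W1 none sep by linarith
    qed
    moreover have "\<forall>u\<in>X. \<forall>k\<in>K. k \<otimes> u \<in> F \<and> \<phi> (k \<otimes> u) = k \<otimes> \<phi> u"
    proof (intro ballI)
      fix u k assume u: "u \<in> X" and k: "k \<in> K"
      then obtain c where c: "?a u = Some c" "?a (k \<otimes> u) = Some c" by (auto simp: X_def)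
      have "k \<in> carrier G" "u \<in> carrier G" "c \<in> carrier G" using center[OF c(1)] k K u Fp by (auto simp: X_def)
      then have "\<phi> (k \<otimes> u) = k \<otimes> \<phi> u" by (simp add: \<phi>_def c m_assoc)
      moreover have "k \<otimes> u \<in> F" using u k unfolding X_def by blast
      ultimately show "k \<otimes> u \<in> F \<and> \<phi> (k \<otimes> u) = k \<otimes> \<phi> u" by blast
    qed
    moreover have "card ((\<lambda>u. \<lambda>b\<in>B. \<phi> (b \<otimes> u)) ` X) \<le> exp (\<epsilon> * real (card B))"
    proof -
      define \<L> where "\<L> = {Ds. length Ds = length Cs \<and> (\<forall>C\<in>set Ds. C \<subseteq> Y) \<and> (\<Sum>C\<leftarrow>Ds. card C) \<le> \<zeta> * card B}"
      define pat where "pat Ds = (\<lambda>b\<in>B. case asg (in_tile T) Ds b of None \<Rightarrow> \<tau>0 | Some c \<Rightarrow> b \<otimes> inv c)" for Ds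
      have fin\<L>: "finite \<L>" and card\<L>: "card \<L> \<le> exp (\<zeta> * card B * ln (1 / x) + x * (length Cs * card Y))"
        unfolding \<L>_def using card_small_set_lists_le[OF Yp(1), of x "length Cs" "\<zeta> * card B"] x01 by auto
      \<comment> \<open>In coordinates relative to \<open>u\<close>, the pattern is a function of
        the list of center sets seen through \<open>Y\<close>: the position of
        \<open>b \<otimes> u\<close> in the tile at \<open>c \<otimes> u\<close> is
        \<open>b \<otimes> inv c\<close>.\<close>
      have "(\<lambda>u. \<lambda>b\<in>B. \<phi> (b \<otimes> u)) ` X \<subseteq> pat ` \<L>"
      proof (rule image_subsetI)
        fix u assume u: "u \<in> X"
        then have uG: "u \<in> carrier G" using Fp by (auto simp: X_def)
        define Ds where "Ds = map (\<lambda>C. {x\<in>Y. x \<otimes> u \<in> C}) Cs"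
        have "w u = (\<Sum>C\<leftarrow>Ds. card C)" by (simp add: w_def Ds_def comp_def)
        then have "Ds \<in> \<L>" using u by (auto simp: \<L>_def X_def) (auto simp: Ds_def)
        moreover have "(\<lambda>b\<in>B. \<phi> (b \<otimes> u)) = pat Ds"
          unfolding pat_def
        proof (rule restrict_ext)
          fix b assume b: "b \<in> B"
          then have bG: "b \<in> carrier G" using Bp by auto
          have shift: "?a (b \<otimes> u) = map_option (\<lambda>x. x \<otimes> u) (asg (in_tile T) Ds b)"
            unfolding Ds_def using Cs b by (intro asg_shift[OF uG bG Tp(3) _ Yp(2)]) (auto simp: Y_def)
          show "\<phi> (b \<otimes> u) = (case asg (in_tile T) Ds b of None \<Rightarrow> \<tau>0 | Some c \<Rightarrow> b \<otimes> inv c)"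
          proof (cases "asg (in_tile T) Ds b")
            case None
            then show ?thesis by (simp add: \<phi>_def shift)
          next
            case (Some c)
            then have "c \<in> \<Union>(set Ds)" by (rule asg_SomeD)
            then have "c \<in> carrier G" using Yp by (auto simp: Ds_def)
            then show ?thesis using Some uG bG by (simp add: \<phi>_def shift inv_mult_group m_assoc)
          qed
        qed
        ultimately show "(\<lambda>b\<in>B. \<phi> (b \<otimes> u)) \<in> pat ` \<L>" by blast
      qed
      then have "card ((\<lambda>u. \<lambda>b\<in>B. \<phi> (b \<otimes> u)) ` X) \<le> card (pat ` \<L>)"
        using fin\<L> by (intro card_mono) auto
      also have "\<dots> \<le> card \<L>" using fin\<L> by (rule card_image_le)
      finally have "real (card ((\<lambda>u. \<lambda>b\<in>B. \<phi> (b \<otimes> u)) ` X)) \<le> exp (\<zeta> * card B * ln (1 / x) + x * (length Cs * card Y))"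
        using card\<L> by linarith
      also have "\<dots> \<le> exp (\<epsilon> * real (card B))"
      proof -
        have e1: "\<zeta> * card B * ln (1 / x) = \<epsilon> / 2 * card B" using ln_pos by (simp add: \<zeta>)
        have e2: "x * (length Cs * card Y) \<le> x * (2048 / \<epsilon> ^ 3 * (2 * card B))"
        proof -
          have "16 / (\<epsilon> / 2 * (\<epsilon> / 8)\<^sup>2) = 2048 / \<epsilon> ^ 3" by (simp add: power2_eq_square power3_eq_cube)
          then have "length Cs \<le> 2048 / \<epsilon> ^ 3" using len by linarith
          then show ?thesis unfolding of_nat_mult of_nat_numeral
            using x01 cY \<epsilon> by (intro mult_left_mono mult_mono) simp_all
        qed
        have e3: "x * (2048 / \<epsilon> ^ 3 * (2 * card B)) = \<epsilon> / 2 * card B"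
          using \<epsilon> by (simp add: x field_simps power_numeral_reduce)
        show ?thesis unfolding exp_le_cancel_iff using e1 e2 e3 by linarith
      qed
      finally show ?thesis .
    qed
    ultimately show ?thesis by blast
  qed
  moreover have "finite Q" "Q \<subseteq> carrier G" "0 < \<delta>'"
    using K Tp Bp \<epsilon> cT by (auto simp: Q_def \<delta>'_def)
  ultimately show "\<exists>Q \<delta>. finite Q \<and> Q \<subseteq> carrier G \<and> 0 < \<delta> \<and> (\<forall>F. almost_inv Q \<delta> F \<longrightarrow>
       (\<exists>\<phi> X. \<phi> \<in> F \<rightarrow> T \<and> X \<subseteq> F
          \<and> (\<Sum>u\<in>F. \<rho> (\<phi> u)) \<le> (1 + \<epsilon>) * ((\<Sum>\<tau>\<in>T. \<rho> \<tau>) / card T) * card F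
          \<and> real (card (F - X)) \<le> \<epsilon> * real (card F)
          \<and> (\<forall>u\<in>X. \<forall>k\<in>K. k \<otimes> u \<in> F \<and> \<phi> (k \<otimes> u) = k \<otimes> \<phi> u)
          \<and> card ((\<lambda>u. \<lambda>b\<in>B. \<phi> (b \<otimes> u)) ` X) \<le> exp (\<epsilon> * real (card B))))"
    by (intro exI[of _ Q] exI[of _ \<delta>']) simp
qed

lemma ex_good_tile:
  fixes \<epsilon> :: real
  assumes K: "finite K" "K \<subseteq> carrier G" and \<epsilon>: "0 < \<epsilon>" "\<epsilon> \<le> 1"
  shows "\<exists>\<delta> N. 0 < \<delta> \<and> (\<forall>T. almost_inv (K \<union> m_inv G ` K) \<delta> T \<and> N \<le> card T \<longrightarrow> good_tile K \<epsilon> T)"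
proof -
  define x where "x = \<epsilon> ^ 4 / 8192"
  define \<zeta> where "\<zeta> = \<epsilon> / (2 * ln (1 / x))"
  define \<delta> where "\<delta> = \<epsilon>\<^sup>2 / (512 * (card K + 1))"
  define N where "N = nat \<lceil>4096 / (\<epsilon> ^ 3 * \<zeta>)\<rceil>"
  have "card K * (2 * \<delta>) \<le> \<epsilon>\<^sup>2 / 256" by (simp add: \<delta>_def field_simps)
  moreover have "4096 / (\<epsilon> ^ 3 * \<zeta>) \<le> card T" if "N \<le> card T" for T
    using that unfolding N_def by linarith
  moreover have "0 < \<delta>" using \<epsilon> by (simp add: \<delta>_def)
  ultimately show ?thesis
    using good_tile_step[OF K \<epsilon> _ x_def \<zeta>_def] by (intro exI[of _ \<delta>] exI[of _ N]) blast
qed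

end

section \<open>Sequences of tilings\<close>

text \<open>The composite of the position maps from level \<open>M\<close> down to level
  \<open>n\<close>. The \<open>else\<close> branch is the empty composite for
  \<open>n = Suc M\<close> and a filler for larger \<open>n\<close>.\<close>

primrec down :: "(nat \<Rightarrow> 'a \<Rightarrow> 'a) \<Rightarrow> nat \<Rightarrow> nat \<Rightarrow> 'a \<Rightarrow> 'a" where
  "down \<phi> n 0 u = u"
| "down \<phi> n (Suc M) u = (if n \<le> M then down \<phi> n M (\<phi> M u) else u)"

lemma down_same [simp]: "down \<phi> n n u = u"
  by (cases n) auto

text \<open>\<open>F n\<close> is the shape of the tiles of level \<open>n\<close>. A point \<open>u\<close> of \<open>F (n + 1)\<close> has position \<open>\<phi> n u\<close> in
  its tile of level \<open>n\<close>, so this tile is a subset of \<open>F n\<close> translated by the center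
  \<open>inv (\<phi> n u) \<otimes> u\<close>. The equation \<open>\<phi> n (k \<otimes> u) = k \<otimes> \<phi> n u\<close> says that \<open>u\<close> and
  \<open>k \<otimes> u\<close> lie in the same tile.\<close>

locale tiling_sequence = group G for G (structure) +
  fixes F K B Bad :: "nat \<Rightarrow> 'a set" and \<phi> :: "nat \<Rightarrow> 'a \<Rightarrow> 'a"
  assumes countable_carrier: "countable (carrier G)"
    and infinite_carrier: "infinite (carrier G)"
    and F: "finite (F n)" "F n \<noteq> {}" "F n \<subseteq> carrier G"
    and \<phi>: "u \<in> F (Suc n) \<Longrightarrow> \<phi> n u \<in> F n"
    and K_sub: "K n \<subseteq> carrier G" and K_Suc: "K n \<subseteq> K (Suc n)" and K_all: "carrier G \<subseteq> (\<Union>n. K n)"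
    and B: "finite (B n)" "B n \<noteq> {}" "B n \<subseteq> K (Suc n)"
    and good: "u \<in> F (Suc n) \<Longrightarrow> u \<notin> Bad n \<Longrightarrow> k \<in> K n \<Longrightarrow>
       k \<otimes> u \<in> F (Suc n) \<and> \<phi> n (k \<otimes> u) = k \<otimes> \<phi> n u"
    and patterns: "card ((\<lambda>u. \<lambda>b\<in>B n. \<phi> n (b \<otimes> u)) ` (F (Suc n) - Bad n)) \<le> exp ((1 / 4) ^ n * real (card (B n)))"
    and bad_freq: "n < M \<Longrightarrow>
       card {u \<in> F M. down \<phi> (Suc n) M u \<in> Bad n} \<le> 3 * (1 / 2) ^ n * real (card (F M))"

context group
begin

lemma ex_tile:
  assumes fol: "folner_sequence G Fs" and inf: "infinite (carrier G)"
    and Q: "finite Q" "Q \<subseteq> carrier G" "0 < (\<delta>::real)"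
    and K: "finite K" "K \<subseteq> carrier G" "0 < (\<epsilon>::real)" "\<epsilon> \<le> 1"
  shows "\<exists>F. almost_inv Q \<delta> F \<and> good_tile K \<epsilon> F"
proof -
  obtain \<delta>' N where \<delta>': "0 < \<delta>'" and good: "\<And>T. almost_inv (K \<union> m_inv G ` K) \<delta>' T \<Longrightarrow> N \<le> card T \<Longrightarrow> good_tile K \<epsilon> T"
    using ex_good_tile[OF K] by blast
  have "K \<union> m_inv G ` K \<subseteq> carrier G" "finite (K \<union> m_inv G ` K)" using K by auto
  then have "\<forall>\<^sub>F n in sequentially. almost_inv Q \<delta> (Fs n) \<and> almost_inv (K \<union> m_inv G ` K) \<delta>' (Fs n) \<and> N \<le> card (Fs n)"
    using folner_sequence_almost_inv[OF fol] folner_sequence_card[OF fol inf] Q \<delta>'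
    by (intro eventually_conj) auto
  then obtain n where "almost_inv Q \<delta> (Fs n)" "almost_inv (K \<union> m_inv G ` K) \<delta>' (Fs n)" "N \<le> card (Fs n)"
    using eventually_happens'[OF sequentially_bot] by blast
  then show ?thesis using good by blast
qed

text \<open>Dependent choice of tiles. The state carries, besides the tile, a weight on it that
  records all earlier bad sets, and \<open>good_tile\<close> is applied to this accumulated weight
  at each step.\<close>

theorem ex_tiling_sequence:
  assumes fol: "folner_sequence G Fs" and inf: "infinite (carrier G)" and cnt: "countable (carrier G)"
  shows "\<exists>F K B Bad \<phi>. tiling_sequence G F K B Bad \<phi>"
proof -
  \<comment> \<open>Charged with \<open>2 ^ n\<close>, a set of density \<open>\<epsilon> n\<close>
    still costs only \<open>(1 / 2) ^ n / 8\<close>, which is summable.\<close>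
  define \<epsilon> :: "nat \<Rightarrow> real" where "\<epsilon> n = (1 / 4) ^ n / 8" for n
  have \<epsilon>: "0 < \<epsilon> n" "\<epsilon> n \<le> 1" "\<epsilon> n \<le> (1 / 4) ^ n" for n
  proof -
    have "0 < (1 / 4 :: real) ^ n" "(1 / 4 :: real) ^ n \<le> 1" by (auto simp: power_le_one)
    then show "0 < \<epsilon> n" "\<epsilon> n \<le> 1" "\<epsilon> n \<le> (1 / 4) ^ n" unfolding \<epsilon>_def by linarith+
  qed
  define enum where "enum = from_nat_into (carrier G)"
  have enum: "enum n \<in> carrier G" "range enum = carrier G" for n
  proof -
    have ne: "carrier G \<noteq> {}" using one_closed by blast
    show "enum n \<in> carrier G" "range enum = carrier G"
      unfolding enum_def using from_nat_into[OF ne] range_from_nat_into[OF ne cnt] by auto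
  qed
  \<comment> \<open>The gap \<open>2 * (1 / 2) ^ n\<close> below 3 is what remains for all later
    increases of the mean weight. At level 0 the weight is constantly 1 and the bound is an
    equality.\<close>
  define P where "P n = (\<lambda>(K, F, \<rho>). finite K \<and> K \<subseteq> carrier G \<and> finite F \<and> F \<noteq> {} \<and> F \<subseteq> carrier G
    \<and> good_tile K (\<epsilon> n) F \<and> (\<forall>\<tau>. 1 \<le> \<rho> \<tau>) \<and> (\<Sum>\<tau>\<in>F. \<rho> \<tau>) \<le> (3 - 2 * (1 / 2) ^ n) * real (card F))"
    for n and p :: "'a set \<times> 'a set \<times> ('a \<Rightarrow> real)"
  define R where "R n = (\<lambda>(K, F, \<rho> :: 'a \<Rightarrow> real) (K', F', \<rho>' :: 'a \<Rightarrow> real) \<phi> Bad B. \<phi> \<in> F' \<rightarrow> F \<and> Bad \<subseteq> F' \<and> K \<subseteq> K' \<and> enum n \<in> K'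
    \<and> finite B \<and> B \<noteq> {} \<and> B \<subseteq> K' \<and> (\<forall>u\<in>F' - Bad. \<forall>k\<in>K. k \<otimes> u \<in> F' \<and> \<phi> (k \<otimes> u) = k \<otimes> \<phi> u)
    \<and> card ((\<lambda>u. \<lambda>b\<in>B. \<phi> (b \<otimes> u)) ` (F' - Bad)) \<le> exp (\<epsilon> n * real (card B))
    \<and> \<rho>' = (\<lambda>u. \<rho> (\<phi> u) + (if u \<in> Bad then 2 ^ n else 0)))"
    for n :: nat and p q :: "'a set \<times> 'a set \<times> ('a \<Rightarrow> real)" and \<phi> :: "'a \<Rightarrow> 'a" and Bad B :: "'a set"
  have "\<exists>f. \<forall>n. P n (f n) \<and> (\<exists>\<phi> Bad B. R n (f n) (f (Suc n)) \<phi> Bad B)"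
  proof (rule dependent_nat_choice)
    have "\<exists>F. almost_inv {} 1 F \<and> good_tile {} (\<epsilon> 0) F"
      by (rule ex_tile[OF fol inf]) (simp_all add: \<epsilon>)
    then obtain F where "almost_inv {} 1 F" "good_tile {} (\<epsilon> 0) F" by blast
    then have "P 0 ({}, F, \<lambda>_. 1)" by (auto simp: P_def almost_inv_def)
    then show "\<exists>p. P 0 p" by blast
  next
    fix p n assume "P n p"
    then obtain K F \<rho> where p: "p = (K, F, \<rho>)" and K: "finite K" "K \<subseteq> carrier G"
      and F: "finite F" "F \<noteq> {}" "F \<subseteq> carrier G" and good: "good_tile K (\<epsilon> n) F"
      and \<rho>: "\<And>\<tau>. 1 \<le> \<rho> \<tau>" "(\<Sum>\<tau>\<in>F. \<rho> \<tau>) \<le> (3 - 2 * (1 / 2) ^ n) * real (card F)"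
      unfolding P_def by (cases p) auto
    have cF: "0 < real (card F)" using F by (simp add: card_gt_0_iff)
    have \<rho>0: "0 \<le> \<rho> \<tau>" for \<tau> using \<rho>(1)[of \<tau>] by linarith
    have "card F \<le> (\<Sum>\<tau>\<in>F. \<rho> \<tau>)" using sum_mono[of F "\<lambda>_. 1" \<rho>] \<rho> by simp
    then have pos: "0 < (\<Sum>\<tau>\<in>F. \<rho> \<tau>)" using cF by linarith
    have "m_inv G ` F \<subseteq> carrier G" using F by auto
    then have "\<forall>\<^sub>F n in sequentially. almost_inv (m_inv G ` F) (1 / card F) (Fs n)"
      using folner_sequence_almost_inv[OF fol, of "m_inv G ` F" "1 / card F"] F cF by auto
    then obtain B where B: "almost_inv (m_inv G ` F) (1 / card F) B"
      using eventually_happens'[OF sequentially_bot] by blast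
    have "(\<forall>\<tau>. 0 \<le> \<rho> \<tau>) \<and> 0 < (\<Sum>\<tau>\<in>F. \<rho> \<tau>) \<and> almost_inv (m_inv G ` F) (1 / card F) B"
      using \<rho>0 pos B by blast
    from good[unfolded good_tile_def, THEN spec, THEN spec, THEN mp, OF this]
    obtain Q \<delta> where Q: "finite Q" "Q \<subseteq> carrier G" "0 < \<delta>" and step: "\<forall>F'. almost_inv Q \<delta> F' \<longrightarrow>
       (\<exists>\<phi> X. \<phi> \<in> F' \<rightarrow> F \<and> X \<subseteq> F'
          \<and> (\<Sum>u\<in>F'. \<rho> (\<phi> u)) \<le> (1 + \<epsilon> n) * ((\<Sum>\<tau>\<in>F. \<rho> \<tau>) / card F) * card F'
          \<and> real (card (F' - X)) \<le> \<epsilon> n * card F'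
          \<and> (\<forall>u\<in>X. \<forall>k\<in>K. k \<otimes> u \<in> F' \<and> \<phi> (k \<otimes> u) = k \<otimes> \<phi> u)
          \<and> card ((\<lambda>u. \<lambda>b\<in>B. \<phi> (b \<otimes> u)) ` X) \<le> exp (\<epsilon> n * card B))"
      by (elim exE conjE) (rule that)
    \<comment> \<open>Adding \<open>enum n\<close> makes the sets exhaust the group. Adding
      \<open>B\<close> keeps the window \<open>B\<close> inside one tile from the next level on,
      outside the later bad sets.\<close>
    define K' where "K' = K \<union> B \<union> {enum n}"
    have Bp: "finite B" "B \<noteq> {}" "B \<subseteq> carrier G" using B by (auto simp: almost_inv_def)
    have K': "finite K'" "K' \<subseteq> carrier G" using K Bp enum by (auto simp: K'_def)
    obtain F' where F': "almost_inv Q \<delta> F'" and good': "good_tile K' (\<epsilon> (Suc n)) F'"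
      using ex_tile[OF fol inf Q K' \<epsilon>(1,2)] by blast
    have F'p: "finite F'" "F' \<noteq> {}" "F' \<subseteq> carrier G" using F' by (auto simp: almost_inv_def)
    obtain \<phi> X where \<phi>: "\<phi> \<in> F' \<rightarrow> F" "X \<subseteq> F'"
      and sum: "(\<Sum>u\<in>F'. \<rho> (\<phi> u)) \<le> (1 + \<epsilon> n) * ((\<Sum>\<tau>\<in>F. \<rho> \<tau>) / card F) * card F'"
      and bad: "real (card (F' - X)) \<le> \<epsilon> n * card F'"
      and eq: "\<forall>u\<in>X. \<forall>k\<in>K. k \<otimes> u \<in> F' \<and> \<phi> (k \<otimes> u) = k \<otimes> \<phi> u"
      and pat: "card ((\<lambda>u. \<lambda>b\<in>B. \<phi> (b \<otimes> u)) ` X) \<le> exp (\<epsilon> n * card B)"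
      using step[THEN spec, THEN mp, OF F'] by (elim exE conjE) (rule that)
    define \<rho>' where "\<rho>' = (\<lambda>u. \<rho> (\<phi> u) + (if u \<in> F' - X then 2 ^ n else 0))"
    have X: "F' - (F' - X) = X" using \<phi> by auto
    have R: "R n p (K', F', \<rho>') \<phi> (F' - X) B"
      unfolding p R_def prod.case X using \<phi> eq pat Bp \<rho>'_def by (auto simp: K'_def)
    \<comment> \<open>With \<open>h = (1 / 2) ^ n\<close> the mean weight grows from at most
      \<open>3 - 2 * h\<close> to at most \<open>(1 + h\<^sup>2 / 8) * (3 - 2 * h) + h / 8\<close>,
      where the last term is \<open>2 ^ n * \<epsilon> n\<close>. This is below
      \<open>3 - h\<close>, the bound for the next level.\<close>
    define h :: real where "h = (1 / 2) ^ n"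
    have h: "0 < h" "h \<le> 1" by (auto simp: h_def power_le_one)
    have hh: "\<epsilon> n = h\<^sup>2 / 8" "(2::real) ^ n * h = 1" "(1 / 2) ^ Suc n = h / 2"
      by (simp_all add: \<epsilon>_def h_def power2_eq_square flip: power_mult_distrib)
    have "(\<Sum>u\<in>F'. \<rho>' u) = (\<Sum>u\<in>F'. \<rho> (\<phi> u)) + 2 ^ n * card (F' - X)"
    proof -
      have "{u\<in>F'. u \<in> F' - X} = F' - X" by auto
      then show ?thesis
        unfolding \<rho>'_def sum.distrib using F'p
        by (simp only: flip: sum.inter_filter) simp
    qed
    also have "\<dots> \<le> (1 + \<epsilon> n) * (3 - 2 * h) * card F' + 2 ^ n * (\<epsilon> n * card F')"
    proof (intro add_mono mult_left_mono)
      have "(\<Sum>\<tau>\<in>F. \<rho> \<tau>) / card F \<le> 3 - 2 * h"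
        using \<rho>(2) cF by (simp add: pos_divide_le_eq h_def)
      then have "(1 + \<epsilon> n) * ((\<Sum>\<tau>\<in>F. \<rho> \<tau>) / card F) * card F' \<le> (1 + \<epsilon> n) * (3 - 2 * h) * card F'"
        using \<epsilon>(1)[of n] by (intro mult_right_mono mult_left_mono) auto
      then show "(\<Sum>u\<in>F'. \<rho> (\<phi> u)) \<le> (1 + \<epsilon> n) * (3 - 2 * h) * card F'" using sum by linarith
    qed (use bad in auto)
    also have "\<dots> = ((1 + h\<^sup>2 / 8) * (3 - 2 * h) + h / 8) * card F'"
    proof -
      have "2 ^ n * \<epsilon> n = (2 ^ n * h) * h / 8" unfolding hh(1) by (simp add: power2_eq_square)
      then have e: "2 ^ n * \<epsilon> n = h / 8" unfolding hh(2) by simp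
      have "2 ^ n * (\<epsilon> n * card F') = h / 8 * card F'" unfolding e[symmetric] by simp
      then show ?thesis unfolding hh(1)[symmetric] by (simp only: distrib_right)
    qed
    also have "\<dots> \<le> (3 - 2 * (1 / 2) ^ Suc n) * card F'"
    proof (rule mult_right_mono)
      have "h\<^sup>2 \<le> h" using h by (simp add: power2_eq_square mult_left_le)
      then have "h\<^sup>2 / 8 * (3 - 2 * h) \<le> h / 8 * 3"
        using h by (intro mult_mono) auto
      moreover have "(1 + h\<^sup>2 / 8) * (3 - 2 * h) = 3 - 2 * h + h\<^sup>2 / 8 * (3 - 2 * h)"
        by (simp only: distrib_right mult_1)
      ultimately have "(1 + h\<^sup>2 / 8) * (3 - 2 * h) + h / 8 \<le> 3 - h"
        using h by linarith
      then show "(1 + h\<^sup>2 / 8) * (3 - 2 * h) + h / 8 \<le> 3 - 2 * (1 / 2) ^ Suc n"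
        unfolding hh(3) by simp
    qed simp
    finally have sum': "(\<Sum>u\<in>F'. \<rho>' u) \<le> (3 - 2 * (1 / 2) ^ Suc n) * real (card F')" .
    have "1 \<le> \<rho>' u" for u using \<rho>(1)[of "\<phi> u"] by (simp add: \<rho>'_def add_increasing2)
    then have "P (Suc n) (K', F', \<rho>')"
      using K' F'p good' sum' by (simp add: P_def)
    then show "\<exists>q. P (Suc n) q \<and> (\<exists>\<phi> Bad B. R n p q \<phi> Bad B)" using R by blast
  qed
  then obtain f where f: "\<And>n. P n (f n)" and "\<forall>n. \<exists>\<phi> Bad B. R n (f n) (f (Suc n)) \<phi> Bad B" by blast
  then obtain \<phi> Bad B where R: "\<And>n. R n (f n) (f (Suc n)) (\<phi> n) (Bad n) (B n)" by metis
  define K where "K n = fst (f n)" for n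
  define F where "F n = fst (snd (f n))" for n
  define \<rho> where "\<rho> n = snd (snd (f n))" for n
  have f_eq: "f n = (K n, F n, \<rho> n)" for n by (simp add: K_def F_def \<rho>_def)
  note f = f[unfolded f_eq P_def prod.case] and R = R[unfolded f_eq R_def prod.case]
  have "tiling_sequence G F K B Bad \<phi>"
  proof
    fix n M u k
    show "countable (carrier G)" "infinite (carrier G)" by fact+
    show "finite (F n)" "F n \<noteq> {}" "F n \<subseteq> carrier G" "K n \<subseteq> carrier G" using f[of n] by auto
    show "u \<in> F (Suc n) \<Longrightarrow> \<phi> n u \<in> F n" "K n \<subseteq> K (Suc n)" "finite (B n)" "B n \<noteq> {}" "B n \<subseteq> K (Suc n)"
      using R[of n] by auto
    show "carrier G \<subseteq> (\<Union>n. K n)"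
    proof
      fix g assume "g \<in> carrier G"
      then obtain n where "g = enum n" using enum(2) by auto
      then show "g \<in> (\<Union>n. K n)" using R[of n] by auto
    qed
    show "u \<in> F (Suc n) \<Longrightarrow> u \<notin> Bad n \<Longrightarrow> k \<in> K n \<Longrightarrow> k \<otimes> u \<in> F (Suc n) \<and> \<phi> n (k \<otimes> u) = k \<otimes> \<phi> n u"
      using R[of n] by auto
    have "card ((\<lambda>u. \<lambda>b\<in>B n. \<phi> n (b \<otimes> u)) ` (F (Suc n) - Bad n)) \<le> exp (\<epsilon> n * real (card (B n)))"
      using R[of n] by auto
    also have "\<dots> \<le> exp ((1 / 4) ^ n * real (card (B n)))"
      using \<epsilon>(3)[of n] by (simp add: mult_right_mono)
    finally show "card ((\<lambda>u. \<lambda>b\<in>B n. \<phi> n (b \<otimes> u)) ` (F (Suc n) - Bad n)) \<le> exp ((1 / 4) ^ n * real (card (B n)))" .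
    assume "n < M"
    \<comment> \<open>The charge for \<open>Bad n\<close> survives on all higher levels, because
      each weight dominates the previous one at the position below.\<close>
    have weight: "(if down \<phi> (Suc n) M u \<in> Bad n then 2 ^ n else 0) \<le> \<rho> M u" for u
      using \<open>n < M\<close>
    proof (induction M arbitrary: u)
      case (Suc M)
      have \<rho>: "\<rho> (Suc M) u = \<rho> M (\<phi> M u) + (if u \<in> Bad M then 2 ^ M else 0)"
        using R[of M] by auto
      show ?case
      proof (cases "n = M")
        case True
        have "1 \<le> \<rho> M (\<phi> M u)" using f[of M] by auto
        then show ?thesis unfolding \<rho> True by simp
      next
        case False
        then have "(if down \<phi> (Suc n) M (\<phi> M u) \<in> Bad n then 2 ^ n else 0) \<le> \<rho> M (\<phi> M u)"
          using Suc by simp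
        also have "\<dots> \<le> \<rho> (Suc M) u" unfolding \<rho> by simp
        finally show ?thesis using False Suc.prems by simp
      qed
    qed simp
    have finF: "finite (F M)" using f[of M] by auto
    have "card {u\<in>F M. down \<phi> (Suc n) M u \<in> Bad n} * 2 ^ n
      = (\<Sum>u\<in>F M. if down \<phi> (Suc n) M u \<in> Bad n then 2 ^ n else (0::real))"
      using finF by (simp flip: sum.inter_filter)
    also have "\<dots> \<le> (\<Sum>u\<in>F M. \<rho> M u)" by (intro sum_mono weight)
    also have "\<dots> \<le> (3 - 2 * (1 / 2) ^ M) * real (card (F M))" using f[of M] by auto
    also have "\<dots> \<le> 3 * real (card (F M))" by (intro mult_right_mono) auto
    finally show "card {u\<in>F M. down \<phi> (Suc n) M u \<in> Bad n} \<le> 3 * (1 / 2) ^ n * real (card (F M))"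
      by (simp add: field_simps power_divide)
  qed
  then show ?thesis by blast
qed

end

section \<open>The limit measure\<close>

lemma down_Suc_same [simp]: "down \<phi> n (Suc n) u = \<phi> n u"
  by simp

lemma down_down:
  assumes "n \<le> m" "m \<le> M"
  shows "down \<phi> n m (down \<phi> m M u) = down \<phi> n M u"
  using assms(2)
proof (induction M arbitrary: u)
  case (Suc M)
  show ?case
  proof (cases "m = Suc M")
    case True
    then show ?thesis by simp
  next
    case False
    then show ?thesis using Suc assms(1) by simp
  qed
qed simp

lemma map_pmf_down:
  assumes "\<And>n. map_pmf (\<phi> n) (P (Suc n)) = P n" "n \<le> M"
  shows "map_pmf (down \<phi> n M) (P M) = P n"
  using assms(2)
proof (induction M)
  case 0
  then show ?case by (simp add: map_pmf_idI)
next
  case (Suc M)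
  show ?case
  proof (cases "n = Suc M")
    case True
    then have "down \<phi> n (Suc M) = id" by (auto simp: fun_eq_iff)
    then show ?thesis using True by (simp add: pmf.map_id)
  next
    case False
    then have "down \<phi> n (Suc M) = down \<phi> n M \<circ> \<phi> M" using Suc by auto
    then have "map_pmf (down \<phi> n (Suc M)) (P (Suc M)) = map_pmf (down \<phi> n M) (map_pmf (\<phi> M) (P (Suc M)))"
      by (simp only: pmf.map_comp)
    then show ?thesis using Suc False assms(1)[of M] by (simp del: down.simps)
  qed
qed

text \<open>Kolmogorov extension: the coordinates in a finite set \<open>J\<close> get the law of a
  point of level \<open>top J\<close> together with its images on the lower levels of
  \<open>J\<close>, and consistency is the hypothesis iterated. Positions are coded by reals because
  the projective limit is formed over a Polish space.\<close>

theorem pmf_inverse_limit: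
  fixes P :: "nat \<Rightarrow> 'a pmf"
  assumes cons: "\<And>n. map_pmf (\<phi> n) (P (Suc n)) = P n"
  obtains \<mu> where "prob_space \<mu>" "sets \<mu> = sets (PiM UNIV (\<lambda>_. count_space UNIV))"
    "AE \<omega> in \<mu>. \<forall>n. \<omega> n \<in> set_pmf (P n) \<and> \<phi> n (\<omega> (Suc n)) = \<omega> n"
    "\<And>n A. measure \<mu> {\<omega>. \<omega> n \<in> A} = measure (P n) A"
proof -
  define S where "S = (\<Union>n. set_pmf (P n))"
  define e :: "'a \<Rightarrow> real" where "e x = real (to_nat_on S x)" for x
  define d where "d y = from_nat_into S (nat \<lfloor>y::real\<rfloor>)" for y
  have "countable S" by (auto simp: S_def)
  then have de: "d (e x) = x" if "x \<in> S" for x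
    using that by (simp add: d_def e_def)
  have d_meas [measurable]: "d \<in> borel \<rightarrow>\<^sub>M count_space UNIV"
    unfolding d_def by (rule measurable_compose[OF measurable_real_floor]) simp
  \<comment> \<open>The value 0 at the empty set keeps \<open>top\<close> monotone.\<close>
  define top where "top J = (if J = {} then 0 else Max J)" for J :: "nat set"
  have top_le: "j \<le> top J" if "finite J" "j \<in> J" for j J using that by (auto simp: top_def)
  have top_mono: "top J \<le> top H" if "finite H" "J \<subseteq> H" for J H
    using that by (auto simp: top_def intro: Max_mono)
  define cod where "cod J u = (\<lambda>j\<in>J. e (down \<phi> j (top J) u))" for J u
  have cod_meas [measurable]: "cod J \<in> measure_pmf p \<rightarrow>\<^sub>M PiM J (\<lambda>_. borel)" for J p
    by (auto simp: cod_def space_PiM)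
  define Q where "Q J = distr (P (top J)) (PiM J (\<lambda>_. borel)) (cod J)" for J
  interpret polish_projective UNIV Q
  proof (intro polish_projective.intro projective_family.intro)
    fix J :: "nat set"
    show "prob_space (Q J)" unfolding Q_def by (intro prob_space.prob_space_distr prob_space_measure_pmf cod_meas)
    fix H assume JH: "J \<subseteq> H" "finite H"
    have "P (top J) = map_pmf (down \<phi> (top J) (top H)) (P (top H))"
      using map_pmf_down[of \<phi> P, OF cons top_mono[OF JH(2,1)]] by simp
    then have "Q J = distr (distr (P (top H)) (count_space UNIV) (down \<phi> (top J) (top H))) (PiM J (\<lambda>_. borel)) (cod J)"
      unfolding Q_def by (simp add: map_pmf_rep_eq)
    also have "\<dots> = distr (P (top H)) (PiM J (\<lambda>_. borel)) (cod J \<circ> down \<phi> (top J) (top H))"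
      by (intro distr_distr) (auto simp: cod_def space_PiM)
    also have "cod J \<circ> down \<phi> (top J) (top H) = (\<lambda>f. restrict f J) \<circ> cod H"
    proof
      fix u show "(cod J \<circ> down \<phi> (top J) (top H)) u = ((\<lambda>f. restrict f J) \<circ> cod H) u"
        using JH top_le[OF finite_subset[OF JH]] top_mono[OF JH(2,1)]
        by (auto simp: cod_def restrict_def down_down fun_eq_iff)
    qed
    also have "distr (P (top H)) (PiM J (\<lambda>_. borel)) ((\<lambda>f. restrict f J) \<circ> cod H)
       = distr (Q H) (PiM J (\<lambda>_. borel)) (\<lambda>f. restrict f J)"
      unfolding Q_def using JH by (intro distr_distr[symmetric] measurable_restrict_subset)
        (auto simp: cod_def space_PiM)
    finally show "Q J = distr (Q H) (PiM J (\<lambda>_. borel)) (\<lambda>f. restrict f J)" .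
  qed
  have restr: "(\<lambda>f. restrict f J) \<in> lim \<rightarrow>\<^sub>M PiM J (\<lambda>_. borel)" for J
    unfolding measurable_cong_sets[OF sets_lim refl] by (rule measurable_restrict_subset) simp
  have marg: "distr lim (PiM J (\<lambda>_. borel)) (\<lambda>f. restrict f J) = Q J" if "finite J" for J
  proof (rule measure_eqI)
    show "sets (distr lim (PiM J (\<lambda>_. borel)) (\<lambda>f. restrict f J)) = sets (Q J)" by (simp add: Q_def)
    fix X assume "X \<in> sets (distr lim (PiM J (\<lambda>_. borel)) (\<lambda>f. restrict f J))"
    then have X: "X \<in> sets (PiM J (\<lambda>_. borel))" by simp
    have "emeasure (distr lim (PiM J (\<lambda>_. borel)) (\<lambda>f. restrict f J)) X = emeasure lim (prod_emb UNIV (\<lambda>_. borel) J X)"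
      by (subst emeasure_distr[OF restr X]) (auto simp: prod_emb_def space_PiM vimage_def)
    also have "\<dots> = emeasure (Q J) X" using that X by (intro emeasure_lim_emb) auto
    finally show "emeasure (distr lim (PiM J (\<lambda>_. borel)) (\<lambda>f. restrict f J)) X = emeasure (Q J) X" .
  qed
  have AE_lim: "AE f in lim. R (restrict f J)"
    if J: "finite J" and R: "\<And>u. u \<in> set_pmf (P (top J)) \<Longrightarrow> R (cod J u)"
      and meas: "{f\<in>space (PiM J (\<lambda>_. borel)). R f} \<in> sets (PiM J (\<lambda>_. borel))" for J R
  proof -
    have "AE f in Q J. R f"
      unfolding Q_def AE_distr_iff[OF cod_meas meas] using R by (auto simp: AE_measure_pmf_iff)
    then have "AE f in distr lim (PiM J (\<lambda>_. borel)) (\<lambda>f. restrict f J). R f"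
      unfolding marg[OF J, symmetric] .
    then show ?thesis
      by (simp only: AE_distr_iff[OF restr meas])
  qed
  define dec where "dec f = (\<lambda>n. d (f n))" for f :: "nat \<Rightarrow> real"
  have dec_meas [measurable]: "dec \<in> lim \<rightarrow>\<^sub>M PiM UNIV (\<lambda>_. count_space UNIV)"
  proof -
    have "(\<lambda>f. d (f n)) \<in> lim \<rightarrow>\<^sub>M count_space UNIV" for n
    proof (rule measurable_compose[OF _ d_meas])
      show "(\<lambda>f. f n) \<in> lim \<rightarrow>\<^sub>M borel"
        unfolding measurable_cong_sets[OF sets_lim refl] by (rule measurable_component_singleton) simp
    qed
    then show ?thesis unfolding dec_def by (intro measurable_PiM_single') (auto simp: space_PiM)
  qed
  have coord: "{f\<in>space (PiM J (\<lambda>_. borel)). d (f j) \<in> A} \<in> sets (PiM J (\<lambda>_. borel))" if "j \<in> J" for j J A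
  proof -
    have "(\<lambda>f. d (f j)) \<in> PiM J (\<lambda>_. borel) \<rightarrow>\<^sub>M count_space UNIV"
      by (rule measurable_compose[OF measurable_component_singleton[OF that] d_meas])
    then have "(\<lambda>f. d (f j)) -` A \<inter> space (PiM J (\<lambda>_. borel)) \<in> sets (PiM J (\<lambda>_. borel))"
      by (rule measurable_sets) simp
    then show ?thesis by (simp add: vimage_def Int_def conj_commute)
  qed
  define \<mu> where "\<mu> = distr lim (PiM UNIV (\<lambda>_. count_space UNIV)) dec"
  have sets: "{\<omega>. \<omega> n \<in> A} \<in> sets (PiM UNIV (\<lambda>_. count_space UNIV))" for n and A :: "'a set"
  proof -
    have "(\<lambda>\<omega>. \<omega> n) -` A \<inter> space (PiM UNIV (\<lambda>_. count_space UNIV)) \<in> sets (PiM UNIV (\<lambda>_. count_space UNIV))"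
      by (rule measurable_sets[of _ _ "count_space UNIV"]) auto
    then show ?thesis by (simp add: vimage_def space_PiM)
  qed
  show thesis
  proof (rule that[of \<mu>])
    show "prob_space \<mu>" unfolding \<mu>_def by (intro P.prob_space_distr dec_meas)
    show "sets \<mu> = sets (PiM UNIV (\<lambda>_. count_space UNIV))" by (simp add: \<mu>_def)
    have inS: "u \<in> set_pmf (P n) \<Longrightarrow> u \<in> S" for u n by (auto simp: S_def)
    have AE1: "AE f in lim. d (f n) \<in> set_pmf (P n)" for n
    proof -
      have "AE f in lim. d (restrict f {n} n) \<in> set_pmf (P n)"
        using inS by (intro AE_lim[of "{n}" "\<lambda>f. d (f n) \<in> set_pmf (P n)"] coord)
          (auto simp: top_def cod_def de)
      then show ?thesis by simp
    qed
    have AE2: "AE f in lim. \<phi> n (d (f (Suc n))) = d (f n)" for n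
    proof -
      have "AE f in lim. \<phi> n (d (restrict f {n, Suc n} (Suc n))) = d (restrict f {n, Suc n} n)"
      proof (rule AE_lim[of "{n, Suc n}" "\<lambda>f. \<phi> n (d (f (Suc n))) = d (f n)"])
        fix u assume u: "u \<in> set_pmf (P (top {n, Suc n}))"
        then have u: "u \<in> set_pmf (P (Suc n))" by (simp add: top_def)
        then have "\<phi> n u \<in> set_pmf (P n)" using cons[of n] by (metis imageI pmf.set_map)
        with u show "\<phi> n (d (cod {n, Suc n} u (Suc n))) = d (cod {n, Suc n} u n)"
          by (simp add: cod_def top_def de[OF inS])
      next
        \<comment> \<open>Only countably many values are decoded, so the relation between two
          coordinates is a countable union of product events.\<close>
        have c: "countable (range d)"
          unfolding d_def by (rule countable_subset[of _ "range (from_nat_into S)"]) auto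
        have "{f\<in>space (PiM {n, Suc n} (\<lambda>_. borel)). \<phi> n (d (f (Suc n))) = d (f n)}
          = (\<Union>x\<in>range d. {f\<in>space (PiM {n, Suc n} (\<lambda>_. borel)). d (f (Suc n)) \<in> {x}}
              \<inter> {f\<in>space (PiM {n, Suc n} (\<lambda>_. borel)). d (f n) \<in> {\<phi> n x}})" by auto
        also have "\<dots> \<in> sets (PiM {n, Suc n} (\<lambda>_. borel))"
          by (intro sets.countable_UN'' c sets.Int coord) auto
        finally show "{f\<in>space (PiM {n, Suc n} (\<lambda>_. borel)). \<phi> n (d (f (Suc n))) = d (f n)}
           \<in> sets (PiM {n, Suc n} (\<lambda>_. borel))" .
      qed simp
      then show ?thesis by simp
    qed
    have "AE f in lim. \<forall>n. d (f n) \<in> set_pmf (P n) \<and> \<phi> n (d (f (Suc n))) = d (f n)"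
      unfolding AE_all_countable using AE1 AE2 by auto
    then have "AE f in lim. \<forall>n. dec f n \<in> set_pmf (P n) \<and> \<phi> n (dec f (Suc n)) = dec f n"
      by (simp add: dec_def)
    then show "AE \<omega> in \<mu>. \<forall>n. \<omega> n \<in> set_pmf (P n) \<and> \<phi> n (\<omega> (Suc n)) = \<omega> n"
    proof -
      let ?R = "\<lambda>\<omega>. \<forall>n. \<omega> n \<in> set_pmf (P n) \<and> \<phi> n (\<omega> (Suc n)) = \<omega> n"
      have "{\<omega>\<in>space (PiM UNIV (\<lambda>_. count_space UNIV)). ?R \<omega>} =
        (\<Inter>n. \<Union>x\<in>set_pmf (P (Suc n)). {\<omega>. \<omega> n \<in> set_pmf (P n)} \<inter> {\<omega>. \<omega> (Suc n) \<in> {x}} \<inter> {\<omega>. \<omega> n \<in> {\<phi> n x}})" (is "_ = ?I")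
      proof (intro equalityI subsetI)
        fix \<omega> assume "\<omega> \<in> {\<omega>\<in>space (PiM UNIV (\<lambda>_. count_space UNIV)). ?R \<omega>}"
        then have R: "?R \<omega>" unfolding mem_Collect_eq by (rule conjunct2)
        show "\<omega> \<in> ?I"
        proof (rule INT_I)
          fix n
          have "\<omega> (Suc n) \<in> set_pmf (P (Suc n))" using R by blast
          moreover have "\<omega> n \<in> set_pmf (P n)" "\<phi> n (\<omega> (Suc n)) = \<omega> n" using R by blast+
          ultimately show "\<omega> \<in> (\<Union>x\<in>set_pmf (P (Suc n)). {\<omega>. \<omega> n \<in> set_pmf (P n)} \<inter> {\<omega>. \<omega> (Suc n) \<in> {x}} \<inter> {\<omega>. \<omega> n \<in> {\<phi> n x}})"
            by (intro UN_I[of "\<omega> (Suc n)"]) simp_all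
        qed
      next
        fix \<omega> assume I: "\<omega> \<in> ?I"
        have "\<omega> n \<in> set_pmf (P n) \<and> \<phi> n (\<omega> (Suc n)) = \<omega> n" for n
        proof -
          obtain x where "\<omega> n \<in> set_pmf (P n)" "\<omega> (Suc n) = x" "\<omega> n = \<phi> n x"
            using INT_D[OF I UNIV_I, of n] by blast
          then show ?thesis by simp
        qed
        then show "\<omega> \<in> {\<omega>\<in>space (PiM UNIV (\<lambda>_. count_space UNIV)). ?R \<omega>}"
          by (simp add: space_PiM)
      qed
      also have "\<dots> \<in> sets (PiM UNIV (\<lambda>_. count_space UNIV))"
        by (intro sets.countable_INT'' sets.countable_UN'' sets.Int sets countable_set_pmf)
          (use sets[of undefined UNIV] in auto)
      finally have "{\<omega>\<in>space (PiM UNIV (\<lambda>_. count_space UNIV)). ?R \<omega>} \<in> sets (PiM UNIV (\<lambda>_. count_space UNIV))" .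
      from AE_distr_iff[OF dec_meas this] show ?thesis
        unfolding \<mu>_def using \<open>AE f in lim. ?R (dec f)\<close> by blast
    qed
    fix n :: nat and A :: "'a set"
    have "measure \<mu> {\<omega>. \<omega> n \<in> A} = measure lim {f. d (f n) \<in> A}"
      unfolding \<mu>_def using sets by (subst measure_distr) (auto simp: dec_def space_PiM vimage_def)
    also have "{f. d (f n) \<in> A} = prod_emb UNIV (\<lambda>_. borel) {n} {f\<in>space (PiM {n} (\<lambda>_. borel)). d (f n) \<in> A}"
      by (auto simp: prod_emb_def space_PiM)
    also have "measure lim \<dots> = measure (Q {n}) {f\<in>space (PiM {n} (\<lambda>_. borel)). d (f n) \<in> A}"
      by (intro measure_lim_emb coord) auto
    also have "\<dots> = measure (P n) {u. d (cod {n} u n) \<in> A}"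
      unfolding Q_def measure_distr[OF cod_meas coord[OF singletonI]]
      by (auto simp: vimage_def top_def cod_def space_PiM intro!: arg_cong[of _ _ "measure (P n)"])
    also have "\<dots> = measure (P n) A"
      by (intro measure_pmf.finite_measure_eq_AE) (auto simp: AE_measure_pmf_iff cod_def top_def de[OF inS])
    finally show "measure \<mu> {\<omega>. \<omega> n \<in> A} = measure (P n) A" .
  qed
qed

lemma sum_half_powers_le: "(\<Sum>j\<in>{n..<M}. (1 / 2 :: real) ^ j) \<le> 2 * (1 / 2) ^ n"
proof -
  have "(\<Sum>j\<in>{n..<M}. (1 / 2 :: real) ^ j) \<le> 2 * (1 / 2) ^ n - 2 * (1 / 2) ^ M" if "n \<le> M"
    using that by (induction M rule: dec_induct) auto
  then have *: "(\<Sum>j\<in>{n..<M}. (1 / 2 :: real) ^ j) \<le> 2 * (1 / 2) ^ n - 2 * (1 / 2) ^ M \<or> M < n" by force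
  show ?thesis
  proof (cases "n \<le> M")
    case True
    moreover have "(0::real) \<le> 2 * (1 / 2) ^ M" by simp
    ultimately show ?thesis using * by linarith
  qed simp
qed

context tiling_sequence
begin

lemma down_in_F: "n \<le> M \<Longrightarrow> u \<in> F M \<Longrightarrow> down \<phi> n M u \<in> F n"
proof (induction M arbitrary: u)
  case (Suc M)
  then show ?case
  proof (cases "n = Suc M")
    case False
    then show ?thesis using Suc \<phi>[of u M] by simp
  qed simp
qed simp

lemma K_mono: "n \<le> m \<Longrightarrow> K n \<subseteq> K m"
  by (rule lift_Suc_mono_le[of K, OF K_Suc])

text \<open>Descend one level at a time: outside \<open>Bad j\<close> the step commutes with every
  element of \<open>K j\<close>, and \<open>K n\<close> is contained in each of these sets.\<close>

lemma down_mult: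
  assumes "n \<le> M" "u \<in> F M" "g \<in> K n"
    and "\<And>j. n \<le> j \<Longrightarrow> j < M \<Longrightarrow> down \<phi> (Suc j) M u \<notin> Bad j"
  shows "down \<phi> n M (g \<otimes> u) = g \<otimes> down \<phi> n M u \<and> (n < M \<longrightarrow> g \<otimes> u \<in> F M)"
  using assms
proof (induction M arbitrary: u)
  case (Suc M)
  show ?case
  proof (cases "n = Suc M")
    case False
    then have nM: "n \<le> M" using Suc by simp
    have "u \<notin> Bad M" using Suc.prems(4)[of M] nM by simp
    then have u: "g \<otimes> u \<in> F (Suc M)" "\<phi> M (g \<otimes> u) = g \<otimes> \<phi> M u"
      using good[of u M g] Suc.prems K_mono[OF nM] by auto
    have "down \<phi> (Suc j) M (\<phi> M u) \<notin> Bad j" if "n \<le> j" "j < M" for j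
      using Suc.prems(4)[of j] that by simp
    then have "down \<phi> n M (g \<otimes> \<phi> M u) = g \<otimes> down \<phi> n M (\<phi> M u)"
      using Suc.IH[of "\<phi> M u"] nM Suc.prems \<phi>[of u M] by blast
    then show ?thesis using u nM by simp
  qed simp
qed simp

section \<open>Frequencies of positions and their limits\<close>

definition freq :: "nat \<Rightarrow> nat \<Rightarrow> 'a set \<Rightarrow> real" where
  "freq n M A = card {u\<in>F M. down \<phi> n M u \<in> A} / card (F M)"

lemma card_F_pos: "0 < real (card (F M))"
  using F[of M] by (simp add: card_gt_0_iff)

lemma freq_bounds: "0 \<le> freq n M A" "freq n M A \<le> 1"
proof -
  have "card {u\<in>F M. down \<phi> n M u \<in> A} \<le> card (F M)" using F(1)[of M] by (intro card_mono) auto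
  then show "0 \<le> freq n M A" "freq n M A \<le> 1" using card_F_pos[of M] by (auto simp: freq_def)
qed

lemma freq_eq_sum:
  assumes "n \<le> M"
  shows "freq n M A = (\<Sum>v\<in>F n \<inter> A. freq n M {v})"
proof -
  have "{u\<in>F M. down \<phi> n M u \<in> A} = (\<Union>v\<in>F n \<inter> A. {u\<in>F M. down \<phi> n M u \<in> {v}})"
    using down_in_F[OF assms] by auto
  also have "card \<dots> = (\<Sum>v\<in>F n \<inter> A. card {u\<in>F M. down \<phi> n M u \<in> {v}})"
    using F by (intro card_UN_disjoint) auto
  finally show ?thesis by (simp add: freq_def sum_divide_distrib)
qed

lemma freq_bad_le: "n < M \<Longrightarrow> freq (Suc n) M (Bad n) \<le> 3 * (1 / 2) ^ n"
  using bad_freq[of n M] card_F_pos[of M] by (simp add: freq_def divide_le_eq)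

text \<open>Leave out the points that are bad at some level from \<open>n\<close> to
  \<open>M - 1\<close>; their proportion is at most the geometric sum
  \<open>6 * (1 / 2) ^ n\<close>. On the rest, the injection that sends \<open>u\<close> to
  \<open>g \<otimes> u\<close> carries the first event into the second.\<close>

lemma freq_shift_le:
  assumes "n < M" "g \<in> K n"
  shows "freq n M {x. g \<otimes> x \<in> A} \<le> freq n M A + 6 * (1 / 2) ^ n"
proof -
  have gG: "g \<in> carrier G" using assms K_sub by auto
  let ?bad = "\<lambda>j. {u\<in>F M. down \<phi> (Suc j) M u \<in> Bad j}"
  let ?X = "{u\<in>F M. g \<otimes> u \<in> F M \<and> down \<phi> n M (g \<otimes> u) \<in> A}"
  let ?Y = "{u\<in>F M. down \<phi> n M u \<in> A}"
  have "{u\<in>F M. down \<phi> n M u \<in> {x. g \<otimes> x \<in> A}} \<subseteq> (\<Union>j\<in>{n..<M}. ?bad j) \<union> ?X"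
  proof
    fix u assume u: "u \<in> {u\<in>F M. down \<phi> n M u \<in> {x. g \<otimes> x \<in> A}}"
    show "u \<in> (\<Union>j\<in>{n..<M}. ?bad j) \<union> ?X"
    proof (cases "\<exists>j. n \<le> j \<and> j < M \<and> down \<phi> (Suc j) M u \<in> Bad j")
      case True
      then show ?thesis using u by auto
    next
      case False
      then show ?thesis using u down_mult[of n M u g] assms by auto
    qed
  qed
  then have "card {u\<in>F M. down \<phi> n M u \<in> {x. g \<otimes> x \<in> A}} \<le> card ((\<Union>j\<in>{n..<M}. ?bad j) \<union> ?X)"
    using F by (intro card_mono) auto
  also have "\<dots> \<le> card (\<Union>j\<in>{n..<M}. ?bad j) + card ?X" by (rule card_Un_le)
  also have "\<dots> \<le> (\<Sum>j\<in>{n..<M}. card (?bad j)) + card ?Y"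
  proof (rule add_mono)
    show "card (\<Union>j\<in>{n..<M}. ?bad j) \<le> (\<Sum>j\<in>{n..<M}. card (?bad j))" by (rule card_UN_le) simp
    have "inj_on (\<lambda>u. g \<otimes> u) ?X" using gG F(3)[of M] by (auto simp: inj_on_def subset_eq)
    then show "card ?X \<le> card ?Y"
      using F(1)[of M] by (intro card_inj_on_le[of "\<lambda>u. g \<otimes> u"]) auto
  qed
  finally have le: "real (card {u\<in>F M. down \<phi> n M u \<in> {x. g \<otimes> x \<in> A}})
     \<le> (\<Sum>j\<in>{n..<M}. real (card (?bad j))) + card ?Y"
    by (simp flip: of_nat_sum of_nat_add)
  have "(\<Sum>j\<in>{n..<M}. real (card (?bad j))) \<le> (\<Sum>j\<in>{n..<M}. 3 * card (F M) * (1 / 2) ^ j)"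
  proof (rule sum_mono)
    fix j assume "j \<in> {n..<M}"
    then show "real (card (?bad j)) \<le> 3 * card (F M) * (1 / 2) ^ j"
      using bad_freq[of j M] by (simp add: mult_ac)
  qed
  also have "\<dots> \<le> 3 * card (F M) * (2 * (1 / 2) ^ n)"
    unfolding sum_distrib_left[symmetric] by (intro mult_left_mono sum_half_powers_le) simp
  also have "\<dots> = (6 * (1 / 2) ^ n) * card (F M)" by simp
  finally have "real (card {u\<in>F M. down \<phi> n M u \<in> {x. g \<otimes> x \<in> A}})
     \<le> (6 * (1 / 2) ^ n) * card (F M) + card ?Y" using le by linarith
  then have "card {u\<in>F M. down \<phi> n M u \<in> {x. g \<otimes> x \<in> A}} / card (F M)
     \<le> ((6 * (1 / 2) ^ n) * card (F M) + card ?Y) / card (F M)"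
    by (intro divide_right_mono) auto
  then show ?thesis using card_F_pos[of M] by (simp add: freq_def add_divide_distrib)
qed

text \<open>A diagonal subsequence makes the frequency of every single position converge, since
  there are only countably many. No mass escapes because each \<open>F n\<close> is finite.\<close>

lemma ex_limit_pmfs:
  obtains r P where "strict_mono (r :: nat \<Rightarrow> nat)" "\<And>n. set_pmf (P n) \<subseteq> F n"
    "\<And>n A. (\<lambda>k. freq n (r k) A) \<longlonglongrightarrow> measure (P n) A"
proof -
  have cnt: "countable (SIGMA n:(UNIV::nat set). F n)"
    using F(1) by (intro countable_SIGMA) (auto intro: countable_finite)
  have "norm (freq (fst p) M {snd p}) \<le> 1" for M and p :: "nat \<times> 'a"
    using freq_bounds[of "fst p" M "{snd p}"] by simp
  then obtain r :: "nat \<Rightarrow> nat" where r: "strict_mono r"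
    and conv: "\<And>p. p \<in> (SIGMA n:UNIV. F n) \<Longrightarrow> \<exists>l. (\<lambda>k. freq (fst p) (r k) {snd p}) \<longlonglongrightarrow> l"
    using function_convergent_subsequence[OF cnt, of "\<lambda>M p. freq (fst p) M {snd p}" 1] by blast
  define w where "w n v = lim (\<lambda>k. freq n (r k) {v})" for n v
  have w: "(\<lambda>k. freq n (r k) {v}) \<longlonglongrightarrow> w n v" if "v \<in> F n" for n v
    using conv[of "(n, v)"] that unfolding w_def by (auto simp: convergent_def convergent_LIMSEQ_iff[symmetric])
  have lim: "(\<lambda>k. freq n (r k) A) \<longlonglongrightarrow> (\<Sum>v\<in>F n \<inter> A. w n v)" for n A
  proof (rule Lim_transform_eventually)
    show "(\<lambda>k. \<Sum>v\<in>F n \<inter> A. freq n (r k) {v}) \<longlonglongrightarrow> (\<Sum>v\<in>F n \<inter> A. w n v)"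
      using w by (intro tendsto_sum) auto
    have "n \<le> r k" if "n \<le> k" for k using seq_suble[OF r, of k] that by linarith
    then show "\<forall>\<^sub>F k in sequentially. (\<Sum>v\<in>F n \<inter> A. freq n (r k) {v}) = freq n (r k) A"
      using freq_eq_sum[symmetric] by (intro eventually_sequentiallyI[of n]) blast
  qed
  have nonneg: "0 \<le> w n v" if "v \<in> F n" for n v
    using w[OF that] freq_bounds by (intro LIMSEQ_le_const) auto
  have total: "(\<Sum>v\<in>F n. w n v) = 1" for n
  proof -
    have "freq n M UNIV = 1" for M using card_F_pos[of M] by (simp add: freq_def)
    then show ?thesis using lim[of n UNIV] by (simp add: LIMSEQ_const_iff)
  qed
  define f where "f n v = (if v \<in> F n then w n v else 0)" for n v
  define P where "P n = embed_pmf (f n)" for n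
  have pmf_P: "pmf (P n) v = f n v" for n v
    unfolding P_def
  proof (rule pmf_embed_pmf)
    show "0 \<le> f n v" for v using nonneg by (simp add: f_def)
    have "(\<integral>\<^sup>+ v. ennreal (f n v) \<partial>count_space UNIV) = (\<Sum>v\<in>F n. ennreal (f n v))"
      using F(1) by (intro nn_integral_count_space') (auto simp: f_def)
    also have "\<dots> = ennreal (\<Sum>v\<in>F n. f n v)"
      using nonneg by (intro sum_ennreal) (auto simp: f_def)
    also have "(\<Sum>v\<in>F n. f n v) = 1" using total by (simp add: f_def)
    finally show "(\<integral>\<^sup>+ v. ennreal (f n v) \<partial>count_space UNIV) = 1" by simp
  qed
  have set_P: "set_pmf (P n) \<subseteq> F n" for n
    by (auto simp: set_pmf_iff pmf_P f_def split: if_splits)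
  have meas: "measure (P n) A = (\<Sum>v\<in>F n \<inter> A. w n v)" for n A
  proof -
    have "measure (P n) A = measure (P n) (F n \<inter> A)"
      using set_P[of n] by (intro measure_pmf.finite_measure_eq_AE) (auto simp: AE_measure_pmf_iff)
    also have "\<dots> = (\<Sum>v\<in>F n \<inter> A. pmf (P n) v)" using F(1) by (intro measure_measure_pmf_finite) auto
    finally show ?thesis by (simp add: pmf_P f_def)
  qed
  show thesis using that[of r P] r set_P lim meas by simp
qed

end

text \<open>The frequencies at finite levels survive only as these properties of \<mu>.
  \<open>prob_shift\<close> is one-sided and approximate; invariance becomes exact as the level
  tends to infinity.\<close>

locale tiling_system = tiling_sequence G F K B Bad \<phi> + prob_space \<mu>
  for G :: "('a, 'b) monoid_scheme" (structure) and F K B Bad \<phi> and \<mu> :: "(nat \<Rightarrow> 'a) measure" +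
  assumes sets_\<mu>: "sets \<mu> = sets (PiM UNIV (\<lambda>_. count_space UNIV))"
    and AE_coherent: "AE \<omega> in \<mu>. \<forall>n. \<omega> n \<in> F n \<and> \<phi> n (\<omega> (Suc n)) = \<omega> n"
    and prob_bad: "prob {\<omega>. \<omega> (Suc n) \<in> Bad n} \<le> 3 * (1 / 2) ^ n"
    and prob_shift: "g \<in> K n \<Longrightarrow> prob {\<omega>. g \<otimes> \<omega> n \<in> A} \<le> prob {\<omega>. \<omega> n \<in> A} + 6 * (1 / 2) ^ n"

text \<open>The uniform distributions on \<open>F M\<close>, pushed down to the levels below
  \<open>M\<close>, are consistent, hence so are their limits. The two inequalities are closed
  conditions and pass to the limit.\<close>

theorem (in tiling_sequence) ex_tiling_system: "\<exists>\<mu>. tiling_system G F K B Bad \<phi> \<mu>"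
proof -
  obtain r P where r: "strict_mono (r :: nat \<Rightarrow> nat)" and supp: "\<And>n. set_pmf (P n) \<subseteq> F n"
    and lim: "\<And>n A. (\<lambda>k. freq n (r k) A) \<longlonglongrightarrow> measure (P n) A"
    using ex_limit_pmfs by blast
  have large: "n < r k" if "n < k" for n k using seq_suble[OF r, of k] that by linarith
  have cons: "map_pmf (\<phi> n) (P (Suc n)) = P n" for n
  proof (rule pmf_eqI)
    fix v
    have "pmf (map_pmf (\<phi> n) (P (Suc n))) v = measure (P (Suc n)) (\<phi> n -` {v})" by (simp add: pmf_map)
    moreover have "(\<lambda>k. freq (Suc n) (r k) (\<phi> n -` {v})) \<longlonglongrightarrow> measure (P n) {v}"
    proof (rule Lim_transform_eventually[OF lim])
      have "freq n (r k) {v} = freq (Suc n) (r k) (\<phi> n -` {v})" if "n < k" for k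
      proof -
        have "\<phi> n (down \<phi> (Suc n) (r k) u) = down \<phi> n (r k) u" for u
          using down_down[of n "Suc n" "r k" \<phi> u] large[OF that] by simp
        then show ?thesis by (simp add: freq_def)
      qed
      then show "\<forall>\<^sub>F k in sequentially. freq n (r k) {v} = freq (Suc n) (r k) (\<phi> n -` {v})"
        by (intro eventually_sequentiallyI[of "Suc n"]) simp
    qed
    ultimately have "pmf (map_pmf (\<phi> n) (P (Suc n))) v = measure (P n) {v}"
      using LIMSEQ_unique[OF lim] by simp
    then show "pmf (map_pmf (\<phi> n) (P (Suc n))) v = pmf (P n) v" by (simp add: measure_pmf_single)
  qed
  obtain \<mu> where \<mu>: "prob_space \<mu>" "sets \<mu> = sets (PiM UNIV (\<lambda>_. count_space UNIV))"
    "AE \<omega> in \<mu>. \<forall>n. \<omega> n \<in> set_pmf (P n) \<and> \<phi> n (\<omega> (Suc n)) = \<omega> n"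
    "\<And>n A. measure \<mu> {\<omega>. \<omega> n \<in> A} = measure (P n) A"
    using pmf_inverse_limit[of \<phi> P, OF cons] by blast
  interpret prob_space \<mu> by fact
  have "tiling_system G F K B Bad \<phi> \<mu>"
  proof
    show "sets \<mu> = sets (PiM UNIV (\<lambda>_. count_space UNIV))" by fact
    show "AE \<omega> in \<mu>. \<forall>n. \<omega> n \<in> F n \<and> \<phi> n (\<omega> (Suc n)) = \<omega> n"
      using \<mu>(3) by eventually_elim (use supp in blast)
    fix n
    have "\<forall>\<^sub>F k in sequentially. freq (Suc n) (r k) (Bad n) \<le> 3 * (1 / 2) ^ n"
      using freq_bad_le large by (intro eventually_sequentiallyI[of "Suc n"]) simp
    then have "measure (P (Suc n)) (Bad n) \<le> 3 * (1 / 2) ^ n"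
      by (intro tendsto_upperbound[OF lim]) auto
    then show "prob {\<omega>. \<omega> (Suc n) \<in> Bad n} \<le> 3 * (1 / 2) ^ n" by (simp add: \<mu>(4))
    fix g A assume g: "g \<in> K n"
    have "\<forall>\<^sub>F k in sequentially. freq n (r k) {x. g \<otimes> x \<in> A} \<le> freq n (r k) A + 6 * (1 / 2) ^ n"
      using freq_shift_le[OF _ g] large by (intro eventually_sequentiallyI[of "Suc n"]) simp
    then have "measure (P n) {x. g \<otimes> x \<in> A} \<le> measure (P n) A + 6 * (1 / 2) ^ n"
      by (intro tendsto_le[OF sequentially_bot tendsto_add[OF lim tendsto_const] lim])
    then show "prob {\<omega>. g \<otimes> \<omega> n \<in> A} \<le> prob {\<omega>. \<omega> n \<in> A} + 6 * (1 / 2) ^ n"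
      using \<mu>(4)[of n "{x. g \<otimes> x \<in> A}"] by (simp add: \<mu>(4))
  qed
  then show ?thesis by blast
qed

section \<open>The action on coherent sequences of positions\<close>

context tiling_system
begin

text \<open>\<open>\<omega> n\<close> is the position of the unit element in its tile of level \<open>n\<close>; \<open>stable M g \<omega>\<close> says that
  \<open>g\<close> lies in the same tile from level \<open>M\<close> on.\<close>

definition commuting :: "nat \<Rightarrow> 'a \<Rightarrow> 'a set" where
  "commuting m g = {x\<in>F (Suc m). g \<otimes> \<phi> m x \<in> F m \<and> \<phi> m (g \<otimes> x) = g \<otimes> \<phi> m x}"

definition stable :: "nat \<Rightarrow> 'a \<Rightarrow> (nat \<Rightarrow> 'a) \<Rightarrow> bool" where
  "stable M g \<omega> \<longleftrightarrow> (\<forall>m\<ge>M. \<omega> (Suc m) \<in> commuting m g)"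

text \<open>Stability of every group element means that each element eventually shares the tile of
  the unit. On this set the action is defined everywhere, so no null sets depending on
  \<open>g\<close> have to be removed later.\<close>

definition points :: "(nat \<Rightarrow> 'a) set" where
  "points = {\<omega>. (\<forall>n. \<omega> n \<in> F n) \<and> (\<forall>n. \<phi> n (\<omega> (Suc n)) = \<omega> n) \<and> (\<forall>g\<in>carrier G. \<exists>M. stable M g \<omega>)}"

definition bad_from :: "nat \<Rightarrow> (nat \<Rightarrow> 'a) set" where
  "bad_from n = {\<omega>. \<exists>m\<ge>n. \<omega> (Suc m) \<in> Bad m}"

lemma space_\<mu> [simp]: "space \<mu> = UNIV"
  using sets_eq_imp_space_eq[OF sets_\<mu>] by (simp add: space_PiM)

lemma coord_sets [measurable]: "{\<omega>. \<omega> n \<in> A} \<in> sets \<mu>"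
proof -
  have "(\<lambda>\<omega>. \<omega> n) -` A \<inter> space (PiM UNIV (\<lambda>_. count_space UNIV)) \<in> sets (PiM UNIV (\<lambda>_. count_space UNIV))"
    by (rule measurable_sets[of _ _ "count_space UNIV"]) auto
  then show ?thesis unfolding sets_\<mu> by (simp add: vimage_def space_PiM)
qed

lemma UNIV_sets [simp]: "UNIV \<in> sets \<mu>"
  using sets.top[of \<mu>] by simp

lemma bad_from_eq: "bad_from n = (\<Union>i. {\<omega>. \<omega> (Suc (n + i)) \<in> Bad (n + i)})"
proof (intro equalityI subsetI)
  fix \<omega> assume "\<omega> \<in> bad_from n"
  then obtain m where "n \<le> m" "\<omega> (Suc m) \<in> Bad m" by (auto simp: bad_from_def)
  then show "\<omega> \<in> (\<Union>i. {\<omega>. \<omega> (Suc (n + i)) \<in> Bad (n + i)})"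
    by (intro UN_I[of "m - n"]) simp_all
next
  fix \<omega> assume "\<omega> \<in> (\<Union>i. {\<omega>. \<omega> (Suc (n + i)) \<in> Bad (n + i)})"
  then obtain i where "\<omega> (Suc (n + i)) \<in> Bad (n + i)" by auto
  then show "\<omega> \<in> bad_from n" by (auto simp: bad_from_def intro!: exI[of _ "n + i"])
qed

lemma bad_from_sets [measurable]: "bad_from n \<in> sets \<mu>"
  unfolding bad_from_eq by (intro sets.countable_UN') auto

lemma half_sums: "(\<lambda>i. 3 * (1 / 2 :: real) ^ (n + i)) sums (6 * (1 / 2) ^ n)"
  using sums_mult[OF geometric_sums[of "1 / 2 :: real"], of "3 * (1 / 2) ^ n"]
  by (simp add: power_add mult.assoc)

lemma prob_bad_from: "prob (bad_from n) \<le> 6 * (1 / 2) ^ n"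
proof -
  have le: "prob {\<omega>. \<omega> (Suc (n + i)) \<in> Bad (n + i)} \<le> 3 * (1 / 2) ^ (n + i)" for i
    by (rule prob_bad)
  have summ: "summable (\<lambda>i. prob {\<omega>. \<omega> (Suc (n + i)) \<in> Bad (n + i)})"
    using le by (intro summable_comparison_test'[OF sums_summable[OF half_sums[of n]]]) auto
  have "prob (bad_from n) \<le> (\<Sum>i. prob {\<omega>. \<omega> (Suc (n + i)) \<in> Bad (n + i)})"
    unfolding bad_from_eq by (intro finite_measure_subadditive_countably summ) auto
  also have "\<dots> \<le> (\<Sum>i. 3 * (1 / 2) ^ (n + i))"
    by (intro suminf_le le summ sums_summable[OF half_sums])
  also have "\<dots> = 6 * (1 / 2) ^ n" by (rule sums_unique[OF half_sums, symmetric])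
  finally show ?thesis .
qed

lemma stable_of_good:
  assumes "\<And>n. \<omega> n \<in> F n" "\<And>n. \<phi> n (\<omega> (Suc n)) = \<omega> n" "g \<in> K n" "\<omega> \<notin> bad_from n"
  shows "stable n g \<omega>"
  unfolding stable_def
proof (intro allI impI)
  fix m assume m: "n \<le> m"
  have "g \<otimes> \<omega> (Suc m) \<in> F (Suc m) \<and> \<phi> m (g \<otimes> \<omega> (Suc m)) = g \<otimes> \<phi> m (\<omega> (Suc m))"
    using assms m K_mono[OF m] by (intro good) (auto simp: bad_from_def)
  then show "\<omega> (Suc m) \<in> commuting m g"
    using assms \<phi>[of "g \<otimes> \<omega> (Suc m)" m] by (auto simp: commuting_def)
qed

lemma points_sets [measurable]: "points \<in> sets \<mu>"
proof -
  \<comment> \<open>Coherence is written as a union over the finitely many values of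
    \<open>\<omega> (Suc n)\<close>, so that only events of single coordinates occur.\<close>
  have eq: "points = (\<Inter>n. \<Union>x\<in>F (Suc n). {\<omega>. \<omega> (Suc n) \<in> {x}} \<inter> {\<omega>. \<omega> n \<in> {\<phi> n x} \<inter> F n})
     \<inter> (\<Inter>g\<in>carrier G. \<Union>M. \<Inter>m\<in>{M..}. {\<omega>. \<omega> (Suc m) \<in> commuting m g})" (is "_ = ?A \<inter> ?B")
  proof -
    have "{\<omega>. (\<forall>n. \<omega> n \<in> F n) \<and> (\<forall>n. \<phi> n (\<omega> (Suc n)) = \<omega> n)} = ?A"
    proof (intro equalityI subsetI)
      fix \<omega> assume "\<omega> \<in> {\<omega>. (\<forall>n. \<omega> n \<in> F n) \<and> (\<forall>n. \<phi> n (\<omega> (Suc n)) = \<omega> n)}"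
      then have \<omega>: "\<omega> n \<in> F n" "\<phi> n (\<omega> (Suc n)) = \<omega> n" for n by blast+
      show "\<omega> \<in> ?A"
      proof (rule INT_I)
        fix n show "\<omega> \<in> (\<Union>x\<in>F (Suc n). {\<omega>. \<omega> (Suc n) \<in> {x}} \<inter> {\<omega>. \<omega> n \<in> {\<phi> n x} \<inter> F n})"
          using \<omega> by (intro UN_I[of "\<omega> (Suc n)"]) simp_all
      qed
    next
      fix \<omega> assume \<omega>: "\<omega> \<in> ?A"
      have "\<omega> n \<in> F n \<and> \<phi> n (\<omega> (Suc n)) = \<omega> n" for n
      proof -
        obtain x where "\<omega> (Suc n) = x" "\<omega> n = \<phi> n x" "\<omega> n \<in> F n"
          using INT_D[OF \<omega> UNIV_I, of n] by blast
        then show ?thesis by simp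
      qed
      then show "\<omega> \<in> {\<omega>. (\<forall>n. \<omega> n \<in> F n) \<and> (\<forall>n. \<phi> n (\<omega> (Suc n)) = \<omega> n)}" by simp
    qed
    moreover have "{\<omega>. \<forall>g\<in>carrier G. \<exists>M. stable M g \<omega>} = ?B"
      by (rule Set.set_eqI) (simp only: stable_def UN_iff INT_iff mem_Collect_eq atLeast_iff UNIV_I Ball_def Bex_def simp_thms)
    moreover have "points = {\<omega>. (\<forall>n. \<omega> n \<in> F n) \<and> (\<forall>n. \<phi> n (\<omega> (Suc n)) = \<omega> n)}
        \<inter> {\<omega>. \<forall>g\<in>carrier G. \<exists>M. stable M g \<omega>}"
      by (simp only: points_def Collect_conj_eq[symmetric] conj_assoc)
    ultimately show ?thesis by (simp only:)
  qed
  have A: "?A \<in> sets \<mu>"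
    using F(1) by (intro sets.countable_INT'' sets.finite_UN sets.Int coord_sets) auto
  have "(\<Inter>m\<in>{M..}. {\<omega>. \<omega> (Suc m) \<in> commuting m g}) \<in> sets \<mu>" for M g
    by (intro sets.countable_INT'' coord_sets) auto
  then have "(\<Union>M. \<Inter>m\<in>{M..}. {\<omega>. \<omega> (Suc m) \<in> commuting m g}) \<in> sets \<mu>" for g
    by (intro sets.countable_UN') auto
  then have "?B \<in> sets \<mu>" using countable_carrier coord_sets[of undefined UNIV]
    by (intro sets.countable_INT'') auto
  then show ?thesis unfolding eq using A by (rule sets.Int[rotated])
qed

text \<open>Borel-Cantelli: almost surely only finitely many levels are bad, and each
  \<open>g\<close> belongs to \<open>K n\<close> for all large \<open>n\<close>.\<close>

lemma AE_points: "AE \<omega> in \<mu>. \<omega> \<in> points"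
proof -
  have "summable (\<lambda>m. prob {\<omega>. \<omega> (Suc m) \<in> Bad m})"
    using prob_bad by (intro summable_comparison_test'[OF sums_summable[OF half_sums[of 0]]]) auto
  then have "AE \<omega> in \<mu>. eventually (\<lambda>m. \<omega> \<in> space \<mu> - {\<omega>. \<omega> (Suc m) \<in> Bad m}) sequentially"
    by (intro borel_cantelli_AE1) (auto simp: emeasure_eq_measure)
  with AE_coherent show ?thesis
  proof eventually_elim
    case (elim \<omega>)
    from elim(2) obtain M where "\<forall>m\<ge>M. \<omega> (Suc m) \<notin> Bad m" by (auto simp: eventually_sequentially)
    then have good: "\<omega> \<notin> bad_from n" if "M \<le> n" for n using that by (auto simp: bad_from_def)
    have "\<exists>M. stable M g \<omega>" if "g \<in> carrier G" for g
    proof -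
      obtain n where "g \<in> K n" using K_all \<open>g \<in> carrier G\<close> by auto
      then have "g \<in> K (max n M)" using K_mono[of n "max n M"] by auto
      then show ?thesis using stable_of_good[of \<omega> g "max n M"] elim(1) good by auto
    qed
    then show ?case using elim(1) by (simp add: points_def)
  qed
qed

definition N :: "(nat \<Rightarrow> 'a) measure" where "N = restrict_space \<mu> points"

lemma space_N [simp]: "space N = points"
  by (simp add: N_def space_restrict_space)

lemma sets_N_iff: "A \<in> sets N \<longleftrightarrow> A \<subseteq> points \<and> A \<in> sets \<mu>"
  unfolding N_def by (rule sets_restrict_space_iff) simp

lemma measure_N: "A \<subseteq> points \<Longrightarrow> measure N A = prob A"
  unfolding N_def by (rule measure_restrict_space) auto

lemma prob_space_N: "prob_space N"
  unfolding N_def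
proof (rule prob_space_restrict_space)
  show "points \<in> events" by (rule points_sets)
  show "emeasure \<mu> points = 1"
    using AE_points prob_space points_sets by (simp add: emeasure_eq_1_AE)
qed

sublocale N: prob_space N
  by (rule prob_space_N)

text \<open>Conditions on a single coordinate suffice: by coherence a coordinate determines all
  lower ones, so these events are already closed under intersection.\<close>

definition cylinders :: "(nat \<Rightarrow> 'a) set set" where
  "cylinders = {{\<omega>\<in>points. \<omega> n \<in> A} | n A. True}"

lemma cylinderI: "{\<omega>\<in>points. \<omega> n \<in> A} \<in> cylinders"
  by (auto simp: cylinders_def)

lemma cylinder_sets [measurable]: "{\<omega>\<in>points. \<omega> n \<in> A} \<in> sets N"
proof -
  have "{\<omega>\<in>points. \<omega> n \<in> A} = points \<inter> {\<omega>. \<omega> n \<in> A}" by auto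
  then show ?thesis by (auto simp: sets_N_iff intro!: sets.Int)
qed

lemma sets_N: "sets N = sigma_sets points cylinders"
proof -
  have "sets \<mu> = sigma_sets UNIV {{f. f i \<in> A} | i A. True}"
    unfolding sets_\<mu> sets_PiM_single by (simp add: PiE_def)
  then have "sets N = (\<inter>) points ` sigma_sets UNIV {{f. f i \<in> A} | i A. True}"
    by (simp add: N_def sets_restrict_space)
  also have "\<dots> = sigma_sets points ((\<inter>) points ` {{f. f i \<in> A} | i A. True})"
  proof (rule sigma_sets_Int)
    show "points \<in> sigma_sets UNIV {{f. f i \<in> A} | i A. True}"
      using points_sets unfolding \<open>sets \<mu> = _\<close> .
  qed simp
  also have "(\<inter>) points ` {{f. f i \<in> A} | i A. True} = cylinders"
    unfolding cylinders_def by (auto simp: image_iff Int_def) blast+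
  finally show ?thesis .
qed

lemma down_points:
  assumes "\<omega> \<in> points" "n \<le> M"
  shows "down \<phi> n M (\<omega> M) = \<omega> n"
  using assms(2)
proof (induction M)
  case (Suc M)
  then show ?case using assms(1) by (cases "n = Suc M") (auto simp: points_def)
qed simp

lemma Int_stable_cylinders: "Int_stable cylinders"
proof (rule Int_stableI)
  have *: "{\<omega>\<in>points. \<omega> n \<in> A} \<inter> {\<omega>\<in>points. \<omega> m \<in> B} \<in> cylinders" if "n \<le> m" for n m A B
  proof -
    have "{\<omega>\<in>points. \<omega> n \<in> A} \<inter> {\<omega>\<in>points. \<omega> m \<in> B} = {\<omega>\<in>points. \<omega> m \<in> B \<inter> down \<phi> n m -` A}"
      using down_points[OF _ that] by auto
    then show ?thesis by (simp only: cylinderI)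
  qed
  fix X Y assume "X \<in> cylinders" "Y \<in> cylinders"
  then obtain n A m B where "X = {\<omega>\<in>points. \<omega> n \<in> A}" "Y = {\<omega>\<in>points. \<omega> m \<in> B}"
    by (auto simp: cylinders_def)
  then show "X \<inter> Y \<in> cylinders"
    using *[of n m A B] *[of m n B A] by (cases "n \<le> m") (auto simp: Int_commute)
qed

text \<open>The action moves the unit to \<open>g\<close>: the new entry at level \<open>n\<close>
  is the position of \<open>g\<close> in its own tile of level \<open>n\<close>. This tile may
  differ from that of the unit, so one climbs to a level where both share a tile, multiplies there
  and descends. Every such level gives the same result.\<close>

definition T :: "'a \<Rightarrow> (nat \<Rightarrow> 'a) \<Rightarrow> (nat \<Rightarrow> 'a)" where
  "T g \<omega> n = (let M = (LEAST M. n \<le> M \<and> stable M g \<omega>) in down \<phi> n M (g \<otimes> \<omega> M))"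

lemma stable_mono: "stable M g \<omega> \<Longrightarrow> M \<le> M' \<Longrightarrow> stable M' g \<omega>"
  by (auto simp: stable_def)

lemma stableD:
  assumes "\<omega> \<in> points" "stable M g \<omega>" "M \<le> m"
  shows "g \<otimes> \<omega> m \<in> F m" "\<phi> m (g \<otimes> \<omega> (Suc m)) = g \<otimes> \<omega> m"
  using assms by (auto simp: stable_def commuting_def points_def)

lemma down_stable:
  assumes "\<omega> \<in> points" "stable M g \<omega>" "n \<le> M" "M \<le> M'"
  shows "down \<phi> n M' (g \<otimes> \<omega> M') = down \<phi> n M (g \<otimes> \<omega> M)"
  using assms(4)
proof (induction M' rule: dec_induct)
  case (step M')
  then show ?case using stableD[OF assms(1,2), of M'] assms(3) by simp
qed simp

lemma T_eq:
  assumes "\<omega> \<in> points" "stable M g \<omega>" "n \<le> M"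
  shows "T g \<omega> n = down \<phi> n M (g \<otimes> \<omega> M)"
proof -
  define L where "L = (LEAST M. n \<le> M \<and> stable M g \<omega>)"
  have "n \<le> L \<and> stable L g \<omega>" unfolding L_def by (rule LeastI[of _ M]) (use assms in auto)
  moreover have "L \<le> M" unfolding L_def by (rule Least_le) (use assms in auto)
  ultimately show ?thesis
    using down_stable[OF assms(1), of L g n M] by (simp add: T_def L_def[symmetric])
qed

lemma T_eq_mult: "\<omega> \<in> points \<Longrightarrow> stable n g \<omega> \<Longrightarrow> T g \<omega> n = g \<otimes> \<omega> n"
  using T_eq[of \<omega> n g n] by simp

lemma points_stable: "\<omega> \<in> points \<Longrightarrow> g \<in> carrier G \<Longrightarrow> \<exists>M. stable M g \<omega>"
  by (auto simp: points_def)

lemma points_carrier: "\<omega> \<in> points \<Longrightarrow> \<omega> n \<in> carrier G"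
  using F(3)[of n] by (auto simp: points_def)

text \<open>If \<open>g\<close> and \<open>h \<otimes> g\<close> both share the tile of the unit,
  they share a tile with each other.\<close>

lemma stable_T:
  assumes \<omega>: "\<omega> \<in> points" and g: "g \<in> carrier G" and h: "h \<in> carrier G"
    and M: "stable M g \<omega>" "stable M (h \<otimes> g) \<omega>"
  shows "stable M h (T g \<omega>)"
  unfolding stable_def
proof (intro allI impI)
  fix m assume m: "M \<le> m"
  have T: "T g \<omega> m = g \<otimes> \<omega> m" "T g \<omega> (Suc m) = g \<otimes> \<omega> (Suc m)"
    using T_eq_mult[OF \<omega> stable_mono[OF M(1)]] m by auto
  have assoc: "h \<otimes> (g \<otimes> \<omega> k) = h \<otimes> g \<otimes> \<omega> k" for k
    using g h points_carrier[OF \<omega>] by (simp add: m_assoc)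
  have "T g \<omega> (Suc m) \<in> F (Suc m)" unfolding T using stableD(1)[OF \<omega> M(1), of "Suc m"] m by simp
  then show "T g \<omega> (Suc m) \<in> commuting m h"
    unfolding T commuting_def
    using stableD[OF \<omega> M(1) m] stableD[OF \<omega> M(2) m] by (simp add: assoc)
qed

lemma T_points:
  assumes \<omega>: "\<omega> \<in> points" and g: "g \<in> carrier G"
  shows "T g \<omega> \<in> points"
proof -
  obtain M where M: "stable M g \<omega>" using points_stable[OF \<omega> g] by auto
  have "T g \<omega> n \<in> F n \<and> \<phi> n (T g \<omega> (Suc n)) = T g \<omega> n" for n
  proof -
    define L where "L = max M (Suc n)"
    have L: "stable L g \<omega>" "Suc n \<le> L" "n \<le> L" using stable_mono[OF M] by (auto simp: L_def)
    have "T g \<omega> (Suc n) = down \<phi> (Suc n) L (g \<otimes> \<omega> L)" "T g \<omega> n = down \<phi> n L (g \<otimes> \<omega> L)"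
      using T_eq[OF \<omega> L(1)] L by auto
    then show ?thesis
      using down_down[of n "Suc n" L \<phi>] L stableD(1)[OF \<omega> L(1)] by (simp add: down_in_F)
  qed
  moreover have "\<exists>L. stable L h (T g \<omega>)" if h: "h \<in> carrier G" for h
  proof -
    obtain M' where M': "stable M' (h \<otimes> g) \<omega>" using points_stable[OF \<omega>] g h by auto
    show ?thesis
      using stable_T[OF \<omega> g h stable_mono[OF M, of "max M M'"] stable_mono[OF M', of "max M M'"]] by auto
  qed
  ultimately show ?thesis by (auto simp: points_def)
qed

lemma T_mult:
  assumes \<omega>: "\<omega> \<in> points" and g: "g \<in> carrier G" and h: "h \<in> carrier G"
  shows "T h (T g \<omega>) = T (h \<otimes> g) \<omega>"
proof
  fix n
  obtain M M' where M: "stable M g \<omega>" "stable M' (h \<otimes> g) \<omega>"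
    using points_stable[OF \<omega>] g h m_closed by meson
  define L where "L = max n (max M M')"
  have L: "stable L g \<omega>" "stable L (h \<otimes> g) \<omega>" "n \<le> L"
    using M stable_mono by (auto simp: L_def)
  have "T h (T g \<omega>) n = down \<phi> n L (h \<otimes> T g \<omega> L)"
    by (rule T_eq[OF T_points[OF \<omega> g] stable_T[OF \<omega> g h L(1,2)] L(3)])
  also have "T g \<omega> L = g \<otimes> \<omega> L" by (rule T_eq_mult[OF \<omega> L(1)])
  finally show "T h (T g \<omega>) n = T (h \<otimes> g) \<omega> n"
    using T_eq[OF \<omega> L(2,3)] g h points_carrier[OF \<omega>] by (simp add: m_assoc)
qed

text \<open>The level from which \<open>g\<close> is stable depends on the point but has only
  countably many values, and for each of them the event is a condition on coordinates.\<close>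

lemma T_cylinder_sets:
  assumes g: "g \<in> carrier G"
  shows "{\<omega>\<in>points. T g \<omega> n \<in> A} \<in> sets N"
proof -
  have "{\<omega>\<in>points. T g \<omega> n \<in> A} =
    (\<Union>M\<in>{n..}. (\<Inter>m\<in>{M..}. {\<omega>\<in>points. \<omega> (Suc m) \<in> commuting m g}) \<inter> {\<omega>\<in>points. \<omega> M \<in> {x. down \<phi> n M (g \<otimes> x) \<in> A}})"
    (is "_ = ?R")
  proof (intro equalityI subsetI)
    fix \<omega> assume "\<omega> \<in> {\<omega>\<in>points. T g \<omega> n \<in> A}"
    then have \<omega>: "\<omega> \<in> points" "T g \<omega> n \<in> A" by auto
    obtain M where M: "stable M g \<omega>" using points_stable[OF \<omega>(1) g] by auto
    then have "stable (max M n) g \<omega>" by (rule stable_mono) simp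
    then show "\<omega> \<in> ?R"
      using \<omega> T_eq[OF \<omega>(1), of "max M n" g n] by (intro UN_I[of "max M n"]) (auto simp: stable_def)
  next
    fix \<omega> assume "\<omega> \<in> ?R"
    then obtain M where M: "n \<le> M" "\<omega> \<in> points" "down \<phi> n M (g \<otimes> \<omega> M) \<in> A" "stable M g \<omega>"
      by (auto simp: stable_def)
    then show "\<omega> \<in> {\<omega>\<in>points. T g \<omega> n \<in> A}" using T_eq[OF M(2,4,1)] by simp
  qed
  also have "\<dots> \<in> sets N"
    by (intro sets.countable_UN'' sets.Int sets.countable_INT' cylinder_sets) auto
  finally show ?thesis .
qed

lemma T_measurable [measurable]:
  assumes g: "g \<in> carrier G"
  shows "T g \<in> N \<rightarrow>\<^sub>M N"
proof (rule measurable_sigma_sets[OF sets_N])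
  show "cylinders \<subseteq> Pow points" by (auto simp: cylinders_def)
  show "T g \<in> space N \<rightarrow> points" using T_points g by auto
  fix X assume "X \<in> cylinders"
  then obtain n A where X: "X = {\<omega>\<in>points. \<omega> n \<in> A}" by (auto simp: cylinders_def)
  have "T g -` X \<inter> space N = {\<omega>\<in>points. T g \<omega> n \<in> A}" using T_points g by (auto simp: X)
  then show "T g -` X \<inter> space N \<in> sets N" using T_cylinder_sets[OF g] by simp
qed

text \<open>At a high level \<open>m\<close>, outside an event of probability at most
  \<open>6 * (1 / 2) ^ m\<close>, the action of \<open>g\<close> is multiplication of coordinate
  \<open>m\<close> by \<open>g\<close>, and \<open>prob_shift\<close> controls this up to another
  \<open>6 * (1 / 2) ^ m\<close>. By coherence the event at level \<open>n\<close> can be read at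
  every such \<open>m\<close>, so \<open>m\<close> may tend to infinity.\<close>

lemma prob_T_le:
  assumes g: "g \<in> carrier G"
  shows "N.prob {\<omega>\<in>points. T g \<omega> n \<in> A} \<le> N.prob {\<omega>\<in>points. \<omega> n \<in> A}"
proof -
  obtain k where k: "g \<in> K k" using K_all g by auto
  have le: "N.prob {\<omega>\<in>points. T g \<omega> n \<in> A} \<le> N.prob {\<omega>\<in>points. \<omega> n \<in> A} + 12 * (1 / 2) ^ m" if m: "max n k \<le> m" for m
  proof -
    have gm: "g \<in> K m" and nm: "n \<le> m" using k K_mono[of k m] m by auto
    have "{\<omega>\<in>points. T g \<omega> n \<in> A} \<subseteq> bad_from m \<union> {\<omega>. g \<otimes> \<omega> m \<in> down \<phi> n m -` A}"
    proof
      fix \<omega> assume \<omega>: "\<omega> \<in> {\<omega>\<in>points. T g \<omega> n \<in> A}"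
      show "\<omega> \<in> bad_from m \<union> {\<omega>. g \<otimes> \<omega> m \<in> down \<phi> n m -` A}"
      proof (cases "\<omega> \<in> bad_from m")
        case False
        have "stable m g \<omega>" using \<omega> False by (intro stable_of_good gm) (auto simp: points_def)
        then show ?thesis using \<omega> T_eq[of \<omega> m g n] nm by auto
      qed simp
    qed
    then have "prob {\<omega>\<in>points. T g \<omega> n \<in> A} \<le> prob (bad_from m \<union> {\<omega>. \<omega> m \<in> {x. g \<otimes> x \<in> down \<phi> n m -` A}})"
      by (intro finite_measure_mono sets.Un bad_from_sets coord_sets) auto
    also have "\<dots> \<le> prob (bad_from m) + prob {\<omega>. \<omega> m \<in> {x. g \<otimes> x \<in> down \<phi> n m -` A}}"
      by (intro measure_Un_le bad_from_sets coord_sets)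
    also have "\<dots> \<le> 6 * (1 / 2) ^ m + (prob {\<omega>. \<omega> m \<in> down \<phi> n m -` A} + 6 * (1 / 2) ^ m)"
      using prob_bad_from[of m] prob_shift[OF gm, of "down \<phi> n m -` A"] by (intro add_mono) simp_all
    also have "prob {\<omega>. \<omega> m \<in> down \<phi> n m -` A} = prob {\<omega>\<in>points. \<omega> n \<in> A}"
    proof (rule finite_measure_eq_AE)
      show "AE \<omega> in \<mu>. (\<omega> \<in> {\<omega>. \<omega> m \<in> down \<phi> n m -` A}) = (\<omega> \<in> {\<omega>\<in>points. \<omega> n \<in> A})"
        using AE_points by eventually_elim (use down_points[OF _ nm] in auto)
      show "{\<omega>\<in>points. \<omega> n \<in> A} \<in> events" using cylinder_sets sets_N_iff by auto
    qed (rule coord_sets)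
    finally show ?thesis by (simp add: measure_N)
  qed
  have lim: "(\<lambda>m. N.prob {\<omega>\<in>points. \<omega> n \<in> A} + 12 * (1 / 2 :: real) ^ m) \<longlonglongrightarrow> N.prob {\<omega>\<in>points. \<omega> n \<in> A} + 12 * 0"
    by (intro tendsto_intros LIMSEQ_power_zero) auto
  have "N.prob {\<omega>\<in>points. T g \<omega> n \<in> A} \<le> N.prob {\<omega>\<in>points. \<omega> n \<in> A} + 12 * 0"
    by (rule LIMSEQ_le_const[OF lim]) (intro exI[of _ "max n k"] allI impI le)
  then show ?thesis by simp
qed

text \<open>The inequality for \<open>A\<close> and for its complement gives equality.\<close>

lemma T_preserves:
  assumes g: "g \<in> carrier G"
  shows "distr N N (T g) = N"
proof (rule measure_eqI_generator_eq[OF Int_stable_cylinders])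
  show "cylinders \<subseteq> Pow points" by (auto simp: cylinders_def)
  show "sets (distr N N (T g)) = sigma_sets points cylinders" "sets N = sigma_sets points cylinders"
    by (simp_all add: sets_N)
  show "range (\<lambda>_::nat. points) \<subseteq> cylinders" by (force simp: cylinders_def)
  show "(\<Union>i::nat. points) = points" by simp
  show "emeasure (distr N N (T g)) points \<noteq> \<infinity>"
    using prob_space.emeasure_space_1[OF N.prob_space_distr[OF T_measurable[OF g]]] by simp
  fix X assume "X \<in> cylinders"
  then obtain n A where X: "X = {\<omega>\<in>points. \<omega> n \<in> A}" by (auto simp: cylinders_def)
  have vim: "T g -` {\<omega>\<in>points. \<omega> n \<in> A} \<inter> space N = {\<omega>\<in>points. T g \<omega> n \<in> A}" for A using T_points g by auto
  have "N.prob {\<omega>\<in>points. T g \<omega> n \<in> - A} = 1 - N.prob {\<omega>\<in>points. T g \<omega> n \<in> A}"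
  proof -
    have "{\<omega>\<in>points. T g \<omega> n \<in> - A} = space N - {\<omega>\<in>points. T g \<omega> n \<in> A}" by auto
    then show ?thesis using N.prob_compl[OF T_cylinder_sets[OF g, of n A]] by simp
  qed
  moreover have "N.prob {\<omega>\<in>points. \<omega> n \<in> - A} = 1 - N.prob {\<omega>\<in>points. \<omega> n \<in> A}"
  proof -
    have "{\<omega>\<in>points. \<omega> n \<in> - A} = space N - {\<omega>\<in>points. \<omega> n \<in> A}" by auto
    then show ?thesis using N.prob_compl[OF cylinder_sets[of n A]] by simp
  qed
  ultimately have "N.prob {\<omega>\<in>points. T g \<omega> n \<in> A} = N.prob {\<omega>\<in>points. \<omega> n \<in> A}"
    using prob_T_le[OF g, of n A] prob_T_le[OF g, of n "- A"] by linarith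
  then show "emeasure (distr N N (T g)) X = emeasure N X"
    unfolding X by (subst emeasure_distr[OF T_measurable[OF g] cylinder_sets])
      (simp only: vim N.emeasure_eq_measure)
qed

lemma prob_T_vimage:
  assumes "g \<in> carrier G" "X \<in> sets N"
  shows "N.prob {\<omega>\<in>points. T g \<omega> \<in> X} = N.prob X"
proof -
  have "N.prob X = measure (distr N N (T g)) X" by (simp add: T_preserves assms)
  also have "\<dots> = N.prob (T g -` X \<inter> space N)" by (rule measure_distr[OF T_measurable[OF assms(1)] assms(2)])
  also have "T g -` X \<inter> space N = {\<omega>\<in>points. T g \<omega> \<in> X}" by auto
  finally show ?thesis by simp
qed

text \<open>The approximation is claimed at all large levels, not just at one, so that finitely many
  events can be brought to a common level. A countable union is first cut off where its remainder
  has probability below \<open>e / 2\<close>.\<close>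

lemma approx_cylinder:
  assumes "X \<in> sets N" "0 < (e::real)"
  shows "\<exists>n. \<forall>m\<ge>n. \<exists>A. N.prob (sym_diff X {\<omega>\<in>points. \<omega> m \<in> A}) < e"
  using assms unfolding sets_N
proof (induction X arbitrary: e rule: sigma_sets.induct)
  case (Basic X)
  then obtain n A where X: "X = {\<omega>\<in>points. \<omega> n \<in> A}" by (auto simp: cylinders_def)
  have "N.prob (sym_diff X {\<omega>\<in>points. \<omega> m \<in> down \<phi> n m -` A}) < e" if "n \<le> m" for m
  proof -
    have "X = {\<omega>\<in>points. \<omega> m \<in> down \<phi> n m -` A}"
      using down_points[OF _ that] by (auto simp: X)
    then have "sym_diff X {\<omega>\<in>points. \<omega> m \<in> down \<phi> n m -` A} = {}" by blast
    then show ?thesis using Basic(2) by (simp only: measure_empty)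
  qed
  then show ?case by blast
next
  case Empty
  have "N.prob (sym_diff {} {\<omega>\<in>points. \<omega> m \<in> {}}) < e" for m using Empty by simp
  then show ?case by blast
next
  case (Compl X)
  then obtain n where n: "\<forall>m\<ge>n. \<exists>A. N.prob (sym_diff X {\<omega>\<in>points. \<omega> m \<in> A}) < e" by blast
  have sub: "X \<subseteq> points" using Compl(1) sigma_sets_into_sp[of cylinders points X] by (auto simp: cylinders_def)
  have "sym_diff (points - X) {\<omega>\<in>points. \<omega> m \<in> - A} = sym_diff X {\<omega>\<in>points. \<omega> m \<in> A}" for m A
    using sub by auto
  then have eq: "N.prob (sym_diff (points - X) {\<omega>\<in>points. \<omega> m \<in> - A}) = N.prob (sym_diff X {\<omega>\<in>points. \<omega> m \<in> A})" for m A
    by (simp only:)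
  show ?case
  proof (intro exI[of _ n] allI impI)
    fix m assume "n \<le> m"
    then obtain A where "N.prob (sym_diff X {\<omega>\<in>points. \<omega> m \<in> A}) < e" using n by blast
    then show "\<exists>A. N.prob (sym_diff (points - X) {\<omega>\<in>points. \<omega> m \<in> A}) < e"
      using eq[of m A] by (intro exI[of _ "- A"]) simp
  qed
next
  case (Union X)
  have X: "X i \<in> sets N" for i using Union(1) by (simp add: sets_N)
  define Y where "Y n = (\<Union>i. X i) - (\<Union>i<n. X i)" for n
  have Y: "Y n \<in> sets N" for n
    unfolding Y_def using X by (intro sets.Diff sets.countable_UN'') auto
  have "decseq Y" by (intro decseq_SucI) (auto simp: Y_def)
  then have "(\<lambda>n. N.prob (Y n)) \<longlonglongrightarrow> N.prob (\<Inter>n. Y n)"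
    using Y by (intro N.finite_Lim_measure_decseq) auto
  moreover have "(\<Inter>n. Y n) = {}" by (auto simp: Y_def)
  ultimately have "(\<lambda>n. N.prob (Y n)) \<longlonglongrightarrow> 0" by simp
  then have "\<forall>\<^sub>F n in sequentially. N.prob (Y n) < e / 2" using Union by (intro order_tendstoD) auto
  then obtain k where k: "N.prob (Y k) < e / 2" by (auto simp: eventually_sequentially)
  have "\<forall>i. \<exists>n. \<forall>m\<ge>n. \<exists>A. N.prob (sym_diff (X i) {\<omega>\<in>points. \<omega> m \<in> A}) < e / (2 * (real k + 1))"
    using Union(2)[of "e / (2 * (real k + 1))"] Union(3) by simp
  then have "\<exists>n. \<forall>i. \<forall>m\<ge>n i. \<exists>A. N.prob (sym_diff (X i) {\<omega>\<in>points. \<omega> m \<in> A}) < e / (2 * (real k + 1))"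
    by (rule choice)
  then obtain n where n: "\<forall>i. \<forall>m\<ge>n i. \<exists>A. N.prob (sym_diff (X i) {\<omega>\<in>points. \<omega> m \<in> A}) < e / (2 * (real k + 1))"
    by (elim exE)
  define L where "L = (\<Sum>i<k. n i)"
  have "\<exists>A. N.prob (sym_diff (\<Union>i. X i) {\<omega>\<in>points. \<omega> m \<in> A}) < e" if m: "L \<le> m" for m
  proof -
    have "n i \<le> m" if "i < k" for i
      using m member_le_sum[of i "{..<k}" n] that by (simp add: L_def)
    then have "\<forall>i. \<exists>A. i < k \<longrightarrow> N.prob (sym_diff (X i) {\<omega>\<in>points. \<omega> m \<in> A}) < e / (2 * (real k + 1))"
      using n by simp
    then have "\<exists>A. \<forall>i. i < k \<longrightarrow> N.prob (sym_diff (X i) {\<omega>\<in>points. \<omega> m \<in> A i}) < e / (2 * (real k + 1))"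
      by (rule choice)
    then obtain A where A: "\<forall>i. i < k \<longrightarrow> N.prob (sym_diff (X i) {\<omega>\<in>points. \<omega> m \<in> A i}) < e / (2 * (real k + 1))"
      by (elim exE)
    let ?C = "\<lambda>A. {\<omega>\<in>points. \<omega> m \<in> A}"
    have "sym_diff (\<Union>i. X i) (?C (\<Union>i<k. A i)) \<subseteq> Y k \<union> (\<Union>i<k. sym_diff (X i) (?C (A i)))"
      by (auto simp: Y_def)
    then have "N.prob (sym_diff (\<Union>i. X i) (?C (\<Union>i<k. A i))) \<le> N.prob (Y k \<union> (\<Union>i<k. sym_diff (X i) (?C (A i))))"
      using X by (intro N.finite_measure_mono) (auto simp: Y_def)
    also have "\<dots> \<le> N.prob (Y k) + N.prob (\<Union>i<k. sym_diff (X i) (?C (A i)))"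
      using X by (intro measure_Un_le) (auto simp: Y_def)
    also have "N.prob (\<Union>i<k. sym_diff (X i) (?C (A i))) \<le> (\<Sum>i<k. N.prob (sym_diff (X i) (?C (A i))))"
      using X by (intro measure_UNION_le) auto
    also have "\<dots> \<le> (\<Sum>i<k. e / (2 * (real k + 1)))" using A by (intro sum_mono) (auto intro: less_imp_le)
    also have "\<dots> \<le> e / 2" using Union(3) by (simp add: field_simps)
    finally show ?thesis using k by (intro exI[of _ "\<Union>i<k. A i"]) linarith
  qed
  then show ?case by blast
qed

end

section \<open>Orders of type Z as a measurable space\<close>

definition relations :: "('g, 'b) monoid_scheme \<Rightarrow> ('g \<times> 'g \<Rightarrow> bool) set" where
  "relations G = extensional (carrier G \<times> carrier G)"

lemma topspace_relation_topology: "topspace (relation_topology G) = relations G"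
  by (simp add: relation_topology_def relations_def PiE_def)

definition pattern_set where
  "pattern_set G P Q = {f \<in> relations G. (\<forall>p\<in>P. f p) \<and> (\<forall>q\<in>Q. \<not> f q)}"

text \<open>For a countable group the topology has a countable base: finitely many pairs are
  required and finitely many are excluded.\<close>

lemma open_relations_countable_union:
  assumes cnt: "countable (carrier G)" and U: "openin (relation_topology G) U"
  shows "\<exists>\<C>. countable \<C> \<and> \<C> \<subseteq> Fpow (carrier G \<times> carrier G) \<times> Fpow (carrier G \<times> carrier G)
    \<and> U = (\<Union>(P, Q)\<in>\<C>. pattern_set G P Q)"
proof -
  let ?I = "carrier G \<times> carrier G"
  define \<C> where "\<C> = {p \<in> Fpow ?I \<times> Fpow ?I. pattern_set G (fst p) (snd p) \<subseteq> U}"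
  have "countable (Fpow ?I \<times> Fpow ?I)" using cnt by (intro countable_SIGMA countable_Fpow) auto
  then have "countable \<C>" by (rule countable_subset[rotated]) (auto simp: \<C>_def)
  moreover have "U \<subseteq> (\<Union>(P, Q)\<in>\<C>. pattern_set G P Q)"
  proof
    fix x assume x: "x \<in> U"
    then obtain V where V: "finite {i\<in>?I. V i \<noteq> UNIV}" "x \<in> Pi\<^sub>E ?I V" "Pi\<^sub>E ?I V \<subseteq> U"
      using U unfolding relation_topology_def openin_product_topology_alt by auto
    define P where "P = {i\<in>?I. V i \<noteq> UNIV \<and> x i}"
    define Q where "Q = {i\<in>?I. V i \<noteq> UNIV \<and> \<not> x i}"
    have fin: "P \<in> Fpow ?I" "Q \<in> Fpow ?I"
      unfolding P_def Q_def Fpow_def by (auto intro: finite_subset[OF _ V(1)])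
    have "pattern_set G P Q \<subseteq> Pi\<^sub>E ?I V"
    proof
      fix f assume f: "f \<in> pattern_set G P Q"
      have "f i \<in> V i" if "i \<in> ?I" for i
      proof (cases "V i = UNIV")
        case False
        then have "i \<in> P \<or> i \<in> Q" "i \<in> P \<Longrightarrow> x i" "i \<in> Q \<Longrightarrow> \<not> x i"
          using that unfolding P_def Q_def by blast+
        then have "f i = x i" using f unfolding pattern_set_def by blast
        then show ?thesis using V(2) that by (auto simp: PiE_iff)
      qed simp
      then show "f \<in> Pi\<^sub>E ?I V" using f by (auto simp: PiE_iff pattern_set_def relations_def)
    qed
    then have "(P, Q) \<in> \<C>" using fin V by (auto simp: \<C>_def)
    moreover have "x \<in> pattern_set G P Q"
      using V(2) by (auto simp: pattern_set_def P_def Q_def relations_def PiE_iff)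
    ultimately show "x \<in> (\<Union>(P, Q)\<in>\<C>. pattern_set G P Q)" by blast
  qed
  moreover have "(\<Union>(P, Q)\<in>\<C>. pattern_set G P Q) \<subseteq> U" by (auto simp: \<C>_def)
  ultimately show ?thesis by (intro exI[of _ \<C>]) (auto simp: \<C>_def)
qed

lemma space_Z_orders_borel: "space (Z_orders_borel G) = Z_orders G"
proof -
  have "{U. openin (relation_topology G) U} \<subseteq> Pow (topspace (relation_topology G))"
    using openin_subset by auto
  then show ?thesis unfolding Z_orders_borel_def space_restrict_space
    by (auto simp: Z_orders_def space_measure_of)
qed

text \<open>Because of the countable base, the Borel sets are generated by the coordinates.\<close>

lemma measurable_Z_orders_borel:
  assumes cnt: "countable (carrier G)" and h: "\<And>x. x \<in> space M \<Longrightarrow> h x \<in> Z_orders G"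
    and coord: "\<And>a b. a \<in> carrier G \<Longrightarrow> b \<in> carrier G \<Longrightarrow> {x\<in>space M. h x (a, b)} \<in> sets M"
  shows "h \<in> M \<rightarrow>\<^sub>M Z_orders_borel G"
  unfolding Z_orders_borel_def
proof (rule measurable_restrict_space2)
  show "h \<in> space M \<rightarrow> Z_orders G" using h by auto
  have rel: "h x \<in> relations G" if "x \<in> space M" for x
    using h[OF that] by (simp add: Z_orders_def topspace_relation_topology)
  show "h \<in> M \<rightarrow>\<^sub>M sigma (topspace (relation_topology G)) {U. openin (relation_topology G) U}"
  proof (rule measurable_measure_of)
    show "{U. openin (relation_topology G) U} \<subseteq> Pow (topspace (relation_topology G))"
      using openin_subset by auto
    show "h \<in> space M \<rightarrow> topspace (relation_topology G)" using rel by (auto simp: topspace_relation_topology)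
    fix U assume "U \<in> {U. openin (relation_topology G) U}"
    then obtain \<C> where \<C>: "countable \<C>" "\<C> \<subseteq> Fpow (carrier G \<times> carrier G) \<times> Fpow (carrier G \<times> carrier G)"
      and U: "U = (\<Union>(P, Q)\<in>\<C>. pattern_set G P Q)"
      using open_relations_countable_union[OF cnt] by auto
    have coord': "{x\<in>space M. h x p} \<in> sets M" if "p \<in> carrier G \<times> carrier G" for p
      using that coord by auto
    have "h -` pattern_set G P Q \<inter> space M \<in> sets M"
      if "P \<in> Fpow (carrier G \<times> carrier G)" "Q \<in> Fpow (carrier G \<times> carrier G)" for P Q
    proof -
      have "h -` pattern_set G P Q \<inter> space M =
        {x\<in>space M. \<forall>p\<in>P. h x p} \<inter> {x\<in>space M. \<forall>q\<in>Q. \<not> h x q}"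
        using rel by (auto simp: pattern_set_def)
      also have "{x\<in>space M. \<forall>p\<in>P. h x p} \<in> sets M"
        using that coord' by (intro sets.sets_Collect_finite_All) (auto simp: Fpow_def)
      then have "{x\<in>space M. \<forall>p\<in>P. h x p} \<inter> {x\<in>space M. \<forall>q\<in>Q. \<not> h x q} \<in> sets M"
        using that coord' by (intro sets.Int sets.sets_Collect_finite_All sets.sets_Collect_neg) (auto simp: Fpow_def)
      finally show ?thesis .
    qed
    then have "(\<Union>p\<in>\<C>. h -` pattern_set G (fst p) (snd p) \<inter> space M) \<in> sets M"
      using \<C> by (intro sets.countable_UN'') auto
    also have "(\<Union>p\<in>\<C>. h -` pattern_set G (fst p) (snd p) \<inter> space M) = h -` U \<inter> space M"
      unfolding U by (auto simp: case_prod_unfold)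
    finally show "h -` U \<inter> space M \<in> sets M" .
  qed
qed

lemma Z_orders_coord_sets:
  assumes "a \<in> carrier G" "b \<in> carrier G"
  shows "{f\<in>Z_orders G. f (a, b)} \<in> sets (Z_orders_borel G)"
proof -
  let ?X = "relation_topology G"
  have sub: "{U. openin ?X U} \<subseteq> Pow (topspace ?X)" using openin_subset by auto
  have "openin ?X {f\<in>topspace ?X. f (a, b) \<in> {True}}"
    unfolding relation_topology_def
    by (rule openin_continuous_map_preimage[OF continuous_map_product_projection]) (use assms in auto)
  then have "{f\<in>topspace ?X. f (a, b) \<in> {True}} \<in> sets (sigma (topspace ?X) {U. openin ?X U})"
    using sub by (simp add: sets_measure_of sigma_sets.Basic)
  then have "Z_orders G \<inter> {f\<in>topspace ?X. f (a, b) \<in> {True}} \<in> sets (Z_orders_borel G)"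
    unfolding Z_orders_borel_def sets_restrict_space by blast
  also have "Z_orders G \<inter> {f\<in>topspace ?X. f (a, b) \<in> {True}} = {f\<in>Z_orders G. f (a, b)}"
    by (auto simp: Z_orders_def)
  finally show ?thesis .
qed

context group
begin

text \<open>Right multiplication by \<open>g\<close> is an isomorphism from the new order onto the
  old one.\<close>

lemma order_action_Z_orders:
  assumes g: "g \<in> carrier G" and f: "f \<in> Z_orders G"
  shows "order_action G g f \<in> Z_orders G"
proof -
  let ?R = "rel_of G f" and ?R' = "rel_of G (order_action G g f)"
  have R': "(a, b) \<in> ?R' \<longleftrightarrow> a \<in> carrier G \<and> b \<in> carrier G \<and> (a \<otimes> g, b \<otimes> g) \<in> ?R" for a b
    using g by (auto simp: rel_of_def order_action_def)
  have Z: "strict_linear_order_on (carrier G) ?R" "\<And>a b. (a, b) \<in> ?R \<Longrightarrow> finite (order_interval G ?R a b)"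
    "\<And>a. a \<in> carrier G \<Longrightarrow> \<exists>b\<in>carrier G. (b, a) \<in> ?R" "\<And>a. a \<in> carrier G \<Longrightarrow> \<exists>b\<in>carrier G. (a, b) \<in> ?R"
    using f by (auto simp: Z_orders_def type_Z_order_def)
  have lin: "trans ?R" "irrefl ?R" "total_on (carrier G) ?R" using Z(1) by (auto simp: strict_linear_order_on_def)
  have cancel: "a \<otimes> g \<otimes> inv g = a" "a \<otimes> inv g \<otimes> g = a" if "a \<in> carrier G" for a
    using that g by (simp_all add: m_assoc)
  have "trans ?R'" unfolding trans_def R' using lin(1) by (meson transD)
  moreover have "irrefl ?R'" using lin(2) unfolding irrefl_def R' by blast
  moreover have "total_on (carrier G) ?R'"
    unfolding total_on_def R'
  proof (intro ballI impI)
    fix a b assume ab: "a \<in> carrier G" "b \<in> carrier G" "a \<noteq> b"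
    then have "a \<otimes> g \<noteq> b \<otimes> g" using g by simp
    then show "a \<in> carrier G \<and> b \<in> carrier G \<and> (a \<otimes> g, b \<otimes> g) \<in> ?R \<or> b \<in> carrier G \<and> a \<in> carrier G \<and> (b \<otimes> g, a \<otimes> g) \<in> ?R"
      using lin(3) ab g unfolding total_on_def by (meson m_closed)
  qed
  ultimately have "strict_linear_order_on (carrier G) ?R'" by (simp add: strict_linear_order_on_def)
  moreover have "finite (order_interval G ?R' a b)" if "(a, b) \<in> ?R'" for a b
  proof (rule finite_subset)
    show "order_interval G ?R' a b \<subseteq> (\<lambda>x. x \<otimes> inv g) ` order_interval G ?R (a \<otimes> g) (b \<otimes> g)"
    proof
      fix x assume x: "x \<in> order_interval G ?R' a b"
      then have xG: "x \<in> carrier G" using that R' by (auto simp: order_interval_def)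
      have "x \<otimes> g \<in> order_interval G ?R (a \<otimes> g) (b \<otimes> g)" using x R' g by (auto simp: order_interval_def)
      then show "x \<in> (\<lambda>x. x \<otimes> inv g) ` order_interval G ?R (a \<otimes> g) (b \<otimes> g)"
        using cancel(1)[OF xG] by (metis image_eqI)
    qed
    show "finite ((\<lambda>x. x \<otimes> inv g) ` order_interval G ?R (a \<otimes> g) (b \<otimes> g))" using Z(2) that R' by auto
  qed
  moreover have "\<exists>b\<in>carrier G. (b, a) \<in> ?R'" "\<exists>b\<in>carrier G. (a, b) \<in> ?R'" if a: "a \<in> carrier G" for a
  proof -
    obtain b c where "b \<in> carrier G" "(b, a \<otimes> g) \<in> ?R" "c \<in> carrier G" "(a \<otimes> g, c) \<in> ?R"
      using Z(3,4)[of "a \<otimes> g"] a g by blast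
    then have "(b \<otimes> inv g, a) \<in> ?R'" "(a, c \<otimes> inv g) \<in> ?R'" "b \<otimes> inv g \<in> carrier G" "c \<otimes> inv g \<in> carrier G"
      unfolding R' using a g cancel by auto
    then show "\<exists>b\<in>carrier G. (b, a) \<in> ?R'" "\<exists>b\<in>carrier G. (a, b) \<in> ?R'" by blast+
  qed
  moreover have "?R' \<subseteq> carrier G \<times> carrier G" by (auto simp: rel_of_def)
  ultimately have "type_Z_order G ?R'" by (auto simp: type_Z_order_def)
  then show ?thesis by (simp add: Z_orders_def topspace_relation_topology relations_def order_action_def)
qed

lemma order_action_measurable:
  assumes "countable (carrier G)" and g: "g \<in> carrier G"
  shows "order_action G g \<in> Z_orders_borel G \<rightarrow>\<^sub>M Z_orders_borel G"
proof (rule measurable_Z_orders_borel[OF assms(1)])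
  fix a b assume "a \<in> carrier G" "b \<in> carrier G"
  then show "{f\<in>space (Z_orders_borel G). order_action G g f (a, b)} \<in> sets (Z_orders_borel G)"
    using Z_orders_coord_sets[of "a \<otimes> g" G "b \<otimes> g"] g by (simp add: order_action_def space_Z_orders_borel)
qed (use order_action_Z_orders[OF g] in \<open>simp add: space_Z_orders_borel\<close>)

end

section \<open>The random order\<close>

context tiling_system
begin

definition code :: "'a \<Rightarrow> nat" where "code = to_nat_on (carrier G)"

lemma code_inj: "x \<in> carrier G \<Longrightarrow> y \<in> carrier G \<Longrightarrow> code x = code y \<Longrightarrow> x = y"
  unfolding code_def using countable_carrier by (simp add: inj_on_to_nat_on inj_on_eq_iff)

definition center :: "nat \<Rightarrow> 'a \<Rightarrow> 'a" where "center n x = inv (\<phi> n x) \<otimes> x"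

text \<open>Comparing centers first keeps each piece together as an interval of the tile. The codes
  merely fix some order among the pieces.\<close>

primrec less_at :: "nat \<Rightarrow> 'a \<Rightarrow> 'a \<Rightarrow> bool" where
  "less_at 0 x y \<longleftrightarrow> code x < code y"
| "less_at (Suc n) x y \<longleftrightarrow> code (center n x) < code (center n y)
     \<or> center n x = center n y \<and> less_at n (\<phi> n x) (\<phi> n y)"

lemma F_carrier: "x \<in> F n \<Longrightarrow> x \<in> carrier G"
  using F(3)[of n] by auto

lemma center_carrier: "x \<in> F (Suc n) \<Longrightarrow> center n x \<in> carrier G"
  using \<phi>[of x n] by (simp add: center_def F_carrier)

lemma center_eqD: "x \<in> F (Suc n) \<Longrightarrow> \<phi> n x \<otimes> center n x = x"
  using F_carrier[OF \<phi>[of x n]] F_carrier[of x "Suc n"] by (simp add: center_def)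

lemma less_at_irrefl: "\<not> less_at n x x"
  by (induction n arbitrary: x) auto

lemma less_at_trans: "less_at n x y \<Longrightarrow> less_at n y z \<Longrightarrow> less_at n x z"
proof (induction n arbitrary: x y z)
  case (Suc n)
  show ?case
    using Suc.prems Suc.IH[of "\<phi> n x" "\<phi> n y" "\<phi> n z"]
    unfolding less_at.simps by (elim disjE conjE) simp_all
qed simp

lemma less_at_total: "x \<in> F n \<Longrightarrow> y \<in> F n \<Longrightarrow> x \<noteq> y \<Longrightarrow> less_at n x y \<or> less_at n y x"
proof (induction n arbitrary: x y)
  case 0
  then show ?case using code_inj[of x y] F_carrier by (force simp: neq_iff)
next
  case (Suc n)
  show ?case
  proof (cases "center n x = center n y")
    case True
    then have "\<phi> n x \<noteq> \<phi> n y" using Suc.prems center_eqD[of x n] center_eqD[of y n] by metis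
    then show ?thesis using True Suc.IH[of "\<phi> n x" "\<phi> n y"] Suc.prems \<phi> by auto
  next
    case False
    then have "code (center n x) \<noteq> code (center n y)"
      using code_inj[of "center n x" "center n y"] Suc.prems center_carrier by blast
    then show ?thesis by auto
  qed
qed

lemma less_at_convex:
  assumes "x \<in> F (Suc n)" "y \<in> F (Suc n)" "z \<in> F (Suc n)"
    and "less_at (Suc n) x y" "less_at (Suc n) y z" "center n x = center n z"
  shows "center n y = center n x \<and> less_at n (\<phi> n x) (\<phi> n y) \<and> less_at n (\<phi> n y) (\<phi> n z)"
  using assms(4-6) unfolding less_at.simps by (elim disjE conjE) simp_all

lemma center_stable:
  assumes \<omega>: "\<omega> \<in> points" and a: "a \<in> carrier G" "stable M a \<omega>" "M \<le> m"
  shows "center m (a \<otimes> \<omega> (Suc m)) = inv (\<omega> m) \<otimes> \<omega> (Suc m)"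
  using stableD(2)[OF \<omega> a(2,3)] a(1) points_carrier[OF \<omega>]
  by (simp add: center_def inv_mult_group m_assoc)

text \<open>Asking for all large levels avoids choosing a level at which \<open>a\<close> and
  \<open>b\<close> are stable. Irreflexivity and transitivity then hold for every sequence; totality
  uses stability.\<close>

definition ord :: "(nat \<Rightarrow> 'a) \<Rightarrow> 'a \<Rightarrow> 'a \<Rightarrow> bool" where
  "ord \<omega> a b \<longleftrightarrow> (\<exists>M. \<forall>m\<ge>M. less_at m (a \<otimes> \<omega> m) (b \<otimes> \<omega> m))"

text \<open>From level \<open>M\<close> on, \<open>a\<close> and \<open>b\<close> lie in the same
  piece, so the comparison ties on centers and passes to the level below.\<close>

lemma less_at_stable:
  assumes \<omega>: "\<omega> \<in> points" and a: "a \<in> carrier G" "stable M a \<omega>" and b: "b \<in> carrier G" "stable M b \<omega>"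
    and "M \<le> m"
  shows "less_at m (a \<otimes> \<omega> m) (b \<otimes> \<omega> m) \<longleftrightarrow> less_at M (a \<otimes> \<omega> M) (b \<otimes> \<omega> M)"
  using assms(6)
proof (induction m rule: dec_induct)
  case (step m)
  then show ?case
    using center_stable[OF \<omega> a step(1)] center_stable[OF \<omega> b step(1)]
      stableD(2)[OF \<omega> a(2) step(1)] stableD(2)[OF \<omega> b(2) step(1)] by simp
qed simp

lemma ord_iff:
  assumes \<omega>: "\<omega> \<in> points" and a: "a \<in> carrier G" "stable M a \<omega>" and b: "b \<in> carrier G" "stable M b \<omega>"
  shows "ord \<omega> a b \<longleftrightarrow> less_at M (a \<otimes> \<omega> M) (b \<otimes> \<omega> M)"
proof
  assume "ord \<omega> a b"
  then obtain M' where "\<forall>m\<ge>M'. less_at m (a \<otimes> \<omega> m) (b \<otimes> \<omega> m)"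
    unfolding ord_def by (elim exE)
  then have "less_at (max M M') (a \<otimes> \<omega> (max M M')) (b \<otimes> \<omega> (max M M'))" by simp
  then show "less_at M (a \<otimes> \<omega> M) (b \<otimes> \<omega> M)"
    using less_at_stable[OF assms, of "max M M'"] by simp
next
  assume *: "less_at M (a \<otimes> \<omega> M) (b \<otimes> \<omega> M)"
  show "ord \<omega> a b"
    unfolding ord_def
  proof (intro exI[of _ M] allI impI)
    fix m assume "M \<le> m"
    then show "less_at m (a \<otimes> \<omega> m) (b \<otimes> \<omega> m)" using * less_at_stable[OF assms] by blast
  qed
qed

lemma common_stable:
  assumes \<omega>: "\<omega> \<in> points" and "a \<in> carrier G" "b \<in> carrier G" "c \<in> carrier G"
  obtains M where "stable M a \<omega>" "stable M b \<omega>" "stable M c \<omega>"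
proof -
  obtain Ma where a: "stable Ma a \<omega>" using points_stable[OF \<omega> assms(2)] by (elim exE)
  obtain Mb where b: "stable Mb b \<omega>" using points_stable[OF \<omega> assms(3)] by (elim exE)
  obtain Mc where c: "stable Mc c \<omega>" using points_stable[OF \<omega> assms(4)] by (elim exE)
  show thesis
    by (rule that[of "max Ma (max Mb Mc)"]) (rule stable_mono[OF a] stable_mono[OF b] stable_mono[OF c], simp)+
qed

text \<open>Where all three elements share the tile of the unit, the position of \<open>a\<close>
  seen from \<open>g\<close> is that of \<open>a \<otimes> g\<close> seen from the unit.\<close>

lemma ord_T:
  assumes \<omega>: "\<omega> \<in> points" and g: "g \<in> carrier G" and ab: "a \<in> carrier G" "b \<in> carrier G"
  shows "ord (T g \<omega>) a b \<longleftrightarrow> ord \<omega> (a \<otimes> g) (b \<otimes> g)"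
proof -
  obtain M where M: "stable M g \<omega>" "stable M (a \<otimes> g) \<omega>" "stable M (b \<otimes> g) \<omega>"
    by (rule common_stable[OF \<omega> g m_closed[OF ab(1) g] m_closed[OF ab(2) g]])
  have "ord (T g \<omega>) a b \<longleftrightarrow> less_at M (a \<otimes> T g \<omega> M) (b \<otimes> T g \<omega> M)"
    using ab by (intro ord_iff T_points[OF \<omega> g] stable_T[OF \<omega> g] M)
  also have "\<dots> \<longleftrightarrow> less_at M (a \<otimes> g \<otimes> \<omega> M) (b \<otimes> g \<otimes> \<omega> M)"
    using T_eq_mult[OF \<omega> M(1)] g ab points_carrier[OF \<omega>] by (simp add: m_assoc)
  also have "\<dots> \<longleftrightarrow> ord \<omega> (a \<otimes> g) (b \<otimes> g)"
    using ab g by (intro ord_iff[symmetric] \<omega> M) auto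
  finally show ?thesis .
qed

lemma ord_irrefl: "\<not> ord \<omega> a a"
proof
  assume "ord \<omega> a a"
  then obtain M where "\<forall>m\<ge>M. less_at m (a \<otimes> \<omega> m) (a \<otimes> \<omega> m)"
    unfolding ord_def by (elim exE)
  then have "less_at M (a \<otimes> \<omega> M) (a \<otimes> \<omega> M)" by simp
  then show False using less_at_irrefl by (rule notE[rotated])
qed

lemma ord_trans:
  assumes "ord \<omega> a b" "ord \<omega> b c"
  shows "ord \<omega> a c"
proof -
  obtain M where M: "\<forall>m\<ge>M. less_at m (a \<otimes> \<omega> m) (b \<otimes> \<omega> m)"
    using assms(1) unfolding ord_def by (elim exE)
  obtain M' where M': "\<forall>m\<ge>M'. less_at m (b \<otimes> \<omega> m) (c \<otimes> \<omega> m)"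
    using assms(2) unfolding ord_def by (elim exE)
  have "\<forall>m\<ge>max M M'. less_at m (a \<otimes> \<omega> m) (c \<otimes> \<omega> m)"
  proof (intro allI impI)
    fix m assume "max M M' \<le> m"
    then have "M \<le> m" "M' \<le> m" by simp_all
    then have "less_at m (a \<otimes> \<omega> m) (b \<otimes> \<omega> m)" "less_at m (b \<otimes> \<omega> m) (c \<otimes> \<omega> m)"
      using M M' by blast+
    then show "less_at m (a \<otimes> \<omega> m) (c \<otimes> \<omega> m)" by (rule less_at_trans)
  qed
  then show ?thesis unfolding ord_def by (rule exI)
qed

lemma ord_total:
  assumes \<omega>: "\<omega> \<in> points" and ab: "a \<in> carrier G" "b \<in> carrier G" "a \<noteq> b"
  shows "ord \<omega> a b \<or> ord \<omega> b a"
proof -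
  obtain M where M: "stable M a \<omega>" "stable M b \<omega>"
    by (rule common_stable[OF \<omega> ab(1) ab(2) ab(2)])
  have "a \<otimes> \<omega> M \<noteq> b \<otimes> \<omega> M" using ab points_carrier[OF \<omega>] by simp
  then have "less_at M (a \<otimes> \<omega> M) (b \<otimes> \<omega> M) \<or> less_at M (b \<otimes> \<omega> M) (a \<otimes> \<omega> M)"
    using stableD(1)[OF \<omega> M(1) order_refl] stableD(1)[OF \<omega> M(2) order_refl] by (rule less_at_total[rotated 2])
  then show ?thesis using ord_iff[OF \<omega> ab(1) M(1) ab(2) M(2)] ord_iff[OF \<omega> ab(2) M(2) ab(1) M(1)] by blast
qed

text \<open>Tiles are convex, so everything between two elements of a tile lies in that tile.\<close>

lemma ord_interval_finite:
  assumes \<omega>: "\<omega> \<in> points" and ab: "a \<in> carrier G" "b \<in> carrier G"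
  shows "finite {x\<in>carrier G. ord \<omega> a x \<and> ord \<omega> x b}"
proof -
  obtain M where M: "stable M a \<omega>" "stable M b \<omega>"
    by (rule common_stable[OF \<omega> ab(1) ab(2) ab(2)])
  have "{x\<in>carrier G. ord \<omega> a x \<and> ord \<omega> x b} \<subseteq> (\<lambda>y. y \<otimes> inv (\<omega> M)) ` F M"
  proof
    fix x assume "x \<in> {x\<in>carrier G. ord \<omega> a x \<and> ord \<omega> x b}"
    then have x: "x \<in> carrier G" "ord \<omega> a x" "ord \<omega> x b" by auto
    obtain M' where "stable M' x \<omega>" using points_stable[OF \<omega> x(1)] by (elim exE)
    define L where "L = max M M'"
    have L: "stable L x \<omega>" "stable L a \<omega>" "stable L b \<omega>" "M \<le> L"
      using \<open>stable M' x \<omega>\<close> M stable_mono by (auto simp: L_def)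
    \<comment> \<open>Descend from a level \<open>L\<close> at which \<open>x\<close> is stable too
      to the level \<open>M\<close>, which does not depend on \<open>x\<close>. On the way convexity
      keeps \<open>x\<close> in the piece of \<open>a\<close> and \<open>b\<close>; at level
      \<open>M\<close> only the finitely many positions in \<open>F M\<close> remain.\<close>
    have "x \<otimes> \<omega> M \<in> F M \<and> less_at M (a \<otimes> \<omega> M) (x \<otimes> \<omega> M) \<and> less_at M (x \<otimes> \<omega> M) (b \<otimes> \<omega> M)"
      using L(4)
    proof (induction rule: inc_induct)
      case base
      show ?case
        using stableD(1)[OF \<omega> L(1) order_refl] x(2,3) ord_iff[OF \<omega> ab(1) L(2) x(1) L(1)] ord_iff[OF \<omega> x(1) L(1) ab(2) L(3)] by blast
    next
      case (step n)
      have n: "M \<le> n" "M \<le> Suc n" using step by auto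
      have ca: "center n (a \<otimes> \<omega> (Suc n)) = inv (\<omega> n) \<otimes> \<omega> (Suc n)"
        by (rule center_stable[OF \<omega> ab(1) M(1) n(1)])
      have cb: "center n (b \<otimes> \<omega> (Suc n)) = inv (\<omega> n) \<otimes> \<omega> (Suc n)"
        by (rule center_stable[OF \<omega> ab(2) M(2) n(1)])
      have conv: "center n (x \<otimes> \<omega> (Suc n)) = center n (a \<otimes> \<omega> (Suc n))
         \<and> less_at n (\<phi> n (a \<otimes> \<omega> (Suc n))) (\<phi> n (x \<otimes> \<omega> (Suc n)))
         \<and> less_at n (\<phi> n (x \<otimes> \<omega> (Suc n))) (\<phi> n (b \<otimes> \<omega> (Suc n)))"
      proof (rule less_at_convex)
        show "a \<otimes> \<omega> (Suc n) \<in> F (Suc n)" "b \<otimes> \<omega> (Suc n) \<in> F (Suc n)"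
          using stableD(1)[OF \<omega> M(1) n(2)] stableD(1)[OF \<omega> M(2) n(2)] .
        show "center n (a \<otimes> \<omega> (Suc n)) = center n (b \<otimes> \<omega> (Suc n))" using ca cb by simp
      qed (use step.IH in blast)+
      have xF: "x \<otimes> \<omega> (Suc n) \<in> F (Suc n)" using step.IH by blast
      have \<omega>G: "\<omega> n \<in> carrier G" "\<omega> (Suc n) \<in> carrier G" using points_carrier[OF \<omega>] by auto
      have "\<phi> n (x \<otimes> \<omega> (Suc n)) \<otimes> (inv (\<omega> n) \<otimes> \<omega> (Suc n)) = x \<otimes> \<omega> (Suc n)"
        using center_eqD[OF xF] conv ca by simp
      also have "x \<otimes> \<omega> (Suc n) = (x \<otimes> \<omega> n) \<otimes> (inv (\<omega> n) \<otimes> \<omega> (Suc n))"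
        using x(1) \<omega>G by (simp add: m_assoc)
      finally have "\<phi> n (x \<otimes> \<omega> (Suc n)) = x \<otimes> \<omega> n"
        using x(1) \<omega>G F_carrier[OF \<phi>[OF xF]] by simp
      moreover have "\<phi> n (x \<otimes> \<omega> (Suc n)) \<in> F n" by (rule \<phi>[OF xF])
      ultimately show ?case
        using conv stableD(2)[OF \<omega> M(1) n(1)] stableD(2)[OF \<omega> M(2) n(1)] by simp
    qed
    moreover have "x = x \<otimes> \<omega> M \<otimes> inv (\<omega> M)" using x(1) points_carrier[OF \<omega>] by (simp add: m_assoc)
    ultimately show "x \<in> (\<lambda>y. y \<otimes> inv (\<omega> M)) ` F M" by blast
  qed
  then show ?thesis using F(1) finite_surj by blast
qed

lemma ord_sets:
  "{\<omega>\<in>points. ord \<omega> a b} \<in> sets N"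
proof -
  have "{\<omega>\<in>points. ord \<omega> a b} = (\<Union>M. \<Inter>m\<in>{M..}. {\<omega>\<in>points. \<omega> m \<in> {x. less_at m (a \<otimes> x) (b \<otimes> x)}})"
    by (auto simp: ord_def)
  also have "\<dots> \<in> sets N"
    by (intro sets.countable_UN'' sets.countable_INT' image_subsetI cylinder_sets) auto
  finally show ?thesis .
qed

text \<open>Used for the events that \<open>a\<close> is minimal, or maximal: no point of an infinite group can be
  chosen uniformly at random.\<close>

lemma null_of_translates:
  assumes X: "\<And>a. a \<in> carrier G \<Longrightarrow> X a \<in> sets N"
    and disj: "disjoint_family_on X (carrier G)"
    and eq: "\<And>a. a \<in> carrier G \<Longrightarrow> N.prob (X a) = p"
  shows "p = 0"
proof (rule ccontr)
  assume "p \<noteq> 0"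
  moreover have "0 \<le> p" using eq[OF one_closed] measure_nonneg[of N "X \<one>"] by simp
  ultimately have "0 < p" by simp
  then obtain n :: nat where n: "1 < n * p" using reals_Archimedean3 by blast
  obtain A where A: "A \<subseteq> carrier G" "finite A" "card A = n"
    using infinite_arbitrarily_large[OF infinite_carrier] by blast
  have "N.prob (\<Union>a\<in>A. X a) = (\<Sum>a\<in>A. N.prob (X a))"
    using A X disjoint_family_on_mono[OF A(1) disj] by (intro N.finite_measure_finite_Union) auto
  also have "\<dots> = n * p" using A eq by (simp add: subset_eq)
  finally show False using n N.prob_le_1[of "\<Union>a\<in>A. X a"] by linarith
qed

definition minimal :: "'a \<Rightarrow> (nat \<Rightarrow> 'a) set" where
  "minimal a = {\<omega>\<in>points. \<forall>b\<in>carrier G. \<not> ord \<omega> b a}"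

definition maximal :: "'a \<Rightarrow> (nat \<Rightarrow> 'a) set" where
  "maximal a = {\<omega>\<in>points. \<forall>b\<in>carrier G. \<not> ord \<omega> a b}"

lemma minimal_sets: "minimal a \<in> sets N" and maximal_sets: "maximal a \<in> sets N"
proof -
  have "minimal a = (\<Inter>b\<in>carrier G. points - {\<omega>\<in>points. ord \<omega> b a})"
    "maximal a = (\<Inter>b\<in>carrier G. points - {\<omega>\<in>points. ord \<omega> a b})"
    using one_closed by (auto simp: minimal_def maximal_def)
  moreover have "points \<in> sets N" using sets.top[of N] by simp
  ultimately show "minimal a \<in> sets N" "maximal a \<in> sets N"
    using one_closed countable_carrier ord_sets by (auto intro!: sets.countable_INT' sets.Diff)
qed

lemma ball_carrier_mult:
  assumes g: "g \<in> carrier G"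
  shows "(\<forall>b\<in>carrier G. P (b \<otimes> g)) \<longleftrightarrow> (\<forall>b\<in>carrier G. P b)"
proof
  assume *: "\<forall>b\<in>carrier G. P (b \<otimes> g)"
  show "\<forall>b\<in>carrier G. P b"
  proof
    fix b assume b: "b \<in> carrier G"
    then have "P (b \<otimes> inv g \<otimes> g)" using * g by simp
    then show "P b" using b g by (simp add: m_assoc)
  qed
qed (use g in auto)

text \<open>\<open>minimal a\<close> is the preimage of \<open>minimal \<one>\<close> under
  \<open>T a\<close>, so all these events have the same probability, and by totality they are
  disjoint. Likewise for \<open>maximal\<close>.\<close>

lemma prob_minimal: "a \<in> carrier G \<Longrightarrow> N.prob (minimal a) = 0"
  and prob_maximal: "a \<in> carrier G \<Longrightarrow> N.prob (maximal a) = 0"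
proof -
  have "{\<omega>\<in>points. T a \<omega> \<in> minimal \<one>} = minimal a" "{\<omega>\<in>points. T a \<omega> \<in> maximal \<one>} = maximal a"
    if a: "a \<in> carrier G" for a
    using a T_points[OF _ a] ball_carrier_mult[OF a, of "\<lambda>b. \<not> ord \<omega> b a" for \<omega>]
      ball_carrier_mult[OF a, of "\<lambda>b. \<not> ord \<omega> a b" for \<omega>]
    by (auto simp: minimal_def maximal_def ord_T)
  then have eq: "N.prob (minimal a) = N.prob (minimal \<one>)" "N.prob (maximal a) = N.prob (maximal \<one>)"
    if "a \<in> carrier G" for a
    using prob_T_vimage[OF that minimal_sets, of \<one>] prob_T_vimage[OF that maximal_sets, of \<one>] that by auto
  have min: "N.prob (minimal \<one>) = 0"
  proof (rule null_of_translates[OF minimal_sets _ eq(1)])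
    show "disjoint_family_on minimal (carrier G)"
      unfolding disjoint_family_on_def minimal_def using ord_total by blast
  qed
  have max: "N.prob (maximal \<one>) = 0"
  proof (rule null_of_translates[OF maximal_sets _ eq(2)])
    show "disjoint_family_on maximal (carrier G)"
      unfolding disjoint_family_on_def maximal_def using ord_total by blast
  qed
  show "a \<in> carrier G \<Longrightarrow> N.prob (minimal a) = 0" by (rule trans[OF eq(1) min])
  show "a \<in> carrier G \<Longrightarrow> N.prob (maximal a) = 0" by (rule trans[OF eq(2) max])
qed

definition typical :: "(nat \<Rightarrow> 'a) set" where
  "typical = {\<omega>\<in>points. \<forall>a\<in>carrier G. \<omega> \<notin> minimal a \<and> \<omega> \<notin> maximal a}"

lemma typical_sets: "typical \<in> sets N"
proof -
  have eq: "typical = points - (\<Union>a\<in>carrier G. minimal a \<union> maximal a)" by (auto simp: typical_def)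
  have "points \<in> sets N" using sets.top[of N] by simp
  then show ?thesis
    unfolding eq by (intro sets.Diff sets.countable_UN'' countable_carrier sets.Un minimal_sets maximal_sets)
qed

lemma AE_typical: "AE \<omega> in N. \<omega> \<in> typical"
proof -
  have "AE \<omega> in N. \<omega> \<notin> minimal a \<and> \<omega> \<notin> maximal a" if "a \<in> carrier G" for a
  proof -
    have "AE \<omega> in N. \<omega> \<notin> minimal a"
      using minimal_sets prob_minimal[OF that] by (intro AE_not_in null_setsI) (simp_all add: N.emeasure_eq_measure)
    moreover have "AE \<omega> in N. \<omega> \<notin> maximal a"
      using maximal_sets prob_maximal[OF that] by (intro AE_not_in null_setsI) (simp_all add: N.emeasure_eq_measure)
    ultimately show ?thesis by eventually_elim (rule conjI)
  qed
  then have "AE \<omega> in N. \<forall>a\<in>carrier G. \<omega> \<notin> minimal a \<and> \<omega> \<notin> maximal a"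
    unfolding AE_ball_countable[OF countable_carrier] by (rule ballI)
  then show ?thesis using AE_space by eventually_elim (simp add: typical_def)
qed

lemma T_typical:
  assumes \<omega>: "\<omega> \<in> typical" and g: "g \<in> carrier G"
  shows "T g \<omega> \<in> typical"
proof -
  have p: "\<omega> \<in> points" using \<omega> by (simp add: typical_def)
  have "T g \<omega> \<notin> minimal a \<and> T g \<omega> \<notin> maximal a" if a: "a \<in> carrier G" for a
  proof -
    have "a \<otimes> g \<in> carrier G" using a g by simp
    then have "\<omega> \<notin> minimal (a \<otimes> g)" "\<omega> \<notin> maximal (a \<otimes> g)" using \<omega> unfolding typical_def by blast+
    then obtain b c where bc: "b \<in> carrier G" "ord \<omega> b (a \<otimes> g)" "c \<in> carrier G" "ord \<omega> (a \<otimes> g) c"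
      using p unfolding minimal_def maximal_def by blast
    then have "ord (T g \<omega>) (b \<otimes> inv g) a" "ord (T g \<omega>) a (c \<otimes> inv g)"
      using ord_T[OF p g] a g by (auto simp: m_assoc)
    moreover have "b \<otimes> inv g \<in> carrier G" "c \<otimes> inv g \<in> carrier G" using bc g by auto
    ultimately show ?thesis unfolding minimal_def maximal_def by blast
  qed
  then show ?thesis using T_points[OF p g] by (simp add: typical_def)
qed

definition order_of :: "(nat \<Rightarrow> 'a) \<Rightarrow> ('a \<times> 'a \<Rightarrow> bool)" where
  "order_of \<omega> = restrict (\<lambda>(a, b). ord \<omega> a b) (carrier G \<times> carrier G)"

lemma order_of_Z_orders:
  assumes "\<omega> \<in> typical"
  shows "order_of \<omega> \<in> Z_orders G"
proof -
  have \<omega>: "\<omega> \<in> points" using assms by (simp add: typical_def)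
  have R: "rel_of G (order_of \<omega>) = {(a, b). a \<in> carrier G \<and> b \<in> carrier G \<and> ord \<omega> a b}"
    by (auto simp: rel_of_def order_of_def)
  have "type_Z_order G (rel_of G (order_of \<omega>))"
    unfolding type_Z_order_def strict_linear_order_on_def
  proof (intro conjI ballI)
    show "trans (rel_of G (order_of \<omega>))" unfolding R trans_def using ord_trans by blast
    show "irrefl (rel_of G (order_of \<omega>))" unfolding R irrefl_def using ord_irrefl by blast
    show "total_on (carrier G) (rel_of G (order_of \<omega>))"
      unfolding R total_on_def using ord_total[OF \<omega>] by blast
    show "rel_of G (order_of \<omega>) \<subseteq> carrier G \<times> carrier G" by (auto simp: rel_of_def)
  next
    fix p assume "p \<in> rel_of G (order_of \<omega>)"
    then obtain a b where p: "p = (a, b)" and ab: "a \<in> carrier G" "b \<in> carrier G" unfolding R by blast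
    have "order_interval G (rel_of G (order_of \<omega>)) a b \<subseteq> {a, b} \<union> {x\<in>carrier G. ord \<omega> a x \<and> ord \<omega> x b}"
      unfolding order_interval_def R by blast
    moreover have "finite ({a, b} \<union> {x\<in>carrier G. ord \<omega> a x \<and> ord \<omega> x b})"
      using ord_interval_finite[OF \<omega> ab] by simp
    ultimately show "case p of (a, b) \<Rightarrow> finite (order_interval G (rel_of G (order_of \<omega>)) a b)"
      unfolding p prod.case by (rule finite_subset)
  next
    fix a assume a: "a \<in> carrier G"
    show "\<exists>b\<in>carrier G. (b, a) \<in> rel_of G (order_of \<omega>)"
      using assms a \<omega> unfolding R typical_def minimal_def by blast
    show "\<exists>b\<in>carrier G. (a, b) \<in> rel_of G (order_of \<omega>)"
      using assms a \<omega> unfolding R typical_def maximal_def by blast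
  qed
  then show ?thesis by (simp add: Z_orders_def topspace_relation_topology relations_def order_of_def)
qed

lemma order_of_T:
  assumes \<omega>: "\<omega> \<in> points" and g: "g \<in> carrier G"
  shows "order_of (T g \<omega>) = order_action G g (order_of \<omega>)"
  using ord_T[OF \<omega> g] g by (auto simp: order_of_def order_action_def fun_eq_iff)

text \<open>Outside \<open>typical\<close> the order may have an end, so a fixed typical point
  replaces the given one. This makes the map take values in \<open>Z_orders G\<close> everywhere, as
  a measurable map into that space must.\<close>

definition Z_order_of :: "(nat \<Rightarrow> 'a) \<Rightarrow> ('a \<times> 'a \<Rightarrow> bool)" where
  "Z_order_of \<omega> = order_of (if \<omega> \<in> typical then \<omega> else (SOME \<omega>. \<omega> \<in> typical))"

lemma Z_order_of_typical: "\<omega> \<in> typical \<Longrightarrow> Z_order_of \<omega> = order_of \<omega>"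
  by (simp add: Z_order_of_def)

lemma some_typical: "(SOME \<omega>. \<omega> \<in> typical) \<in> typical"
proof -
  have "\<exists>\<omega>. \<omega> \<in> typical"
  proof (rule ccontr)
    assume "\<not> ?thesis"
    then have "AE \<omega> in N. False" using AE_typical by auto
    then show False using N.AE_False by simp
  qed
  then show ?thesis by (rule someI_ex)
qed

lemma Z_order_of_measurable: "Z_order_of \<in> N \<rightarrow>\<^sub>M Z_orders_borel G"
proof (rule measurable_Z_orders_borel[OF countable_carrier])
  show "Z_order_of \<omega> \<in> Z_orders G" for \<omega>
    using order_of_Z_orders some_typical by (simp add: Z_order_of_def)
  fix a b assume ab: "a \<in> carrier G" "b \<in> carrier G"
  define s where "s = (SOME \<omega>. \<omega> \<in> typical)"
  have "{\<omega>\<in>space N. Z_order_of \<omega> (a, b)} =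
    (typical \<inter> {\<omega>\<in>points. ord \<omega> a b}) \<union> (if ord s a b then points - typical else {})"
    using ab by (auto simp: Z_order_of_def order_of_def typical_def s_def)
  also have "\<dots> \<in> sets N"
    using typical_sets ord_sets sets.top[of N] by (auto intro!: sets.Un sets.Int sets.Diff)
  finally show "{\<omega>\<in>space N. Z_order_of \<omega> (a, b)} \<in> sets N" .
qed

definition \<nu> :: "('a \<times> 'a \<Rightarrow> bool) measure" where
  "\<nu> = distr N (Z_orders_borel G) Z_order_of"

lemma sets_\<nu>: "sets \<nu> = sets (Z_orders_borel G)" and space_\<nu>: "space \<nu> = Z_orders G"
  by (simp_all add: \<nu>_def space_Z_orders_borel)

lemma prob_space_\<nu>: "prob_space \<nu>"
  unfolding \<nu>_def by (rule N.prob_space_distr[OF Z_order_of_measurable])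

lemma measure_\<nu>:
  assumes "X \<in> sets \<nu>"
  shows "measure \<nu> X = N.prob {\<omega>\<in>points. Z_order_of \<omega> \<in> X}"
proof -
  have "X \<in> sets (Z_orders_borel G)" using assms unfolding sets_\<nu> .
  then have "measure \<nu> X = N.prob (Z_order_of -` X \<inter> space N)"
    unfolding \<nu>_def by (rule measure_distr[OF Z_order_of_measurable])
  also have "Z_order_of -` X \<inter> space N = {\<omega>\<in>points. Z_order_of \<omega> \<in> X}" by auto
  finally show ?thesis .
qed

lemma order_action_\<nu>_measurable:
  assumes "g \<in> carrier G"
  shows "order_action G g \<in> \<nu> \<rightarrow>\<^sub>M \<nu>"
  using order_action_measurable[OF countable_carrier assms]
  by (simp add: \<nu>_def cong: measurable_cong_sets)

text \<open>On the set \<open>typical\<close>, which has full measure, \<open>order_of\<close>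
  intertwines \<open>T g\<close> with \<open>order_action G g\<close>. Hence the invariance of
  \<open>N\<close> passes to its image \<nu>.\<close>

lemma multiorder_\<nu>: "multiorder G \<nu>"
  unfolding multiorder_def
proof (intro conjI ballI prob_space_\<nu> sets_\<nu>)
  show "space \<nu> = space (Z_orders_borel G)" by (simp add: space_\<nu> space_Z_orders_borel)
  fix g assume g: "g \<in> carrier G"
  show act: "order_action G g \<in> \<nu> \<rightarrow>\<^sub>M \<nu>" by (rule order_action_\<nu>_measurable[OF g])
  interpret \<nu>: prob_space \<nu> by (rule prob_space_\<nu>)
  interpret d: prob_space "distr \<nu> \<nu> (order_action G g)" by (rule \<nu>.prob_space_distr[OF act])
  show "distr \<nu> \<nu> (order_action G g) = \<nu>"
  proof (rule measure_eqI)
    fix X assume "X \<in> sets (distr \<nu> \<nu> (order_action G g))"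
    then have X: "X \<in> sets \<nu>" by simp
    have vimX: "{\<omega>\<in>points. Z_order_of \<omega> \<in> X} \<in> sets N"
      using measurable_sets[OF Z_order_of_measurable, of X] X
      by (simp add: sets_\<nu> vimage_def Int_def conj_commute)
    have "measure (distr \<nu> \<nu> (order_action G g)) X = measure \<nu> (order_action G g -` X \<inter> space \<nu>)"
      by (rule measure_distr[OF act X])
    also have "\<dots> = N.prob {\<omega>\<in>points. Z_order_of \<omega> \<in> order_action G g -` X \<inter> space \<nu>}"
      by (rule measure_\<nu>[OF measurable_sets[OF act X]])
    also have "\<dots> = N.prob {\<omega>\<in>points. T g \<omega> \<in> {\<omega>\<in>points. Z_order_of \<omega> \<in> X}}"
    proof (rule N.finite_measure_eq_AE)
      show "AE \<omega> in N. (\<omega> \<in> {\<omega>\<in>points. Z_order_of \<omega> \<in> order_action G g -` X \<inter> space \<nu>})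
         = (\<omega> \<in> {\<omega>\<in>points. T g \<omega> \<in> {\<omega>\<in>points. Z_order_of \<omega> \<in> X}})"
        using AE_typical
      proof eventually_elim
        case (elim \<omega>)
        then have "\<omega> \<in> points" by (simp add: typical_def)
        then show ?case
          using elim T_typical[OF elim g] T_points[OF _ g] order_of_T[OF _ g] order_of_Z_orders[OF elim]
          by (simp add: Z_order_of_typical space_\<nu>)
      qed
      show "{\<omega>\<in>points. Z_order_of \<omega> \<in> order_action G g -` X \<inter> space \<nu>} \<in> N.events"
        using measurable_sets[OF Z_order_of_measurable, of "order_action G g -` X \<inter> space \<nu>"] measurable_sets[OF act X]
        by (simp add: sets_\<nu> vimage_def Int_def conj_commute)
      show "{\<omega>\<in>points. T g \<omega> \<in> {\<omega>\<in>points. Z_order_of \<omega> \<in> X}} \<in> N.events"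
        using measurable_sets[OF T_measurable[OF g] vimX] by (simp add: vimage_def Int_def conj_commute)
    qed
    also have "\<dots> = N.prob {\<omega>\<in>points. Z_order_of \<omega> \<in> X}" by (rule prob_T_vimage[OF g vimX])
    also have "\<dots> = measure \<nu> X" by (rule measure_\<nu>[OF X, symmetric])
    finally show "emeasure (distr \<nu> \<nu> (order_action G g)) X = emeasure \<nu> X"
      by (simp add: d.emeasure_eq_measure \<nu>.emeasure_eq_measure)
  qed simp
qed

end

section \<open>Zero entropy\<close>

lemma sum_entropy_le:
  fixes p :: "'s \<Rightarrow> real"
  assumes "finite S" and p: "\<And>s. s \<in> S \<Longrightarrow> 0 \<le> p s"
  shows "(\<Sum>s\<in>S. - (p s * ln (p s))) \<le> (\<Sum>s\<in>S. p s) * ln (card S) + 1"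
proof (cases "S = {}")
  case False
  then have n: "0 < real (card S)" using assms(1) by (simp add: card_gt_0_iff)
  have "- (p s * ln (p s)) \<le> p s * ln (card S) + 1 / card S" if "s \<in> S" for s
  proof (cases "p s = 0")
    case False
    then have ps: "0 < p s" using p[OF that] by simp
    have "ln (1 / (p s * card S)) \<le> 1 / (p s * card S) - 1" using ps n by (intro ln_le_minus_one) simp
    then have "p s * ln (1 / (p s * card S)) \<le> p s * (1 / (p s * card S) - 1)"
      using ps by (intro mult_left_mono) auto
    also have "\<dots> = 1 / card S - p s" using ps n by (simp add: field_simps)
    finally show ?thesis using ps n by (simp add: ln_div ln_mult algebra_simps)
  qed simp
  then have "(\<Sum>s\<in>S. - (p s * ln (p s))) \<le> (\<Sum>s\<in>S. p s * ln (card S) + 1 / card S)"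
    by (rule sum_mono)
  also have "\<dots> = (\<Sum>s\<in>S. p s) * ln (card S) + 1"
    using n by (simp add: sum.distrib sum_distrib_right)
  finally show ?thesis .
qed simp

definition names_event :: "'x measure \<Rightarrow> ('g \<Rightarrow> 'x \<Rightarrow> 'x) \<Rightarrow> 'g set \<Rightarrow> ('g \<Rightarrow> 'x set) \<Rightarrow> 'x set" where
  "names_event M T D f = {x\<in>space M. \<forall>g\<in>D. T g x \<in> f g}"

text \<open>The refinement is indexed by the preimage partitions, which may coincide for different
  elements of \<open>D\<close>. Passing to names indexed by \<open>D\<close> can only add sets,
  which is harmless in an upper bound since all entropy terms are nonnegative.\<close>

lemma iterated_partition_subset:
  assumes "D \<noteq> {}"
  shows "iterated_partition M T P D \<subseteq> names_event M T D ` (\<Pi>\<^sub>E g\<in>D. P)"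
proof
  fix X assume "X \<in> iterated_partition M T P D"
  then obtain h where h: "h \<in> (\<Pi>\<^sub>E Q\<in>(\<lambda>g. preimage_partition M (T g) P) ` D. Q)"
    and X: "X = \<Inter> (h ` (\<lambda>g. preimage_partition M (T g) P) ` D)"
    unfolding iterated_partition_def common_refinement_def by auto
  have "\<exists>A. A \<in> P \<and> h (preimage_partition M (T g) P) = T g -` A \<inter> space M" if "g \<in> D" for g
  proof -
    have "h (preimage_partition M (T g) P) \<in> preimage_partition M (T g) P" using h that by auto
    then show ?thesis unfolding preimage_partition_def by auto
  qed
  then obtain A where A: "\<And>g. g \<in> D \<Longrightarrow> A g \<in> P \<and> h (preimage_partition M (T g) P) = T g -` A g \<inter> space M"
    by metis
  have "X = (\<Inter>g\<in>D. T g -` A g \<inter> space M)" unfolding X using A by auto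
  also have "\<dots> = names_event M T D (\<lambda>g\<in>D. A g)" using assms by (auto simp: names_event_def)
  finally show "X \<in> names_event M T D ` (\<Pi>\<^sub>E g\<in>D. P)" using A by (intro image_eqI) auto
qed

text \<open>Names in \<N> have mass at most 1 and number at most \<open>exp L\<close>; the others
  have mass at most \<eta> and number at most \<open>card P ^ card D\<close>.
  \<open>sum_entropy_le\<close> bounds both groups and contributes 1 for each, because their masses
  need not be 1.\<close>

lemma partition_entropy_iterated_le:
  fixes L \<eta> :: real
  assumes M: "prob_space M" and P: "measurable_partition M P" and D: "finite D" "D \<noteq> {}"
    and T: "\<And>g. g \<in> D \<Longrightarrow> T g \<in> M \<rightarrow>\<^sub>M M"
    and \<N>: "\<N> \<subseteq> (\<Pi>\<^sub>E g\<in>D. P)" "card \<N> \<le> exp L" "0 \<le> L"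
    and rest: "(\<Sum>f\<in>(\<Pi>\<^sub>E g\<in>D. P) - \<N>. measure M (names_event M T D f)) \<le> \<eta>" "0 \<le> \<eta>"
  shows "partition_entropy M (iterated_partition M T P D) \<le> L + \<eta> * card D * ln (card P) + 2"
proof -
  interpret prob_space M by (rule M)
  let ?\<Pi> = "\<Pi>\<^sub>E g\<in>D. P" and ?E = "names_event M T D"
  have finP: "finite P" and P_sets: "P \<subseteq> sets M" and part: "partition_on (space M) P"
    using P by (auto simp: measurable_partition_def)
  have fin: "finite ?\<Pi>" using D finP by (intro finite_PiE)
  have E_sets: "?E f \<in> sets M" if "f \<in> ?\<Pi>" for f
  proof -
    have "?E f = (\<Inter>g\<in>D. T g -` f g \<inter> space M)" using D(2) unfolding names_event_def by blast
    also have "\<dots> \<in> sets M"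
      using that P_sets by (intro sets.finite_INT[OF D] measurable_sets[OF T]) auto
    finally show ?thesis .
  qed
  have disj: "disjoint_family_on ?E ?\<Pi>"
    unfolding disjoint_family_on_def
  proof (intro ballI impI)
    fix f f' assume f: "f \<in> ?\<Pi>" "f' \<in> ?\<Pi>" "f \<noteq> f'"
    then obtain g where g: "g \<in> D" "f g \<noteq> f' g" by (meson PiE_ext)
    then have "f g \<in> P" "f' g \<in> P" using f by (meson PiE_mem)+
    then have "f g \<inter> f' g = {}" using g(2) part unfolding partition_on_def disjoint_def by blast
    then show "?E f \<inter> ?E f' = {}" using g by (auto simp: names_event_def)
  qed
  have sum_le_1: "(\<Sum>f\<in>\<N>. prob (?E f)) \<le> 1"
  proof -
    have "(\<Sum>f\<in>\<N>. prob (?E f)) = prob (\<Union>f\<in>\<N>. ?E f)"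
      using \<N>(1) fin E_sets disjoint_family_on_mono[OF \<N>(1) disj]
      by (intro finite_measure_finite_Union[symmetric]) (auto intro: finite_subset)
    then show ?thesis by simp
  qed
  define h where "h x = - (x * ln x)" for x :: real
  have h_nonneg: "0 \<le> h (prob A)" for A
  proof (cases "prob A = 0")
    case False
    then have "0 < prob A" by (simp add: zero_less_measure_iff)
    then have "ln (prob A) \<le> 0" using prob_le_1[of A] ln_le_cancel_iff[of "prob A" 1] by simp
    then show ?thesis using measure_nonneg[of M A] by (simp add: h_def mult_nonneg_nonpos)
  qed (simp add: h_def)
  have "partition_entropy M (iterated_partition M T P D) = (\<Sum>A\<in>iterated_partition M T P D. h (prob A))"
    by (simp add: partition_entropy_def h_def sum_negf)
  also have "\<dots> \<le> (\<Sum>A\<in>?E ` ?\<Pi>. h (prob A))"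
    using fin h_nonneg by (intro sum_mono2 iterated_partition_subset D) auto
  also have "\<dots> \<le> (\<Sum>f\<in>?\<Pi>. h (prob (?E f)))"
    using sum_image_le[OF fin, of "\<lambda>A. h (prob A)" ?E] h_nonneg by (simp add: comp_def)
  also have "\<dots> = (\<Sum>f\<in>\<N>. h (prob (?E f))) + (\<Sum>f\<in>?\<Pi> - \<N>. h (prob (?E f)))"
    using sum.subset_diff[OF \<N>(1) fin] by (simp add: add.commute)
  also have "\<dots> \<le> (L + 1) + (\<eta> * card D * ln (card P) + 1)"
  proof (rule add_mono)
    have fin\<N>: "finite \<N>" by (rule finite_subset[OF \<N>(1) fin])
    have "(\<Sum>f\<in>\<N>. h (prob (?E f))) \<le> (\<Sum>f\<in>\<N>. prob (?E f)) * ln (card \<N>) + 1"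
      unfolding h_def by (rule sum_entropy_le[OF fin\<N>]) simp
    also have "(\<Sum>f\<in>\<N>. prob (?E f)) * ln (card \<N>) \<le> L"
    proof (cases "\<N> = {}")
      case False
      then have c: "1 \<le> card \<N>" using fin\<N> by (simp add: Suc_le_eq card_gt_0_iff)
      then have "ln (card \<N>) \<le> ln (exp L)" using \<N>(2) by (subst ln_le_cancel_iff) auto
      moreover have "(\<Sum>f\<in>\<N>. prob (?E f)) * ln (card \<N>) \<le> 1 * ln (card \<N>)"
        using sum_le_1 c by (intro mult_right_mono) auto
      ultimately show ?thesis by simp
    qed (use \<N> in simp)
    finally show "(\<Sum>f\<in>\<N>. h (prob (?E f))) \<le> L + 1" by simp
    have "(\<Sum>f\<in>?\<Pi> - \<N>. h (prob (?E f))) \<le> (\<Sum>f\<in>?\<Pi> - \<N>. prob (?E f)) * ln (card (?\<Pi> - \<N>)) + 1"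
      unfolding h_def using fin by (intro sum_entropy_le) auto
    also have "(\<Sum>f\<in>?\<Pi> - \<N>. prob (?E f)) * ln (card (?\<Pi> - \<N>)) \<le> \<eta> * (card D * ln (card P))"
    proof (cases "?\<Pi> - \<N> = {}")
      case True
      have "0 \<le> ln (real (card P))"
      proof (cases "card P = 0")
        case True
        then show ?thesis unfolding True by simp
      next
        case False
        then have "1 \<le> real (card P)" by linarith
        then show ?thesis by (rule ln_ge_zero)
      qed
      then show ?thesis unfolding True using rest(2) by simp
    next
      case False
      then have c: "1 \<le> card (?\<Pi> - \<N>)" using fin by (simp add: Suc_le_eq card_gt_0_iff)
      have "card (?\<Pi> - \<N>) \<le> card ?\<Pi>" using fin by (intro card_mono) auto
      also have "\<dots> = card P ^ card D" using D by (simp add: card_PiE)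
      finally have le: "card (?\<Pi> - \<N>) \<le> card P ^ card D" .
      have cP: "0 < card P"
      proof (rule ccontr)
        assume "\<not> 0 < card P"
        then have "card P = 0" by linarith
        moreover have "0 < card D" using D by (simp add: card_gt_0_iff)
        ultimately have "card P ^ card D = 0" by (simp only: zero_power)
        then show False using le c by linarith
      qed
      then have "0 < real (card P ^ card D)" by simp
      moreover have "real (card (?\<Pi> - \<N>)) \<le> real (card P ^ card D)" using le by (rule of_nat_mono)
      ultimately have "ln (card (?\<Pi> - \<N>)) \<le> ln (real (card P ^ card D))"
        using c by (subst ln_le_cancel_iff) auto
      also have "\<dots> = card D * ln (card P)"
        using cP by (simp add: ln_realpow)
      finally have "ln (card (?\<Pi> - \<N>)) \<le> card D * ln (card P)" .
      then show ?thesis using rest c by (intro mult_mono) (auto simp: Suc_le_eq)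
    qed
    finally show "(\<Sum>f\<in>?\<Pi> - \<N>. h (prob (?E f))) \<le> \<eta> * card D * ln (card P) + 1" by simp
  qed
  finally show ?thesis by simp
qed

text \<open>A function in the ball is determined by the set where it differs from \<open>m\<close>
  and by its values there. So the count is a sum over small subsets \<open>S\<close> with weight
  \<open>card I ^ card S\<close>.\<close>

lemma hamming_ball_card_le:
  fixes s x :: real and D :: "'a set"
  assumes D: "finite D" and I: "finite I" and x: "0 < x" "x \<le> 1"
  shows "finite {f \<in> D \<rightarrow>\<^sub>E I. card {d\<in>D. f d \<noteq> m d} \<le> s}"
    and "card {f \<in> D \<rightarrow>\<^sub>E I. card {d\<in>D. f d \<noteq> m d} \<le> s} \<le> exp (s * ln (1 / x) + x * card I * card D)"
proof -
  let ?H = "{f \<in> D \<rightarrow>\<^sub>E I. card {d\<in>D. f d \<noteq> m d} \<le> s}"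
  let ?S = "{S. S \<subseteq> D \<and> card S \<le> s}"
  have finS: "finite ?S" using D by (intro finite_subset[OF _ finite_Pow_iff[THEN iffD2, OF D]]) auto
  have fin_mem: "finite S" if "S \<in> ?S" for S using that finite_subset[OF _ D] by blast
  have finPi: "finite (S \<rightarrow>\<^sub>E I)" if "finite S" for S :: "'a set" using that I by (intro finite_PiE) auto
  show fin: "finite ?H" by (rule finite_subset[OF _ finPi[OF D]]) blast
  define J where "J f = ({d\<in>D. f d \<noteq> m d}, restrict f {d\<in>D. f d \<noteq> m d})" for f
  have inj: "inj_on J ?H"
  proof (rule inj_onI)
    fix f f' assume f: "f \<in> ?H" "f' \<in> ?H" and eq: "J f = J f'"
    have sets: "{d\<in>D. f d \<noteq> m d} = {d\<in>D. f' d \<noteq> m d}"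
      and vals: "restrict f {d\<in>D. f d \<noteq> m d} = restrict f' {d\<in>D. f' d \<noteq> m d}"
      using eq unfolding J_def prod.inject by (rule conjunct1, rule conjunct2)
    have "f d = f' d" if d: "d \<in> D" for d
    proof (cases "f d = m d")
      case True
      then have "f' d = m d" using sets d by blast
      then show ?thesis using True by simp
    next
      case False
      then have "d \<in> {d\<in>D. f d \<noteq> m d}" "d \<in> {d\<in>D. f' d \<noteq> m d}" using d sets by blast+
      then show ?thesis using fun_cong[OF vals, of d] by (simp only: restrict_apply if_True)
    qed
    then show "f = f'" using f by (intro PiE_ext[of f D "\<lambda>_. I"]) auto
  qed
  have sub: "J ` ?H \<subseteq> Sigma ?S (\<lambda>S. S \<rightarrow>\<^sub>E I)"
  proof (rule image_subsetI)
    fix f assume f: "f \<in> ?H"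
    then have "restrict f {d\<in>D. f d \<noteq> m d} \<in> {d\<in>D. f d \<noteq> m d} \<rightarrow>\<^sub>E I" by (auto simp: PiE_iff)
    moreover have "{d\<in>D. f d \<noteq> m d} \<in> ?S" using f by blast
    ultimately show "J f \<in> Sigma ?S (\<lambda>S. S \<rightarrow>\<^sub>E I)" unfolding J_def by (intro SigmaI)
  qed
  have finSig: "finite (Sigma ?S (\<lambda>S. S \<rightarrow>\<^sub>E I))"
    by (intro finite_SigmaI finS finPi fin_mem)
  have "card ?H = card (J ` ?H)" using inj by (rule card_image[symmetric])
  also have "\<dots> \<le> card (Sigma ?S (\<lambda>S. S \<rightarrow>\<^sub>E I))" by (rule card_mono[OF finSig sub])
  also have "\<dots> = (\<Sum>S\<in>?S. card (S \<rightarrow>\<^sub>E I))"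
    using finS finPi fin_mem by (intro card_SigmaI) blast+
  also have "\<dots> = (\<Sum>S\<in>?S. card I ^ card S)"
    using fin_mem by (intro sum.cong refl) (simp add: card_PiE)
  finally have "real (card ?H) \<le> (\<Sum>S\<in>?S. real (card I) ^ card S)"
    by (simp flip: of_nat_sum of_nat_power)
  also have "\<dots> \<le> exp (s * ln (1 / x) + x * card I * card D)"
    by (rule sum_small_subsets_le[OF D x]) simp
  finally show "card ?H \<le> exp (s * ln (1 / x) + x * card I * card D)" .
qed

text \<open>Markov's inequality for the number of events that occur.\<close>

lemma (in prob_space) prob_count_le:
  fixes a z :: real
  assumes S: "finite S" and X: "\<And>s. s \<in> S \<Longrightarrow> X s \<in> events" "\<And>s. s \<in> S \<Longrightarrow> prob (X s) \<le> z" and a: "0 < a"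
  shows "{\<omega>\<in>space M. a < card {s\<in>S. \<omega> \<in> X s}} \<in> events"
    and "prob {\<omega>\<in>space M. a < card {s\<in>S. \<omega> \<in> X s}} \<le> z * card S / a"
proof -
  let ?E = "{\<omega>\<in>space M. a < card {s\<in>S. \<omega> \<in> X s}}"
  have count: "real (card {s\<in>S. \<omega> \<in> X s}) = (\<Sum>s\<in>S. indicator (X s) \<omega>)" for \<omega>
    using S by (simp add: indicator_def sum.If_cases Int_def)
  have [measurable]: "(\<lambda>\<omega>. \<Sum>s\<in>S. indicator (X s) \<omega> :: real) \<in> borel_measurable M"
    using X(1) by (intro borel_measurable_sum borel_measurable_indicator) auto
  show E: "?E \<in> events" unfolding count by measurable
  have "a * prob ?E = (\<integral>\<omega>. a * indicator ?E \<omega> \<partial>M)"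
    using E by (simp add: Int_absorb2 sets.sets_into_space)
  also have "\<dots> \<le> (\<integral>\<omega>. (\<Sum>s\<in>S. indicator (X s) \<omega>) \<partial>M)"
  proof (rule integral_mono)
    show "integrable M (\<lambda>\<omega>. a * indicator ?E \<omega>)"
      by (intro integrable_mult_right integrable_real_indicator E) (simp add: emeasure_eq_measure)
    show "integrable M (\<lambda>\<omega>. \<Sum>s\<in>S. indicator (X s) \<omega> :: real)"
      using X(1) by (intro Bochner_Integration.integrable_sum integrable_real_indicator) (auto simp: emeasure_eq_measure)
    fix \<omega>
    show "a * indicator ?E \<omega> \<le> (\<Sum>s\<in>S. indicator (X s) \<omega>)"
      unfolding count[symmetric] by (auto simp: indicator_def)
  qed
  also have "\<dots> = (\<Sum>s\<in>S. prob (X s))"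
    using X(1) by (subst Bochner_Integration.integral_sum)
      (auto simp: Int_absorb2 sets.sets_into_space emeasure_eq_measure intro!: integrable_real_indicator)
  also have "\<dots> \<le> (\<Sum>s\<in>S. z)" using X(2) by (intro sum_mono)
  finally have "prob ?E * a \<le> z * card S" by (simp add: mult.commute)
  then show "prob ?E \<le> z * card S / a" using a by (simp add: pos_le_divide_eq)
qed

text \<open>The covering of \<open>tile_assignment\<close> with \<open>K\<close> empty and constant
  weight 1. Only the number of centers and the uncovered part matter here, so the batches are merged
  into one set.\<close>

lemma (in group) ex_window_cover:
  fixes \<beta> :: real
  assumes B: "finite B" "B \<noteq> {}" "B \<subseteq> carrier G" and \<beta>: "0 < \<beta>" "\<beta> \<le> 1"
    and D: "almost_inv (m_inv G ` B) (1 / card B) D"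
  obtains C a where "finite C" "C \<subseteq> carrier G" "card C \<le> 32 / (\<beta> * card B) * card D"
    "card {g\<in>D. a g = None} \<le> 2 * \<beta> * card D"
    "\<And>g c. a g = Some c \<Longrightarrow> c \<in> C \<and> g \<otimes> inv c \<in> B"
proof -
  have ai: "almost_inv ({} \<union> m_inv G ` {}) 0 B" using B by (simp add: almost_inv_def)
  have "\<exists>Cs. (\<forall>C\<in>set Cs. finite C \<and> C \<subseteq> carrier G)
    \<and> (\<Sum>C\<leftarrow>Cs. card C) \<le> 32 / (1 * \<beta> * card B) * card D
    \<and> card {g\<in>D. asg (in_tile B) Cs g = None} \<le> 2 * \<beta> * card D"
  proof (rule tile_assignment[OF B, of "{}" 0 1 \<beta> "\<lambda>_. 1" 1 D, rotated -1])
    fix Cs :: "'a set list"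
    assume "\<And>C. C \<in> set Cs \<Longrightarrow> finite C \<and> C \<subseteq> carrier G"
      "(\<Sum>C\<leftarrow>Cs. card C) \<le> 32 / (1 * \<beta> * card B) * card D"
      "card {g\<in>D. asg (in_tile B) Cs g = None} \<le> 2 * \<beta> * card D"
    then show "\<exists>Cs. (\<forall>C\<in>set Cs. finite C \<and> C \<subseteq> carrier G)
      \<and> (\<Sum>C\<leftarrow>Cs. card C) \<le> 32 / (1 * \<beta> * card B) * card D
      \<and> card {g\<in>D. asg (in_tile B) Cs g = None} \<le> 2 * \<beta> * card D" by blast
  qed (use \<beta> D ai in auto)
  then obtain Cs where Cs: "\<And>C. C \<in> set Cs \<Longrightarrow> finite C \<and> C \<subseteq> carrier G"
    and sum: "(\<Sum>C\<leftarrow>Cs. card C) \<le> 32 / (1 * \<beta> * card B) * card D"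
    and none: "card {g\<in>D. asg (in_tile B) Cs g = None} \<le> 2 * \<beta> * card D"
    by blast
  have "card (\<Union>(set Cs)) \<le> (\<Sum>C\<leftarrow>Cs. card C)"
  proof (induction Cs)
    case (Cons C Cs)
    then show ?case using card_Un_le[of C "\<Union>(set Cs)"] by simp
  qed simp
  then have "real (card (\<Union>(set Cs))) \<le> 32 / (\<beta> * card B) * card D" using sum by simp
  then show thesis
    using that[of "\<Union>(set Cs)" "asg (in_tile B) Cs"] Cs none asg_SomeD[of "in_tile B" Cs]
    by (auto simp: in_tile_def)
qed

text \<open>Take for \<kappa> a square \<open>s\<^sup>2\<close>: then
  \<open>ln (1 / s) \<le> 1 / s - 1\<close> gives
  \<open>\<kappa> * ln (1 / \<kappa>) \<le> 2 * s\<close>, which is linear in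
  \<open>s\<close>.\<close>

lemma ex_small_entropy_radius:
  fixes \<eta> c :: real
  assumes "0 < \<eta>" "0 \<le> c"
  shows "\<exists>\<kappa>>0. \<kappa> \<le> 1 \<and> \<kappa> * ln (1 / \<kappa>) + \<kappa> * c \<le> \<eta>"
proof -
  define s where "s = min 1 (\<eta> / (2 + c))"
  have s: "0 < s" "s \<le> 1" using assms by (auto simp: s_def)
  have "s \<le> \<eta> / (2 + c)" by (simp add: s_def)
  then have s3: "s * (2 + c) \<le> \<eta>" using assms by (subst (asm) pos_le_divide_eq) auto
  have "ln (1 / s) \<le> 1 / s - 1" using s by (intro ln_le_minus_one) simp
  then have "s\<^sup>2 * (2 * ln (1 / s)) \<le> s\<^sup>2 * (2 * (1 / s))" by (intro mult_left_mono) auto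
  moreover have "ln (1 / s\<^sup>2) = 2 * ln (1 / s)" using s by (simp add: ln_div ln_realpow)
  moreover have "s\<^sup>2 * (2 * (1 / s)) = 2 * s" using s by (simp add: power2_eq_square)
  ultimately have "s\<^sup>2 * ln (1 / s\<^sup>2) \<le> 2 * s" by simp
  moreover have "s\<^sup>2 * c \<le> s * c" using s assms by (intro mult_right_mono) (auto simp: power2_eq_square mult_le_one)
  ultimately have "s\<^sup>2 * ln (1 / s\<^sup>2) + s\<^sup>2 * c \<le> \<eta>" using s3 by (simp add: algebra_simps)
  then show ?thesis using s by (intro exI[of _ "s\<^sup>2"]) (auto simp: power_le_one)
qed

context tiling_system
begin

section \<open>Names seen through windows\<close>

definition window :: "nat \<Rightarrow> (nat \<Rightarrow> 'a) \<Rightarrow> 'a \<Rightarrow> 'a" where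
  "window n \<omega> = (\<lambda>b\<in>B n. T b \<omega> n)"

definition patterns_at :: "nat \<Rightarrow> ('a \<Rightarrow> 'a) set" where
  "patterns_at n = (\<lambda>u. \<lambda>b\<in>B n. \<phi> n (b \<otimes> u)) ` (F (Suc n) - Bad n)"

text \<open>Outside \<open>bad_from n\<close>, every \<open>b\<close> in \<open>B n\<close> shares
  the tile of the unit from level \<open>n + 1\<close> on, so its position at level \<open>n\<close>
  is read off from \<open>\<omega> (Suc n)\<close>. The result is one of the patterns counted when
  \<open>\<phi> n\<close> was constructed.\<close>

lemma window_in_patterns:
  assumes \<omega>: "\<omega> \<in> points" and good: "\<omega> \<notin> bad_from n"
  shows "window n \<omega> \<in> patterns_at n"
proof -
  have good': "\<omega> \<notin> bad_from (Suc n)" using good by (auto simp: bad_from_def)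
  have "window n \<omega> = (\<lambda>b\<in>B n. \<phi> n (b \<otimes> \<omega> (Suc n)))"
    unfolding window_def
  proof (rule restrict_ext)
    fix b assume "b \<in> B n"
    then have b: "b \<in> K (Suc n)" using B(3) by auto
    have "stable (Suc n) b \<omega>" using \<omega> by (intro stable_of_good b good') (auto simp: points_def)
    then show "T b \<omega> n = \<phi> n (b \<otimes> \<omega> (Suc n))" using T_eq[OF \<omega>, of "Suc n" b n] by simp
  qed
  moreover have "\<omega> (Suc n) \<in> F (Suc n) - Bad n" using \<omega> good by (auto simp: points_def bad_from_def)
  ultimately show ?thesis unfolding patterns_at_def by blast
qed

lemma finite_patterns_at: "finite (patterns_at n)"
  unfolding patterns_at_def using F(1) by auto

lemma card_patterns_at: "card (patterns_at n) \<le> exp ((1 / 4) ^ n * real (card (B n)))"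
  unfolding patterns_at_def by (rule patterns)

text \<open>Approximate each cell by a condition on coordinate \<open>m\<close> and let \<psi> pick
  an index whose condition holds. Where all approximations are correct, exactly one condition holds
  and it names the right cell, so the error is at most the sum of \<open>card I\<close> errors of
  size \<open>e / card I\<close>.\<close>

lemma ex_level_approximation:
  fixes p :: "(nat \<Rightarrow> 'a) \<Rightarrow> 'l" and e :: real
  assumes I: "finite I" "I \<noteq> {}" and p: "\<And>\<omega>. \<omega> \<in> points \<Longrightarrow> p \<omega> \<in> I"
    and meas: "\<And>i. i \<in> I \<Longrightarrow> {\<omega>\<in>points. p \<omega> = i} \<in> sets N" and e: "0 < e"
  shows "\<exists>n. \<forall>m\<ge>n. \<exists>\<psi>. (\<forall>x. \<psi> x \<in> I) \<and> {\<omega>\<in>points. p \<omega> \<noteq> \<psi> (\<omega> m)} \<in> sets N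
     \<and> N.prob {\<omega>\<in>points. p \<omega> \<noteq> \<psi> (\<omega> m)} \<le> e"
proof -
  define e' where "e' = e / card I"
  have cI: "0 < real (card I)" using I by (simp add: card_gt_0_iff)
  have e': "0 < e'" using e cI by (simp add: e'_def)
  let ?X = "\<lambda>i. {\<omega>\<in>points. p \<omega> = i}"
  have "\<forall>i\<in>I. \<exists>n. \<forall>m\<ge>n. \<exists>A. N.prob (sym_diff (?X i) {\<omega>\<in>points. \<omega> m \<in> A}) < e'"
    using approx_cylinder[OF meas e'] by blast
  then have "\<exists>n. \<forall>i\<in>I. \<forall>m\<ge>n i. \<exists>A. N.prob (sym_diff (?X i) {\<omega>\<in>points. \<omega> m \<in> A}) < e'"
    by (rule bchoice)
  then obtain n where n: "\<forall>i\<in>I. \<forall>m\<ge>n i. \<exists>A. N.prob (sym_diff (?X i) {\<omega>\<in>points. \<omega> m \<in> A}) < e'"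
    by (elim exE)
  define L where "L = (\<Sum>i\<in>I. n i)"
  have "\<exists>\<psi>. (\<forall>x. \<psi> x \<in> I) \<and> {\<omega>\<in>points. p \<omega> \<noteq> \<psi> (\<omega> m)} \<in> sets N
     \<and> N.prob {\<omega>\<in>points. p \<omega> \<noteq> \<psi> (\<omega> m)} \<le> e" if m: "L \<le> m" for m
  proof -
    have "n i \<le> m" if "i \<in> I" for i
      using m member_le_sum[of i I n] that I by (simp add: L_def)
    then have "\<forall>i\<in>I. \<exists>A. N.prob (sym_diff (?X i) {\<omega>\<in>points. \<omega> m \<in> A}) < e'" using n by blast
    then have "\<exists>A. \<forall>i\<in>I. N.prob (sym_diff (?X i) {\<omega>\<in>points. \<omega> m \<in> A i}) < e'" by (rule bchoice)
    then obtain A where A: "\<forall>i\<in>I. N.prob (sym_diff (?X i) {\<omega>\<in>points. \<omega> m \<in> A i}) < e'" by (elim exE)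
    obtain i0 where i0: "i0 \<in> I" using I by auto
    define \<psi> where "\<psi> x = (if \<exists>i\<in>I. x \<in> A i then SOME i. i \<in> I \<and> x \<in> A i else i0)" for x
    have \<psi>: "\<psi> x \<in> I" "\<exists>i\<in>I. x \<in> A i \<Longrightarrow> x \<in> A (\<psi> x)" for x
    proof -
      have "(SOME i. i \<in> I \<and> x \<in> A i) \<in> I \<and> x \<in> A (SOME i. i \<in> I \<and> x \<in> A i)" if "\<exists>i\<in>I. x \<in> A i"
        using that by (intro someI_ex[of "\<lambda>i. i \<in> I \<and> x \<in> A i"]) blast
      then show "\<psi> x \<in> I" "\<exists>i\<in>I. x \<in> A i \<Longrightarrow> x \<in> A (\<psi> x)" using i0 by (simp_all add: \<psi>_def)
    qed
    let ?Z = "{\<omega>\<in>points. p \<omega> \<noteq> \<psi> (\<omega> m)}"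
    have "?Z = (\<Union>i\<in>I. ?X i \<inter> {\<omega>\<in>points. \<omega> m \<in> {x. \<psi> x \<noteq> i}})" using p by auto
    also have "\<dots> \<in> sets N" by (intro sets.finite_UN sets.Int meas cylinder_sets I(1))
    finally have Z: "?Z \<in> sets N" .
    have sd: "sym_diff (?X i) {\<omega>\<in>points. \<omega> m \<in> A i} \<in> sets N" if "i \<in> I" for i
      using meas[OF that] cylinder_sets by (intro sets.Un sets.Diff) auto
    have "?Z \<subseteq> (\<Union>i\<in>I. sym_diff (?X i) {\<omega>\<in>points. \<omega> m \<in> A i})"
    proof (rule subsetI, rule ccontr)
      fix \<omega> assume \<omega>: "\<omega> \<in> ?Z" and no: "\<omega> \<notin> (\<Union>i\<in>I. sym_diff (?X i) {\<omega>\<in>points. \<omega> m \<in> A i})"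
      have iff: "p \<omega> = i \<longleftrightarrow> \<omega> m \<in> A i" if "i \<in> I" for i
      proof -
        have "\<omega> \<notin> sym_diff (?X i) {\<omega>\<in>points. \<omega> m \<in> A i}" using no that by blast
        then show ?thesis using \<omega> by blast
      qed
      have "\<omega> m \<in> A (p \<omega>)" using iff[of "p \<omega>"] p \<omega> by blast
      then have "\<omega> m \<in> A (\<psi> (\<omega> m))" using \<psi>(2) p \<omega> by blast
      then show False using iff[OF \<psi>(1)] \<omega> by blast
    qed
    then have "N.prob ?Z \<le> N.prob (\<Union>i\<in>I. sym_diff (?X i) {\<omega>\<in>points. \<omega> m \<in> A i})"
      using sd I by (intro N.finite_measure_mono sets.finite_UN) auto
    also have "\<dots> \<le> (\<Sum>i\<in>I. N.prob (sym_diff (?X i) {\<omega>\<in>points. \<omega> m \<in> A i}))"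
      using sd I by (intro measure_UNION_le) auto
    also have "\<dots> \<le> (\<Sum>i\<in>I. e')" using A by (intro sum_mono less_imp_le) blast
    also have "\<dots> = e" using cI by (simp add: e'_def)
    finally show ?thesis using Z \<psi>(1) by blast
  qed
  then show ?thesis by blast
qed

lemma T_vimage_event:
  assumes "g \<in> carrier G" "X \<in> sets N"
  shows "{\<omega>\<in>points. T g \<omega> \<in> X} \<in> sets N"
proof -
  have "T g -` X \<inter> space N \<in> sets N" by (rule measurable_sets[OF T_measurable[OF assms(1)] assms(2)])
  also have "T g -` X \<inter> space N = {\<omega>\<in>points. T g \<omega> \<in> X}" by auto
  finally show ?thesis .
qed

lemma bad_points_sets: "points \<inter> bad_from n \<in> sets N"
  using bad_from_sets points_sets by (simp add: sets_N_iff sets.Int)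

lemma prob_bad_points: "N.prob (points \<inter> bad_from n) \<le> 6 * (1 / 2) ^ n"
proof -
  have "N.prob (points \<inter> bad_from n) = prob (points \<inter> bad_from n)" by (rule measure_N) auto
  also have "\<dots> \<le> prob (bad_from n)" by (intro finite_measure_mono bad_from_sets) auto
  finally show ?thesis using prob_bad_from[of n] by linarith
qed

text \<open>Zero entropy is a count of names. Almost every window of shape \<open>B n\<close> shows one of few
  patterns, few such windows cover almost all of \<open>D\<close>, and the names therefore lie in few Hamming
  balls of small radius.\<close>

lemma few_names:
  fixes p :: "(nat \<Rightarrow> 'a) \<Rightarrow> 'l" and \<eta> :: real
  assumes I: "finite I" "I \<noteq> {}" and p: "\<And>\<omega>. \<omega> \<in> points \<Longrightarrow> p \<omega> \<in> I"
    and meas: "\<And>i. i \<in> I \<Longrightarrow> {\<omega>\<in>points. p \<omega> = i} \<in> sets N" and \<eta>: "0 < \<eta>"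
  shows "\<exists>Q \<delta>. finite Q \<and> Q \<subseteq> carrier G \<and> (0::real) < \<delta> \<and> (\<forall>D. almost_inv Q \<delta> D \<longrightarrow>
    (\<exists>\<N> X. \<N> \<subseteq> D \<rightarrow>\<^sub>E I \<and> card \<N> \<le> exp (\<eta> * real (card D)) \<and> X \<in> sets N \<and> N.prob X \<le> \<eta>
       \<and> (\<forall>\<omega>\<in>points - X. (\<lambda>g\<in>D. p (T g \<omega>)) \<in> \<N>)))"
proof -
  obtain \<kappa> :: real where \<kappa>: "0 < \<kappa>" "\<kappa> \<le> 1" "\<kappa> * ln (1 / \<kappa>) + \<kappa> * card I \<le> \<eta> / 2"
    using ex_small_entropy_radius[of "\<eta> / 2" "card I"] \<eta> by auto
  \<comment> \<open>Three quarters of the radius \<kappa> are spent: on uncovered points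
    (\<open>2 * \<beta> = \<kappa> / 4\<close>), on points in bad windows (threshold
    \<open>r1\<close>) and on points where the approximation at level \<open>n\<close> fails
    (threshold \<open>r2\<close>). The choice of \<open>e\<close> makes
    \<open>e * card D / r2\<close> equal to \<open>\<eta> / 2\<close>.\<close>
  define \<beta> where "\<beta> = \<kappa> / 8"
  have \<beta>: "0 < \<beta>" "\<beta> \<le> 1" using \<kappa> by (auto simp: \<beta>_def)
  define e where "e = \<eta> * \<kappa> / 8"
  have e: "0 < e" using \<eta> \<kappa> by (simp add: e_def)
  obtain n0 where n0: "\<forall>m\<ge>n0. \<exists>\<psi>. (\<forall>x. \<psi> x \<in> I) \<and> {\<omega>\<in>points. p \<omega> \<noteq> \<psi> (\<omega> m)} \<in> sets N
     \<and> N.prob {\<omega>\<in>points. p \<omega> \<noteq> \<psi> (\<omega> m)} \<le> e"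
  proof -
    have "\<exists>n. \<forall>m\<ge>n. \<exists>\<psi>. (\<forall>x. \<psi> x \<in> I) \<and> {\<omega>\<in>points. p \<omega> \<noteq> \<psi> (\<omega> m)} \<in> sets N
     \<and> N.prob {\<omega>\<in>points. p \<omega> \<noteq> \<psi> (\<omega> m)} \<le> e"
      by (rule ex_level_approximation[where p = p and I = I]) (fact I p meas e)+
    then show thesis using that by (elim exE)
  qed
  \<comment> \<open>The first bound provides a point outside \<open>bad_from n\<close>, hence a
    pattern. The second, with \<open>card C / r1 \<le> 1024 / \<kappa>\<^sup>2\<close>, gives many
    bad windows probability at most \<open>\<eta> / 2\<close>. The third limits the choices of
    patterns at all centers to \<open>exp (\<eta> / 2 * card D)\<close>.\<close>
  define \<zeta> where "\<zeta> = min (1 / 12) (min (\<eta> * \<kappa>\<^sup>2 / 2048 / 6) (\<eta> * \<beta> / 64))"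
  have "0 < \<zeta>" using \<eta> \<kappa> \<beta> by (simp add: \<zeta>_def)
  then obtain n1 where n1: "(1 / 2 :: real) ^ n1 < \<zeta>" using real_arch_pow_inv[of \<zeta> "1 / 2"] by auto
  define n where "n = max n0 n1"
  have half_n: "(1 / 2 :: real) ^ n \<le> \<zeta>"
  proof -
    have "(1 / 2 :: real) ^ n \<le> (1 / 2) ^ n1" by (rule power_decreasing) (auto simp: n_def)
    then show ?thesis using n1 by linarith
  qed
  have quarter_n: "(1 / 4 :: real) ^ n \<le> \<eta> * \<beta> / 64"
  proof -
    have "(1 / 4 :: real) ^ n \<le> (1 / 2) ^ n" by (intro power_mono) auto
    then show ?thesis using half_n by (simp add: \<zeta>_def)
  qed
  have bad_n: "6 * (1 / 2 :: real) ^ n \<le> \<eta> * \<kappa>\<^sup>2 / 2048" using half_n by (simp add: \<zeta>_def)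
  have pat_ne: "patterns_at n \<noteq> {}"
  proof -
    have "N.prob (points \<inter> bad_from n) \<noteq> 1" using prob_bad_points[of n] half_n by (simp add: \<zeta>_def)
    then have "points \<inter> bad_from n \<noteq> points" using N.prob_space by auto
    then obtain \<omega> where "\<omega> \<in> points" "\<omega> \<notin> bad_from n" by blast
    then show ?thesis using window_in_patterns by blast
  qed
  obtain \<psi> where \<psi>: "\<And>x. \<psi> x \<in> I" "{\<omega>\<in>points. p \<omega> \<noteq> \<psi> (\<omega> n)} \<in> sets N"
    "N.prob {\<omega>\<in>points. p \<omega> \<noteq> \<psi> (\<omega> n)} \<le> e"
  proof -
    have "n0 \<le> n" by (simp add: n_def)
    with n0 have "\<exists>\<psi>. (\<forall>x. \<psi> x \<in> I) \<and> {\<omega>\<in>points. p \<omega> \<noteq> \<psi> (\<omega> n)} \<in> sets N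
      \<and> N.prob {\<omega>\<in>points. p \<omega> \<noteq> \<psi> (\<omega> n)} \<le> e" by blast
    then show thesis using that by (elim exE conjE) blast
  qed
  let ?B = "B n"
  let ?Z = "{\<omega>\<in>points. p \<omega> \<noteq> \<psi> (\<omega> n)}" and ?W = "points \<inter> bad_from n"
  have Bp: "finite ?B" "?B \<noteq> {}" "?B \<subseteq> carrier G" using B[of n] K_sub[of "Suc n"] by blast+
  have cB: "0 < real (card ?B)" using Bp by (simp add: card_gt_0_iff)
  have "\<exists>\<N> X. \<N> \<subseteq> D \<rightarrow>\<^sub>E I \<and> card \<N> \<le> exp (\<eta> * real (card D)) \<and> X \<in> sets N \<and> N.prob X \<le> \<eta>
       \<and> (\<forall>\<omega>\<in>points - X. (\<lambda>g\<in>D. p (T g \<omega>)) \<in> \<N>)"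
    if D: "almost_inv (m_inv G ` ?B) (1 / card ?B) D" for D
  proof -
    have Dp: "finite D" "D \<noteq> {}" "D \<subseteq> carrier G" using D by (auto simp: almost_inv_def)
    have cD: "0 < real (card D)" using Dp by (simp add: card_gt_0_iff)
    obtain C a where C: "finite C" "C \<subseteq> carrier G" "card C \<le> 32 / (\<beta> * card ?B) * card D"
      and none: "card {g\<in>D. a g = None} \<le> 2 * \<beta> * card D"
      and a: "\<And>g c. a g = Some c \<Longrightarrow> c \<in> C \<and> g \<otimes> inv c \<in> ?B"
      by (rule ex_window_cover[OF Bp \<beta> D]) (rule that; assumption)
    \<comment> \<open>The name predicted from the patterns \<sigma> at the centers. At uncovered
      points any value in \<open>I\<close> will do, since all of them are counted as errors.\<close>
    define model where "model \<sigma> g = (case a g of None \<Rightarrow> \<psi> undefined | Some c \<Rightarrow> \<psi> (\<sigma> c (g \<otimes> inv c)))" for \<sigma> g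
    define ball where "ball \<sigma> = {f \<in> D \<rightarrow>\<^sub>E I. card {d\<in>D. f d \<noteq> model \<sigma> d} \<le> \<kappa> * card D}" for \<sigma>
    define \<N> where "\<N> = (\<Union>\<sigma>\<in>C \<rightarrow>\<^sub>E patterns_at n. ball \<sigma>)"
    define r1 where "r1 = \<kappa> / 4 * card D / card ?B"
    define r2 where "r2 = \<kappa> / 4 * card D"
    have r: "0 < r1" "0 < r2" using \<kappa> cD cB by (auto simp: r1_def r2_def)
    define X1 where "X1 = {\<omega>\<in>space N. r1 < card {c\<in>C. \<omega> \<in> {\<omega>\<in>points. T c \<omega> \<in> ?W}}}"
    define X2 where "X2 = {\<omega>\<in>space N. r2 < card {g\<in>D. \<omega> \<in> {\<omega>\<in>points. T g \<omega> \<in> ?Z}}}"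
    have ev1: "{\<omega>\<in>points. T c \<omega> \<in> ?W} \<in> sets N" "N.prob {\<omega>\<in>points. T c \<omega> \<in> ?W} \<le> \<eta> * \<kappa>\<^sup>2 / 2048" if "c \<in> C" for c
    proof -
      have c: "c \<in> carrier G" using that C by blast
      show "{\<omega>\<in>points. T c \<omega> \<in> ?W} \<in> sets N" by (rule T_vimage_event[OF c bad_points_sets])
      show "N.prob {\<omega>\<in>points. T c \<omega> \<in> ?W} \<le> \<eta> * \<kappa>\<^sup>2 / 2048"
        unfolding prob_T_vimage[OF c bad_points_sets] using prob_bad_points[of n] bad_n by (rule order_trans)
    qed
    have ev2: "{\<omega>\<in>points. T g \<omega> \<in> ?Z} \<in> sets N" "N.prob {\<omega>\<in>points. T g \<omega> \<in> ?Z} \<le> e" if "g \<in> D" for g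
    proof -
      have g: "g \<in> carrier G" using that Dp by blast
      show "{\<omega>\<in>points. T g \<omega> \<in> ?Z} \<in> sets N" by (rule T_vimage_event[OF g \<psi>(2)])
      show "N.prob {\<omega>\<in>points. T g \<omega> \<in> ?Z} \<le> e" unfolding prob_T_vimage[OF g \<psi>(2)] by (rule \<psi>(3))
    qed
    have X1: "X1 \<in> sets N" "N.prob X1 \<le> \<eta> * \<kappa>\<^sup>2 / 2048 * card C / r1"
      unfolding X1_def by (rule N.prob_count_le[OF C(1) ev1 r(1)], assumption+)+
    have X2: "X2 \<in> sets N" "N.prob X2 \<le> e * card D / r2"
      unfolding X2_def by (rule N.prob_count_le[OF Dp(1) ev2 r(2)], assumption+)+
    have "N.prob X1 \<le> \<eta> / 2"
    proof -
      have "\<eta> * \<kappa>\<^sup>2 / 2048 * card C / r1 \<le> \<eta> * \<kappa>\<^sup>2 / 2048 * (32 / (\<beta> * card ?B) * card D) / r1"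
        using C(3) \<eta> r by (intro divide_right_mono mult_left_mono) auto
      also have "\<dots> = \<eta> / 2"
        using \<kappa> cB cD by (simp add: r1_def \<beta>_def field_simps power2_eq_square)
      finally show ?thesis using X1 by linarith
    qed
    moreover have "N.prob X2 \<le> \<eta> / 2"
      using X2(2) \<kappa> cD by (simp add: r2_def e_def)
    ultimately have prob_X: "N.prob (X1 \<union> X2) \<le> \<eta>"
      using measure_Un_le[OF X1(1) X2(1)] by linarith
    have mem: "(\<lambda>g\<in>D. p (T g \<omega>)) \<in> \<N>" if \<omega>: "\<omega> \<in> points - (X1 \<union> X2)" for \<omega>
    proof -
      have \<omega>p: "\<omega> \<in> points" using \<omega> by simp
      let ?C' = "{c\<in>C. T c \<omega> \<in> ?W}" and ?D' = "{g\<in>D. T g \<omega> \<in> ?Z}"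
      have c1: "card ?C' \<le> r1" and c2: "card ?D' \<le> r2"
        using \<omega> by (auto simp: X1_def X2_def not_less)
      \<comment> \<open>A bad window is given an arbitrary pattern; all its points are counted as
        errors.\<close>
      define s where "s = (SOME s. s \<in> patterns_at n)"
      define \<sigma> where "\<sigma> = (\<lambda>c\<in>C. if T c \<omega> \<in> ?W then s else window n (T c \<omega>))"
      have s: "s \<in> patterns_at n" unfolding s_def using pat_ne by (intro someI_ex[of "\<lambda>s. s \<in> patterns_at n"]) blast
      have "\<sigma> \<in> C \<rightarrow>\<^sub>E patterns_at n"
        using s C T_points[OF \<omega>p] window_in_patterns by (auto simp: \<sigma>_def subset_eq)
      moreover have "(\<lambda>g\<in>D. p (T g \<omega>)) \<in> ball \<sigma>"
      proof -
        let ?f = "\<lambda>g\<in>D. p (T g \<omega>)"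
        have "{d\<in>D. ?f d \<noteq> model \<sigma> d} \<subseteq> {g\<in>D. a g = None} \<union> (?D' \<union> (\<lambda>(b, c). b \<otimes> c) ` (?B \<times> ?C'))"
        proof
          fix g assume g: "g \<in> {d\<in>D. ?f d \<noteq> model \<sigma> d}"
          then have gD: "g \<in> D" and ne: "p (T g \<omega>) \<noteq> model \<sigma> g" by auto
          have gG: "g \<in> carrier G" using gD Dp by auto
          show "g \<in> {g\<in>D. a g = None} \<union> (?D' \<union> (\<lambda>(b, c). b \<otimes> c) ` (?B \<times> ?C'))"
          proof (cases "a g")
            case None
            then show ?thesis using gD by simp
          next
            case (Some c)
            then have c: "c \<in> C" "g \<otimes> inv c \<in> ?B" using a by auto
            have cG: "c \<in> carrier G" using c C by auto
            have bG: "g \<otimes> inv c \<in> carrier G" using gG cG by simp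
            have gc: "g \<otimes> inv c \<otimes> c = g" using gG cG by (simp add: m_assoc)
            show ?thesis
            proof (cases "T c \<omega> \<in> ?W")
              case True
              then have "(g \<otimes> inv c, c) \<in> ?B \<times> ?C'" using c by blast
              then have "g \<in> (\<lambda>(b, c). b \<otimes> c) ` (?B \<times> ?C')" using gc by (intro image_eqI[of _ _ "(g \<otimes> inv c, c)"]) auto
              then show ?thesis by blast
            next
              case False
              \<comment> \<open>The window at \<open>c\<close> shows the position of
                \<open>g\<close> itself, as \<open>g\<close> is
                \<open>g \<otimes> inv c \<otimes> c\<close>. A wrong prediction therefore means
                that the approximation by \<psi> fails at \<open>g\<close>.\<close>
              have "model \<sigma> g = \<psi> (window n (T c \<omega>) (g \<otimes> inv c))"
                by (simp only: model_def \<sigma>_def Some option.case restrict_apply c(1) if_True False if_False)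
              also have "window n (T c \<omega>) (g \<otimes> inv c) = T g \<omega> n"
                using c(2) T_mult[OF \<omega>p cG bG] gc by (simp add: window_def)
              finally have "T g \<omega> \<in> ?Z" using ne T_points[OF \<omega>p gG] by simp
              then show ?thesis using gD by blast
            qed
          qed
        qed
        then have "card {d\<in>D. ?f d \<noteq> model \<sigma> d} \<le> card ({g\<in>D. a g = None} \<union> (?D' \<union> (\<lambda>(b, c). b \<otimes> c) ` (?B \<times> ?C')))"
          using Dp Bp C by (intro card_mono) auto
        also have "\<dots> \<le> card {g\<in>D. a g = None} + (card ?D' + card ((\<lambda>(b, c). b \<otimes> c) ` (?B \<times> ?C')))"
          by (intro order_trans[OF card_Un_le] add_mono order_refl card_Un_le)
        also have "\<dots> \<le> card {g\<in>D. a g = None} + (card ?D' + card ?B * card ?C')"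
          using card_image_le[of "?B \<times> ?C'" "\<lambda>(b, c). b \<otimes> c"] Bp C by (simp add: card_cartesian_product)
        finally have "real (card {d\<in>D. ?f d \<noteq> model \<sigma> d}) \<le> card {g\<in>D. a g = None} + (card ?D' + card ?B * real (card ?C'))"
          by (simp flip: of_nat_add of_nat_mult)
        moreover have "card ?B * real (card ?C') \<le> \<kappa> / 4 * card D"
        proof -
          have "card ?B * real (card ?C') \<le> card ?B * r1" using c1 by (intro mult_left_mono) auto
          also have "\<dots> = \<kappa> / 4 * card D" using cB by (simp add: r1_def)
          finally show ?thesis .
        qed
        moreover have "card {g\<in>D. a g = None} \<le> \<kappa> / 4 * card D" using none by (simp add: \<beta>_def)
        moreover have "0 \<le> \<kappa> * card D" using \<kappa> by simp
        ultimately have "card {d\<in>D. ?f d \<noteq> model \<sigma> d} \<le> \<kappa> * card D" using c2 unfolding r2_def by linarith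
        moreover have "?f \<in> D \<rightarrow>\<^sub>E I" using p T_points[OF \<omega>p] Dp by auto
        ultimately show ?thesis by (simp add: ball_def)
      qed
      ultimately show ?thesis unfolding \<N>_def by blast
    qed
    have card_\<N>: "card \<N> \<le> exp (\<eta> * real (card D))"
    proof -
      have finS: "finite (C \<rightarrow>\<^sub>E patterns_at n)" using C finite_patterns_at by (intro finite_PiE) auto
      have "card \<N> \<le> (\<Sum>\<sigma>\<in>C \<rightarrow>\<^sub>E patterns_at n. card (ball \<sigma>))" unfolding \<N>_def by (rule card_UN_le[OF finS])
      then have "real (card \<N>) \<le> (\<Sum>\<sigma>\<in>C \<rightarrow>\<^sub>E patterns_at n. real (card (ball \<sigma>)))" by (simp flip: of_nat_sum)
      also have "\<dots> \<le> (\<Sum>\<sigma>\<in>C \<rightarrow>\<^sub>E patterns_at n. exp (\<eta> / 2 * card D))"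
      proof (rule sum_mono)
        fix \<sigma>
        have "real (card (ball \<sigma>)) \<le> exp (\<kappa> * card D * ln (1 / \<kappa>) + \<kappa> * card I * card D)"
          unfolding ball_def by (rule hamming_ball_card_le(2)[OF Dp(1) I(1) \<kappa>(1,2)])
        also have "\<dots> = exp ((\<kappa> * ln (1 / \<kappa>) + \<kappa> * card I) * card D)" by (simp add: algebra_simps)
        also have "\<dots> \<le> exp (\<eta> / 2 * card D)" using \<kappa>(3) by (simp only: exp_le_cancel_iff) (intro mult_right_mono, auto)
        finally show "real (card (ball \<sigma>)) \<le> exp (\<eta> / 2 * card D)" .
      qed
      also have "\<dots> = real (card (patterns_at n)) ^ card C * exp (\<eta> / 2 * card D)"
        using C by (simp add: card_PiE)
      also have "\<dots> \<le> exp ((1 / 4) ^ n * real (card ?B)) ^ card C * exp (\<eta> / 2 * card D)"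
        using card_patterns_at by (intro mult_right_mono power_mono) auto
      also have "\<dots> = exp (card C * ((1 / 4) ^ n * real (card ?B)) + \<eta> / 2 * card D)"
        by (simp add: exp_add exp_of_nat_mult)
      also have "\<dots> \<le> exp (\<eta> * card D)"
      proof -
        have "card C * ((1 / 4) ^ n * real (card ?B)) \<le> (32 / (\<beta> * card ?B) * card D) * ((\<eta> * \<beta> / 64) * real (card ?B))"
          using C(3) quarter_n \<eta> \<beta> by (intro mult_mono) auto
        also have "\<dots> = \<eta> / 2 * card D" using \<beta> cB by simp
        finally show ?thesis unfolding exp_le_cancel_iff by simp
      qed
      finally show ?thesis .
    qed
    have "\<N> \<subseteq> D \<rightarrow>\<^sub>E I" by (auto simp: \<N>_def ball_def)
    then show ?thesis
      using card_\<N> X1(1) X2(1) prob_X mem by (intro exI[of _ \<N>] exI[of _ "X1 \<union> X2"]) auto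
  qed
  moreover have "finite (m_inv G ` ?B)" "m_inv G ` ?B \<subseteq> carrier G" "0 < 1 / real (card ?B)"
    using Bp cB by auto
  ultimately show ?thesis by blast
qed

end

context tiling_system
begin

text \<open>Labelling a point by the cell \<open>p \<omega>\<close> of its order turns the partition
  of the orders into one of \<open>points\<close>. Names under \<open>order_action\<close> agree
  almost everywhere with names of \<open>p\<close> under \<open>T\<close>, to which
  \<open>few_names\<close> applies.\<close>

lemma entropy_rate_zero:
  assumes P: "measurable_partition \<nu> P" and Fs: "folner_sequence G Fs"
  shows "(\<lambda>k. partition_entropy \<nu> (iterated_partition \<nu> (order_action G) P (Fs k)) / real (card (Fs k))) \<longlonglongrightarrow> 0"
proof -
  interpret \<nu>: prob_space \<nu> by (rule prob_space_\<nu>)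
  have finP: "finite P" and P_sets: "P \<subseteq> sets \<nu>" and part: "partition_on (Z_orders G) P"
    using P by (auto simp: measurable_partition_def space_\<nu>)
  have Z: "Z_order_of \<omega> \<in> Z_orders G" for \<omega>
    using order_of_Z_orders some_typical by (simp add: Z_order_of_def)
  have ex1: "\<exists>A\<in>P. f \<in> A" if "f \<in> Z_orders G" for f
    using that part by (auto simp: partition_on_def)
  have uniq: "A = A'" if "A \<in> P" "A' \<in> P" "f \<in> A" "f \<in> A'" for A A' f
    using that part unfolding partition_on_def disjoint_def by blast
  define p where "p \<omega> = (SOME A. A \<in> P \<and> Z_order_of \<omega> \<in> A)" for \<omega>
  have p: "p \<omega> \<in> P" "Z_order_of \<omega> \<in> p \<omega>" for \<omega>
    using someI_ex[of "\<lambda>A. A \<in> P \<and> Z_order_of \<omega> \<in> A"] ex1[OF Z] unfolding p_def by blast+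
  have p_iff: "p \<omega> = A \<longleftrightarrow> Z_order_of \<omega> \<in> A" if "A \<in> P" for A \<omega>
    using uniq[OF that p(1)] p(2)[of \<omega>] by blast
  have "P \<noteq> {}" using p(1) by blast
  have vim: "{\<omega>\<in>points. Z_order_of \<omega> \<in> A} \<in> sets N" if "A \<in> sets \<nu>" for A
  proof -
    have "A \<in> sets (Z_orders_borel G)" using that unfolding sets_\<nu> .
    then have "Z_order_of -` A \<inter> space N \<in> sets N" by (rule measurable_sets[OF Z_order_of_measurable])
    also have "Z_order_of -` A \<inter> space N = {\<omega>\<in>points. Z_order_of \<omega> \<in> A}" by auto
    finally show ?thesis .
  qed
  have meas: "{\<omega>\<in>points. p \<omega> = A} \<in> sets N" if "A \<in> P" for A
    unfolding p_iff[OF that] using vim that P_sets by blast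
  have Fsp: "finite (Fs k)" "Fs k \<noteq> {}" "Fs k \<subseteq> carrier G" for k using Fs by (auto simp: folner_sequence_def)
  have bound: "partition_entropy \<nu> (iterated_partition \<nu> (order_action G) P D) \<le> \<eta> * card D + \<eta> * card D * ln (card P) + 2"
    if D: "finite D" "D \<noteq> {}" "D \<subseteq> carrier G" and \<eta>: "0 < \<eta>"
      and \<N>: "\<N> \<subseteq> D \<rightarrow>\<^sub>E P" "card \<N> \<le> exp (\<eta> * real (card D))" and X: "X \<in> sets N" "N.prob X \<le> \<eta>"
      and names: "\<forall>\<omega>\<in>points - X. (\<lambda>g\<in>D. p (T g \<omega>)) \<in> \<N>" for D \<N> X and \<eta> :: real
  proof (rule partition_entropy_iterated_le[OF prob_space_\<nu> P D(1,2) _ \<N>])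
    show "order_action G g \<in> \<nu> \<rightarrow>\<^sub>M \<nu>" if "g \<in> D" for g
      using that D(3) by (intro order_action_\<nu>_measurable) auto
    show "0 \<le> \<eta> * real (card D)" "0 \<le> \<eta>" using \<eta> by auto
    let ?E = "names_event \<nu> (order_action G) D" and ?\<Pi> = "D \<rightarrow>\<^sub>E P"
    let ?Y = "\<lambda>f. {\<omega>\<in>points. (\<lambda>g\<in>D. p (T g \<omega>)) = f}"
    have Y: "?Y f \<in> sets N" if "f \<in> ?\<Pi>" for f
    proof -
      have "?Y f = (\<Inter>g\<in>D. {\<omega>\<in>points. T g \<omega> \<in> {\<omega>\<in>points. p \<omega> = f g}})"
      proof (intro equalityI subsetI)
        fix \<omega> assume "\<omega> \<in> ?Y f"
        then show "\<omega> \<in> (\<Inter>g\<in>D. {\<omega>\<in>points. T g \<omega> \<in> {\<omega>\<in>points. p \<omega> = f g}})"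
          using T_points D(3) by auto
      next
        fix \<omega> assume \<omega>: "\<omega> \<in> (\<Inter>g\<in>D. {\<omega>\<in>points. T g \<omega> \<in> {\<omega>\<in>points. p \<omega> = f g}})"
        then have "\<omega> \<in> points" "\<And>g. g \<in> D \<Longrightarrow> p (T g \<omega>) = f g" using D(2) by auto
        moreover have "(\<lambda>g\<in>D. f g) = f" using that by (simp add: PiE_restrict)
        ultimately show "\<omega> \<in> ?Y f" by (auto cong: restrict_cong)
      qed
      also have "\<dots> \<in> sets N"
        using that D(3) by (intro sets.finite_INT[OF D(1,2)] T_vimage_event meas) auto
      finally show ?thesis .
    qed
    have E_sets: "?E f \<in> sets \<nu>" if "f \<in> ?\<Pi>" for f
    proof -
      have "?E f = (\<Inter>g\<in>D. order_action G g -` f g \<inter> space \<nu>)" using D(2) unfolding names_event_def by blast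
      also have "\<dots> \<in> sets \<nu>"
        using that P_sets D(3) by (intro sets.finite_INT[OF D(1,2)] measurable_sets[OF order_action_\<nu>_measurable]) auto
      finally show ?thesis .
    qed
    have E_eq: "measure \<nu> (?E f) = N.prob (?Y f)" if f: "f \<in> ?\<Pi>" for f
      unfolding measure_\<nu>[OF E_sets[OF f]]
    proof (rule N.finite_measure_eq_AE)
      show "{\<omega>\<in>points. Z_order_of \<omega> \<in> ?E f} \<in> sets N" by (rule vim[OF E_sets[OF f]])
      show "?Y f \<in> sets N" by (rule Y[OF f])
      show "AE \<omega> in N. (\<omega> \<in> {\<omega>\<in>points. Z_order_of \<omega> \<in> ?E f}) = (\<omega> \<in> ?Y f)"
        using AE_typical
      proof eventually_elim
        case (elim \<omega>)
        then have \<omega>: "\<omega> \<in> points" by (simp add: typical_def)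
        have "order_action G g (Z_order_of \<omega>) \<in> f g \<longleftrightarrow> p (T g \<omega>) = f g" if "g \<in> D" for g
        proof -
          have g: "g \<in> carrier G" "f g \<in> P" using that D(3) f by auto
          have "order_action G g (Z_order_of \<omega>) = Z_order_of (T g \<omega>)"
            using Z_order_of_typical[OF elim] Z_order_of_typical[OF T_typical[OF elim g(1)]] order_of_T[OF \<omega> g(1)] by simp
          then show ?thesis using p_iff[OF g(2), of "T g \<omega>"] by simp
        qed
        then have "Z_order_of \<omega> \<in> ?E f \<longleftrightarrow> (\<forall>g\<in>D. p (T g \<omega>) = f g)"
          using Z[of \<omega>] unfolding names_event_def space_\<nu> by blast
        also have "\<dots> \<longleftrightarrow> (\<lambda>g\<in>D. p (T g \<omega>)) = f"
        proof
          assume "\<forall>g\<in>D. p (T g \<omega>) = f g"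
          then have "(\<lambda>g\<in>D. p (T g \<omega>)) = restrict f D" by (intro restrict_ext) simp
          then show "(\<lambda>g\<in>D. p (T g \<omega>)) = f" using f by (simp add: PiE_restrict)
        qed auto
        finally show ?case using \<omega> by blast
      qed
    qed
    have fin: "finite (?\<Pi> - \<N>)" using finite_PiE[of D "\<lambda>_. P"] D finP by blast
    have "(\<Sum>f\<in>?\<Pi> - \<N>. measure \<nu> (?E f)) = (\<Sum>f\<in>?\<Pi> - \<N>. N.prob (?Y f))"
      using E_eq by (intro sum.cong) auto
    also have "\<dots> = N.prob (\<Union>f\<in>?\<Pi> - \<N>. ?Y f)"
      using Y by (intro N.finite_measure_finite_Union[OF fin, symmetric]) (auto simp: disjoint_family_on_def)
    also have "\<dots> \<le> N.prob X"
      using names X(1) by (intro N.finite_measure_mono) auto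
    finally show "(\<Sum>f\<in>?\<Pi> - \<N>. measure \<nu> (?E f)) \<le> \<eta>" using X(2) by linarith
  qed
  have upper: "\<forall>\<^sub>F k in sequentially. partition_entropy \<nu> (iterated_partition \<nu> (order_action G) P (Fs k)) / real (card (Fs k)) \<le> e"
    if e: "0 < e" for e :: real
  proof -
    define l where "l = ln (card P)"
    have l: "0 \<le> l" using finP \<open>P \<noteq> {}\<close> by (auto simp: l_def Suc_le_eq card_gt_0_iff intro!: ln_ge_zero)
    \<comment> \<open>The entropy is at most \<open>\<eta> * (1 + l) * card (Fs k) + 2\<close>. The
      first term is made half of \<open>e * card (Fs k)\<close>, and the constant 2 fits into the
      other half once \<open>card (Fs k)\<close> is at least \<open>4 / e\<close>.\<close>
    define \<eta> where "\<eta> = e / 2 / (1 + l)"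
    have ne: "1 + l \<noteq> 0" using l by linarith
    have \<eta>: "0 < \<eta>" using e l by (simp add: \<eta>_def)
    have \<eta>l: "\<eta> * (1 + l) = e / 2"
      unfolding \<eta>_def by (rule nonzero_eq_divide_eq[OF ne, THEN iffD1, OF refl])
    obtain Q \<delta> where Q: "finite Q" "Q \<subseteq> carrier G" "(0::real) < \<delta>" and few: "\<forall>D. almost_inv Q \<delta> D \<longrightarrow>
      (\<exists>\<N> X. \<N> \<subseteq> D \<rightarrow>\<^sub>E P \<and> card \<N> \<le> exp (\<eta> * real (card D)) \<and> X \<in> sets N \<and> N.prob X \<le> \<eta>
       \<and> (\<forall>\<omega>\<in>points - X. (\<lambda>g\<in>D. p (T g \<omega>)) \<in> \<N>))"
    proof -
      have "\<exists>Q \<delta>. finite Q \<and> Q \<subseteq> carrier G \<and> (0::real) < \<delta> \<and> (\<forall>D. almost_inv Q \<delta> D \<longrightarrow>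
        (\<exists>\<N> X. \<N> \<subseteq> D \<rightarrow>\<^sub>E P \<and> card \<N> \<le> exp (\<eta> * real (card D)) \<and> X \<in> sets N \<and> N.prob X \<le> \<eta>
         \<and> (\<forall>\<omega>\<in>points - X. (\<lambda>g\<in>D. p (T g \<omega>)) \<in> \<N>)))"
        by (rule few_names[where p = p and I = P]) (rule finP \<open>P \<noteq> {}\<close> p(1) \<eta> | erule meas)+
      then show thesis by (elim exE conjE) (rule that)
    qed
    have "\<forall>\<^sub>F k in sequentially. almost_inv Q \<delta> (Fs k)" by (rule folner_sequence_almost_inv[OF Fs Q])
    moreover have "\<forall>\<^sub>F k in sequentially. nat \<lceil>4 / e\<rceil> \<le> card (Fs k)"
      by (rule folner_sequence_card[OF Fs infinite_carrier])
    ultimately show ?thesis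
    proof eventually_elim
      case (elim k)
      from few[THEN spec, THEN mp, OF elim(1)]
      obtain \<N> X where NX: "\<N> \<subseteq> Fs k \<rightarrow>\<^sub>E P" "card \<N> \<le> exp (\<eta> * real (card (Fs k)))"
        "X \<in> sets N" "N.prob X \<le> \<eta>" "\<forall>\<omega>\<in>points - X. (\<lambda>g\<in>Fs k. p (T g \<omega>)) \<in> \<N>"
        by (elim exE conjE) (rule that)
      have "partition_entropy \<nu> (iterated_partition \<nu> (order_action G) P (Fs k)) \<le> \<eta> * card (Fs k) + \<eta> * card (Fs k) * l + 2"
        unfolding l_def by (rule bound[OF Fsp \<eta> NX])
      also have "\<dots> = (\<eta> * (1 + l)) * card (Fs k) + 2" by (simp add: algebra_simps)
      also have "\<dots> = e / 2 * card (Fs k) + 2" by (simp only: \<eta>l)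
      finally have "partition_entropy \<nu> (iterated_partition \<nu> (order_action G) P (Fs k)) \<le> e / 2 * card (Fs k) + 2" .
      moreover have "4 / e \<le> card (Fs k)" using elim(2) by linarith
      then have "2 \<le> e / 2 * card (Fs k)" using e by (simp add: field_simps)
      ultimately have "partition_entropy \<nu> (iterated_partition \<nu> (order_action G) P (Fs k)) \<le> e * card (Fs k)"
        by simp
      moreover have "0 < real (card (Fs k))" using Fsp[of k] by (simp add: card_gt_0_iff)
      ultimately show ?case by (simp add: divide_le_eq)
    qed
  qed
  have lower: "0 \<le> partition_entropy \<nu> R" for R
  proof -
    have "measure \<nu> A * ln (measure \<nu> A) \<le> 0" for A
    proof (cases "measure \<nu> A = 0")
      case False
      then have "0 < measure \<nu> A" by (simp add: zero_less_measure_iff)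
      then have "ln (measure \<nu> A) \<le> 0" using \<nu>.prob_le_1[of A] ln_le_cancel_iff[of "measure \<nu> A" 1] by simp
      then show ?thesis by (simp add: mult_nonneg_nonpos)
    qed simp
    then show ?thesis unfolding partition_entropy_def by (simp add: sum_nonpos)
  qed
  show ?thesis
  proof (rule order_tendstoI)
    fix e :: real assume "e < 0"
    then show "\<forall>\<^sub>F k in sequentially. e < partition_entropy \<nu> (iterated_partition \<nu> (order_action G) P (Fs k)) / real (card (Fs k))"
      using lower by (intro always_eventually allI) (meson divide_nonneg_nonneg less_le_trans of_nat_0_le_iff)
  next
    fix e :: real assume "0 < e"
    then have "\<forall>\<^sub>F k in sequentially. partition_entropy \<nu> (iterated_partition \<nu> (order_action G) P (Fs k)) / real (card (Fs k)) \<le> e / 2"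
      by (intro upper) simp
    then show "\<forall>\<^sub>F k in sequentially. partition_entropy \<nu> (iterated_partition \<nu> (order_action G) P (Fs k)) / real (card (Fs k)) < e"
      by eventually_elim (use \<open>0 < e\<close> in linarith)
  qed
qed

text \<open>The given Folner sequence makes the value under \<open>THE\<close> unique; without one
  every number would qualify vacuously. The trivial partition makes the supremum one over a nonempty
  set.\<close>

lemma KS_entropy_zero:
  assumes Fs: "folner_sequence G Fs"
  shows "KS_entropy G \<nu> (order_action G) = 0"
proof -
  interpret \<nu>: prob_space \<nu> by (rule prob_space_\<nu>)
  have "entropy_of_partition G \<nu> (order_action G) P = 0" if "measurable_partition \<nu> P" for P
    unfolding entropy_of_partition_def
  proof (rule the_equality)
    show "\<forall>F. folner_sequence G F \<longrightarrow>
        (\<lambda>n. partition_entropy \<nu> (iterated_partition \<nu> (order_action G) P (F n)) / real (card (F n))) \<longlonglongrightarrow> 0"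
      using entropy_rate_zero[OF that] by blast
    fix h assume "\<forall>F. folner_sequence G F \<longrightarrow>
        (\<lambda>n. partition_entropy \<nu> (iterated_partition \<nu> (order_action G) P (F n)) / real (card (F n))) \<longlonglongrightarrow> h"
    then show "h = 0" using Fs entropy_rate_zero[OF that Fs] LIMSEQ_unique by blast
  qed
  moreover have "measurable_partition \<nu> {space \<nu>}"
    using \<nu>.not_empty by (simp add: measurable_partition_def partition_on_space)
  ultimately show ?thesis
    unfolding KS_entropy_def by (intro SUP_eq_const) auto
qed

end

theorem theorem2p6:
  fixes G :: "('g, 'b) monoid_scheme"
  assumes "countable_amenable_group G"
  shows "\<exists>\<nu>. multiorder G \<nu> \<and> KS_entropy G \<nu> (order_action G) = 0"
proof -
  interpret group G using assms by (simp add: countable_amenable_group_def)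
  obtain Fs where Fs: "folner_sequence G Fs" and "infinite (carrier G)" "countable (carrier G)"
    using assms by (auto simp: countable_amenable_group_def)
  then obtain F K B Bad \<phi> where "tiling_sequence G F K B Bad \<phi>" using ex_tiling_sequence by blast
  then obtain \<mu> where "tiling_system G F K B Bad \<phi> \<mu>" using tiling_sequence.ex_tiling_system by blast
  then interpret tiling_system G F K B Bad \<phi> \<mu> .
  show ?thesis using multiorder_\<nu> KS_entropy_zero[OF Fs] by blast
qed

end
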